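(* Let $M$ be a $C^\infty$ real hypersurface in $\mathbb{C}^{n+1}$ ($n\ge1$) and $p\in M$, and suppose $M$ admits a good coordinate at $p$. If the Bloom-Graham type of $M$ at $p$ is infinity, then the following three conditions are equivalent: (i) there exists $\gamma\in\Gamma$ tangent to $M$ at $p$ to infinite order; (ii) there exists a good coordinate $(z,w)$ for $M$ at $p$ and some $\hat\gamma\in\hat\Gamma$ such that $(F\circ\hat\gamma)(t)$ is flat at $t=0$; (iii) there exists a good coordinate $(z,w)$ for $M$ at $p$ and some $\hat\gamma\in\hat\Gamma$ such that the formal power series $(\mathcal{S}\circ\hat\gamma)(t)$ converges on an open neighborhood of $t=0$.
   Context: A good coordinate for $M$ at $p$ is a holomorphic coordinate $(z,w)=(z_1,\dots,z_n,w)$ centered at $p$ in which $M$ has the local defining function $r=2\operatorname{Re}(w)+F(z,\bar z)$, with $F$ real-valued $C^\infty$ near $0\in\mathbb{C}^n$, $F(0)=0$, $\nabla F(0)=0$. Bloom-Graham type: an $n$-dimensional complex submanifold $X\ni p$ is tangent to $M$ at $p$ to order $m$ if $r|_X$ vanishes to order at least $m$ at $p$; the type is infinity if such $X$ exist for every $m$. When the Bloom-Graham type is infinity, the Taylor series of $F$ at $0$ consists only of pure terms (monomials $z^\alpha$ or $\bar z^\beta$) and can be written $2\sum_{\alpha\in\mathbb{Z}_+^n}\operatorname{Re}(c_\alpha z^\alpha)$ with $c_\alpha\in\mathbb{C}$; set $\mathcal{S}(z)=\sum_\alpha c_\alpha z^\alpha$ (formal). $\hat\Gamma$ is the set of germs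 of nonconstant holomorphic maps $\hat\gamma=(\hat\gamma_1,\dots,\hat\gamma_n):(\mathbb{C},0)\to(\mathbb{C}^n,0)$; if $\hat\gamma_j(t)=\sum_{k\ge1}a_{jk}t^k$, then $(\mathcal{S}\circ\hat\gamma)(t)=\sum_\alpha c_\alpha\prod_j(\sum_k a_{jk}t^k)^{\alpha_j}$, expanded formally as a power series in $t$. A smooth function of $t$ is flat at $0$ if all its Taylor coefficients at $0$ vanish. $\Gamma$ is the set of germs of nonconstant holomorphic maps $\gamma:(\mathbb{C},0)\to(\mathbb{C}^{n+1},p)$ (good parametrization); $\gamma$ is tangent to $M$ at $p$ to infinite order if $(r\circ\gamma)(t)=O(t^N)$ as $t\to0$ for all $N\in\mathbb{N}$. *)

theory Defs
  imports "HOL-Analysis.Analysis" "HOL-Library.Landau_Symbols"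
    "HOL-Library.Multiset" "HOL-Computational_Algebra.Formal_Power_Series"
begin

text \<open>Ambient space C^(n+1) is modelled as complex^('n option): the coordinate
  indexed by Some j is z_j, the coordinate indexed by None is w.\<close>

definition zpart :: "complex^('n::finite option) \<Rightarrow> complex^'n" where
  "zpart x = (\<chi> j. x $ Some j)"

definition wpart :: "complex^('n::finite option) \<Rightarrow> complex" where
  "wpart x = x $ None"

fun dderiv :: "'a list \<Rightarrow> ('a::real_normed_vector \<Rightarrow> 'b::real_normed_vector) \<Rightarrow> 'a \<Rightarrow> 'b" where
  "dderiv [] g = g"
| "dderiv (v # vs) g = dderiv vs (\<lambda>x. frechet_derivative g (at x) v)"

definition smooth_on :: "'a set \<Rightarrow> ('a::real_normed_vector \<Rightarrow> 'b::real_normed_vector) \<Rightarrow> bool" where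
  "smooth_on U g \<longleftrightarrow> open U \<and> (\<forall>vs. \<forall>x\<in>U. dderiv vs g differentiable (at x))"

definition holo_map_on :: "(complex^'a::finite) set \<Rightarrow> (complex^'a \<Rightarrow> complex^'b::finite) \<Rightarrow> bool" where
  "holo_map_on U f \<longleftrightarrow> open U \<and> (\<forall>x\<in>U. \<exists>L. (f has_derivative L) (at x) \<and>
      (\<forall>c v. L (c *s v) = c *s L v))"

definition local_defining_fn ::
  "(complex^('n::finite option)) set \<Rightarrow> complex^('n option) \<Rightarrow> (complex^('n option)) set
    \<Rightarrow> (complex^('n option) \<Rightarrow> real) \<Rightarrow> bool" where
  "local_defining_fn M q U r \<longleftrightarrow> open U \<and> q \<in> U \<and> smooth_on U r \<and>
     frechet_derivative r (at q) \<noteq> (\<lambda>v. 0) \<and> M \<inter> U = {x\<in>U. r x = 0}"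

definition real_hypersurface :: "(complex^('n::finite option)) set \<Rightarrow> bool" where
  "real_hypersurface M \<longleftrightarrow> (\<forall>q\<in>M. \<exists>U r. local_defining_fn M q U r)"

definition good_coord ::
  "(complex^('n::finite option)) set \<Rightarrow> complex^('n option) \<Rightarrow> (complex^('n option)) set
    \<Rightarrow> (complex^('n option) \<Rightarrow> complex^('n option)) \<Rightarrow> (complex^'n) set
    \<Rightarrow> (complex^'n \<Rightarrow> real) \<Rightarrow> bool" where
  "good_coord M p U \<Phi> W F \<longleftrightarrow>
     open U \<and> p \<in> U \<and> holo_map_on U \<Phi> \<and> inj_on \<Phi> U \<and> open (\<Phi> ` U) \<and>
     holo_map_on (\<Phi> ` U) (inv_into U \<Phi>) \<and> \<Phi> p = 0 \<and>
     open W \<and> 0 \<in> W \<and> smooth_on W F \<and> F 0 = 0 \<and> (F has_derivative (\<lambda>v. 0)) (at 0) \<and>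
     (\<forall>x\<in>U. zpart (\<Phi> x) \<in> W) \<and>
     M \<inter> U = {x\<in>U. 2 * Re (wpart (\<Phi> x)) + F (zpart (\<Phi> x)) = 0}"

text \<open>Bloom-Graham type infinity: for every m there is an n-dimensional complex
  submanifold X through p (given by a holomorphic immersion phi of a neighbourhood of
  0 in C^n, phi 0 = p) with r restricted to X vanishing to order at least m at p.\<close>
definition bg_type_infinite :: "(complex^('n::finite option)) set \<Rightarrow> complex^('n option) \<Rightarrow> bool" where
  "bg_type_infinite M p \<longleftrightarrow> (\<exists>U r. local_defining_fn M p U r \<and>
     (\<forall>m::nat. \<exists>V (\<phi> :: complex^'n \<Rightarrow> complex^('n option)).
        0 \<in> V \<and> holo_map_on V \<phi> \<and> \<phi> 0 = p \<and> inj (frechet_derivative \<phi> (at 0)) \<and>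
        (\<lambda>\<zeta>. r (\<phi> \<zeta>)) \<in> O[at 0](\<lambda>\<zeta>. norm \<zeta> ^ m)))"

definition Gamma :: "complex^('n::finite option) \<Rightarrow> (complex \<Rightarrow> complex^('n option)) set" where
  "Gamma p = {\<gamma>. (\<exists>\<epsilon>>0. \<forall>j. (\<lambda>t. \<gamma> t $ j) holomorphic_on ball 0 \<epsilon>) \<and> \<gamma> 0 = p \<and>
                 \<not> eventually (\<lambda>t. \<gamma> t = \<gamma> 0) (nhds 0)}"

definition Gamma_hat :: "(complex \<Rightarrow> complex^('n::finite)) set" where
  "Gamma_hat = {\<gamma>. (\<exists>\<epsilon>>0. \<forall>j. (\<lambda>t. \<gamma> t $ j) holomorphic_on ball 0 \<epsilon>) \<and> \<gamma> 0 = 0 \<and>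
                 \<not> eventually (\<lambda>t. \<gamma> t = \<gamma> 0) (nhds 0)}"

definition flat_at0 :: "(complex \<Rightarrow> real) \<Rightarrow> bool" where
  "flat_at0 g \<longleftrightarrow> (\<forall>vs. dderiv vs g 0 = 0)"

definition wirt :: "'n::finite \<Rightarrow> (complex^'n \<Rightarrow> complex) \<Rightarrow> complex^'n \<Rightarrow> complex" where
  "wirt j g x = (frechet_derivative g (at x) (axis j 1) - \<i> * frechet_derivative g (at x) (axis j \<i>)) / 2"

definition mi_list :: "('n::finite \<Rightarrow> nat) \<Rightarrow> 'n list" where
  "mi_list \<alpha> = (SOME js. \<forall>j. count (mset js) j = \<alpha> j)"

text \<open>c_alpha = coefficient of z^alpha in the Taylor series of F at 0
  = (d/dz)^alpha F (0) / alpha!.\<close>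
definition c_coeff :: "(complex^'n::finite \<Rightarrow> real) \<Rightarrow> ('n \<Rightarrow> nat) \<Rightarrow> complex" where
  "c_coeff F \<alpha> = foldr wirt (mi_list \<alpha>) (\<lambda>z. complex_of_real (F z)) 0
                   / of_nat (\<Prod>j\<in>UNIV. fact (\<alpha> j))"

definition ghat_fps :: "(complex \<Rightarrow> complex^'n::finite) \<Rightarrow> 'n \<Rightarrow> complex fps" where
  "ghat_fps \<gamma> j = Abs_fps (\<lambda>k. (deriv ^^ k) (\<lambda>t. \<gamma> t $ j) 0 / fact k)"

text \<open>The formal series S o gamma-hat; the coefficient of t^k only receives
  contributions from |alpha| <= k (all other terms have order > k), so the sum
  over {alpha. all alpha j <= k} is exactly the coefficient of t^k.\<close>
definition S_comp :: "(complex^'n::finite \<Rightarrow> real) \<Rightarrow> (complex \<Rightarrow> complex^'n) \<Rightarrow> complex fps" where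
  "S_comp F \<gamma> = Abs_fps (\<lambda>k. \<Sum>\<alpha>\<in>{\<alpha>::'n\<Rightarrow>nat. \<forall>j. \<alpha> j \<le> k}.
       c_coeff F \<alpha> * fps_nth (\<Prod>j\<in>UNIV. ghat_fps \<gamma> j ^ \<alpha> j) k)"

definition fps_converges_near0 :: "complex fps \<Rightarrow> bool" where
  "fps_converges_near0 P \<longleftrightarrow> (\<exists>\<epsilon>>0. \<forall>t. cmod t < \<epsilon> \<longrightarrow> summable (\<lambda>k. fps_nth P k * t ^ k))"

end

theory Submission
  imports Defs "HOL-Complex_Analysis.Complex_Analysis"
begin

text \<open>
  If \<open>M\<close> is tangent to complex hypersurfaces to every order, then in a good coordinate the Taylor
  series of \<open>F\<close> is \<open>2 Re S\<close> with \<open>S\<close> a formal holomorphic series: along a tangent disc the first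
  homogeneous part of \<open>F\<close> that could contain mixed terms is harmonic in the parameter, for every
  direction of the disc. Hence \<open>F \<circ> \<gamma>\<close> has the Taylor series \<open>2 Re (S \<circ> \<gamma>)\<close> for every holomorphic
  curve \<open>\<gamma>\<close> in \<open>z\<close>-space, and a curve \<open>(\<gamma>, h)\<close> is tangent to \<open>M\<close> to infinite order iff
  \<open>h = - S \<circ> \<gamma>\<close> formally. So flatness of \<open>F \<circ> \<gamma>\<close> means \<open>S \<circ> \<gamma> = 0\<close>, and convergence of \<open>S \<circ> \<gamma>\<close>
  supplies \<open>h\<close>.

  To pass from a tangent curve \<open>(\<gamma>, h)\<close> to flatness one needs a convergent \<open>g(z)\<close> with
  \<open>g \<circ> \<gamma> = h\<close>; the coordinate \<open>w' = w - g(z)\<close> then makes \<open>F \<circ> \<gamma>\<close> flat. Reparametrize so that one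
  component of \<open>\<gamma>\<close> is \<open>t\<^sup>m\<close>. The functions \<open>P \<circ> \<gamma>\<close>, with \<open>P\<close> a polynomial of order at least two,
  form a module over \<open>\<complex>[t\<^sup>m]\<close>, and \<open>h\<close> lies in its formal closure. Division by elements of least
  order in each residue class modulo \<open>m\<close> expresses \<open>h\<close> by finitely many of them with convergent
  coefficients in \<open>t\<^sup>m\<close>.
\<close>

subsection \<open>Smooth functions\<close>

text \<open>In the step from a tangent curve to flatness, S may diverge although S \<circ> \<gamma>
  converges. So neither S nor a truncation of it can serve as the coordinate change: g has to
  converge, and it can agree with the formal solution only along the curve. The reparametrization
  makes multiplication by one coordinate function act as multiplication by \<open>t ^ m\<close>;
  power series in t have rank m over power series in \<open>t ^ m\<close>, which is why m divisors
  are enough. Order at least two is imposed on the polynomials because a shear of w by g(z) gives a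
  good coordinate again only if g has neither a constant nor a linear part.

  Two more difficulties come from the definitions. Tangency and type refer to an arbitrary defining
  function r, so \<bar>r\<bar> and \<bar>2 Re w + F\<bar> are compared near p in both directions, by
  Lipschitz estimates. And F is merely smooth, so Taylor series are handled through orders of
  vanishing at 0; such estimates are differentiated by means of Taylor polynomials.\<close>

lemma frechet_derivative_eqI:
  "(f has_derivative f') (at x) \<Longrightarrow> frechet_derivative f (at x) = f'"
  by (metis frechet_derivative_at)

lemma frechet_derivative_cong_open:
  assumes "open U" "x \<in> U" "\<And>y. y \<in> U \<Longrightarrow> f y = g y"
  shows "frechet_derivative f (at x) = frechet_derivative g (at x)"
proof -
  have "(f has_derivative f') (at x) \<longleftrightarrow> (g has_derivative f') (at x)" for f'
    using assms has_derivative_transform_within_open by metis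
  then show ?thesis
    unfolding frechet_derivative_def by simp
qed

lemma differentiable_cong_open:
  assumes "open U" "x \<in> U" "\<And>y. y \<in> U \<Longrightarrow> f y = g y" "f differentiable at x"
  shows "g differentiable at x"
  using assms by (meson differentiable_def has_derivative_transform_within_open)

lemma dderiv_cong_open:
  assumes "open U" "x \<in> U" "\<And>y. y \<in> U \<Longrightarrow> f y = g y"
  shows "dderiv vs f x = dderiv vs g x"
  using assms(2,3)
proof (induction vs arbitrary: f g x)
  case (Cons v vs)
  have "frechet_derivative f (at y) v = frechet_derivative g (at y) v" if "y \<in> U" for y
    by (rule fun_cong[OF frechet_derivative_cong_open[OF assms(1) that]]) (simp add: Cons.prems)
  from Cons.IH[OF Cons.prems(1) this] show ?case
    by simp
qed simp

lemma smooth_on_open: "smooth_on U f \<Longrightarrow> open U"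
  by (simp add: smooth_on_def)

lemma smooth_on_differentiable: "smooth_on U f \<Longrightarrow> x \<in> U \<Longrightarrow> f differentiable at x"
  unfolding smooth_on_def by (metis dderiv.simps(1))

lemma smooth_on_has_derivative:
  "smooth_on U f \<Longrightarrow> x \<in> U \<Longrightarrow> (f has_derivative frechet_derivative f (at x)) (at x)"
  using smooth_on_differentiable frechet_derivative_works by blast

lemma smooth_on_frechet_derivative:
  "smooth_on U f \<Longrightarrow> smooth_on U (\<lambda>x. frechet_derivative f (at x) v)"
  unfolding smooth_on_def by (metis dderiv.simps(2))

lemma smooth_on_subset: "smooth_on U f \<Longrightarrow> open V \<Longrightarrow> V \<subseteq> U \<Longrightarrow> smooth_on V f"
  unfolding smooth_on_def by blast

lemma smooth_on_continuous: "smooth_on U f \<Longrightarrow> continuous_on U f"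
  by (meson continuous_at_imp_continuous_on differentiable_imp_continuous_within smooth_on_differentiable)

text \<open>Product and chain rules turn one generator into a sum of generators, so the families in
  the smoothness proofs are stable under differentiation only up to addition.\<close>

inductive_set add_closure :: "('a \<Rightarrow> 'b::real_normed_vector) set \<Rightarrow> ('a \<Rightarrow> 'b) set" for X where
  base: "f \<in> X \<Longrightarrow> f \<in> add_closure X"
| zero: "(\<lambda>x. 0) \<in> add_closure X"
| add: "f \<in> add_closure X \<Longrightarrow> g \<in> add_closure X \<Longrightarrow> (\<lambda>x. f x + g x) \<in> add_closure X"

lemma add_closure_sum:
  assumes "finite I" "\<And>i. i \<in> I \<Longrightarrow> f i \<in> add_closure X"
  shows "(\<lambda>x. \<Sum>i\<in>I. f i x) \<in> add_closure X"
  using assms by (induction I) (auto intro: add_closure.intros)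

text \<open>A coinduction principle: if all members of a family are differentiable and their
  directional derivatives are sums of members, then derivatives of every order exist. It takes the
  place of Leibniz and Faa di Bruno formulas for \<open>dderiv\<close>.\<close>

lemma smooth_on_coinduct_add:
  assumes U: "open U" and f: "f \<in> add_closure X"
    and X: "\<And>g x. g \<in> X \<Longrightarrow> x \<in> U \<Longrightarrow> g differentiable at x"
      "\<And>g v. g \<in> X \<Longrightarrow> \<exists>h\<in>add_closure X. \<forall>x\<in>U. frechet_derivative g (at x) v = h x"
  shows "smooth_on U f"
proof -
  have clo: "(\<forall>x\<in>U. g differentiable at x) \<and>
      (\<forall>v. \<exists>h\<in>add_closure X. \<forall>x\<in>U. frechet_derivative g (at x) v = h x)"
    if "g \<in> add_closure X" for g
    using that
  proof (induction rule: add_closure.induct)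
    case zero
    then show ?case by (auto intro: add_closure.zero)
  next
    case (add f g)
    have "frechet_derivative (\<lambda>x. f x + g x) (at x) v
        = frechet_derivative f (at x) v + frechet_derivative g (at x) v" if "x \<in> U" for x v
    proof -
      have "((\<lambda>x. f x + g x) has_derivative
          (\<lambda>v. frechet_derivative f (at x) v + frechet_derivative g (at x) v)) (at x)"
        using add.IH that by (intro has_derivative_add) (auto simp: frechet_derivative_works)
      from frechet_derivative_eqI[OF this] show ?thesis by simp
    qed
    moreover have "\<exists>h\<in>add_closure X. \<forall>x\<in>U. frechet_derivative f (at x) v
        + frechet_derivative g (at x) v = h x" for v
    proof -
      obtain h k where "h \<in> add_closure X" "\<forall>x\<in>U. frechet_derivative f (at x) v = h x"
          "k \<in> add_closure X" "\<forall>x\<in>U. frechet_derivative g (at x) v = k x"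
        using add.IH by blast
      then show ?thesis
        by (intro bexI[of _ "\<lambda>x. h x + k x"]) (auto intro: add_closure.add)
    qed
    ultimately show ?case
      using add.IH by (auto intro: differentiable_add)
  qed (use X in auto)
  have iter: "\<exists>h\<in>add_closure X. \<forall>x\<in>U. dderiv vs g x = h x" if "g \<in> add_closure X" for vs g
    using that
  proof (induction vs arbitrary: g)
    case (Cons v vs)
    then obtain h where h: "h \<in> add_closure X" "\<forall>x\<in>U. frechet_derivative g (at x) v = h x"
      using clo by blast
    then show ?case
      using Cons.IH[OF h(1)] dderiv_cong_open[OF U, where vs = vs and g = h] by fastforce
  qed auto
  have "dderiv vs f differentiable at x" if "x \<in> U" for vs x
  proof -
    obtain h where "h \<in> add_closure X" "\<forall>x\<in>U. dderiv vs f x = h x"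
      using iter[of f vs] f by blast
    then show ?thesis
      using clo differentiable_cong_open[OF U that, of h "dderiv vs f"] that by simp
  qed
  then show ?thesis
    using U by (simp add: smooth_on_def)
qed

lemmas smooth_on_coinduct = smooth_on_coinduct_add[OF _ add_closure.base]

lemma smooth_on_const: "open U \<Longrightarrow> smooth_on U (\<lambda>x. c)"
  by (rule smooth_on_coinduct[where X = "range (\<lambda>c x. c)"]) (auto intro!: add_closure.zero)

lemma smooth_on_bounded_linear:
  assumes "open U" "bounded_linear f" shows "smooth_on U f"
proof (rule smooth_on_coinduct[where X = "insert f (range (\<lambda>c x. c))"])
  show "\<exists>h\<in>add_closure (insert f (range (\<lambda>c x. c))). \<forall>x\<in>U. frechet_derivative g (at x) v = h x"
    if "g \<in> insert f (range (\<lambda>c x. c))" for g v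
  proof (cases "g = f")
    case True
    then have "frechet_derivative g (at x) v = f v" for x
      using assms(2) by (metis bounded_linear_imp_has_derivative frechet_derivative_eqI)
    then show ?thesis by (intro bexI[of _ "\<lambda>x. f v"]) (auto intro: add_closure.base)
  qed (use that in \<open>auto intro!: add_closure.zero\<close>)
qed (use assms in \<open>auto intro: bounded_linear_imp_differentiable\<close>)

lemma smooth_on_add:
  assumes "smooth_on U f" "smooth_on U g"
  shows "smooth_on U (\<lambda>x. f x + g x)"
proof (rule smooth_on_coinduct_add[where X = "Collect (smooth_on U)"])
  show "(\<lambda>x. f x + g x) \<in> add_closure (Collect (smooth_on U))"
    using assms by (intro add_closure.add add_closure.base) auto
  fix g :: "'a \<Rightarrow> 'b" and v
  assume "g \<in> Collect (smooth_on U)"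
  then have "(\<lambda>x. frechet_derivative g (at x) v) \<in> add_closure (Collect (smooth_on U))"
    by (intro add_closure.base) (simp add: smooth_on_frechet_derivative)
  then show "\<exists>h\<in>add_closure (Collect (smooth_on U)). \<forall>x\<in>U. frechet_derivative g (at x) v = h x"
    by (rule bexI[rotated]) simp
qed (use assms in \<open>auto simp: smooth_on_open smooth_on_differentiable\<close>)

text \<open>The family of all \<open>B (f x) (g x)\<close> with smooth factors is stable: the
  Leibniz rule yields two members, each with one factor differentiated.\<close>

lemma smooth_on_bilinear:
  assumes B: "bounded_bilinear B" and "smooth_on U f" "smooth_on U g"
  shows "smooth_on U (\<lambda>x. B (f x) (g x))"
proof -
  define X where "X = {\<lambda>x. B (f x) (g x) |f g. smooth_on U f \<and> smooth_on U g}"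
  have mem: "(\<lambda>x. B (f x) (g x)) \<in> X" if "smooth_on U f" "smooth_on U g" for f g
    unfolding X_def using that by blast
  have der: "((\<lambda>x. B (f x) (g x)) has_derivative (\<lambda>v. B (f x) (frechet_derivative g (at x) v)
      + B (frechet_derivative f (at x) v) (g x))) (at x)"
    if "smooth_on U f" "smooth_on U g" "x \<in> U" for f g x
    using that by (intro bounded_bilinear.FDERIV[OF B] smooth_on_has_derivative)
  show ?thesis
  proof (rule smooth_on_coinduct[where X = X])
    fix h v
    assume "h \<in> X"
    then obtain f g where h: "h = (\<lambda>x. B (f x) (g x))" "smooth_on U f" "smooth_on U g"
      unfolding X_def by blast
    have "\<forall>x\<in>U. frechet_derivative h (at x) v
        = B (f x) (frechet_derivative g (at x) v) + B (frechet_derivative f (at x) v) (g x)"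
      unfolding h(1) using frechet_derivative_eqI[OF der[OF h(2,3)]] by simp
    moreover have "(\<lambda>x. B (f x) (frechet_derivative g (at x) v)
        + B (frechet_derivative f (at x) v) (g x)) \<in> add_closure X"
      by (rule add_closure.add; rule add_closure.base; rule mem)
        (simp_all add: h smooth_on_frechet_derivative)
    ultimately show "\<exists>k\<in>add_closure X. \<forall>x\<in>U. frechet_derivative h (at x) v = k x"
      by (rule bexI)
  next
    fix h x
    assume "h \<in> X" "x \<in> U"
    then obtain f g where "h = (\<lambda>x. B (f x) (g x))" "smooth_on U f" "smooth_on U g"
      unfolding X_def by blast
    then show "h differentiable at x"
      using der[OF _ _ \<open>x \<in> U\<close>] unfolding differentiable_def by blast
  qed (use assms mem smooth_on_open in auto)
qed

lemmas smooth_on_scaleR = smooth_on_bilinear[OF bounded_bilinear_scaleR]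
lemmas smooth_on_inner = smooth_on_bilinear[OF bounded_bilinear_inner]
lemmas smooth_on_mult = smooth_on_bilinear[OF bounded_bilinear_mult]

text \<open>The members of the family carry a scalar factor \<open>k\<close> because the chain rule,
  expanded in a basis of the middle space, multiplies partial derivatives of \<open>G\<close> by
  components of the derivative of \<open>f\<close>.\<close>

lemma smooth_on_compose:
  fixes f :: "'a::real_normed_vector \<Rightarrow> 'b::euclidean_space" and G :: "'b \<Rightarrow> 'c::real_normed_vector"
  assumes "smooth_on U f" "smooth_on W G" "f ` U \<subseteq> W"
  shows "smooth_on U (\<lambda>x. G (f x))"
proof -
  define X where "X = {\<lambda>x. k x *\<^sub>R G (f x) |(k :: 'a \<Rightarrow> real) (G :: 'b \<Rightarrow> 'c).
    smooth_on U k \<and> smooth_on W G}"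
  have mem: "(\<lambda>x. k x *\<^sub>R G (f x)) \<in> X" if "smooth_on U k" "smooth_on W G"
    for k :: "'a \<Rightarrow> real" and G :: "'b \<Rightarrow> 'c"
    unfolding X_def using that by blast
  have der: "((\<lambda>x. k x *\<^sub>R G (f x)) has_derivative (\<lambda>v. k x *\<^sub>R
        frechet_derivative G (at (f x)) (frechet_derivative f (at x) v)
        + frechet_derivative k (at x) v *\<^sub>R G (f x))) (at x)"
    if "smooth_on U k" "smooth_on W G" "x \<in> U" for k :: "'a \<Rightarrow> real" and G :: "'b \<Rightarrow> 'c" and x
    using that assms
    by (intro has_derivative_scaleR has_derivative_compose[of f _ _ _ G] smooth_on_has_derivative) auto
  have "smooth_on U (\<lambda>x. 1 *\<^sub>R G (f x))"
  proof (rule smooth_on_coinduct[where X = X])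
    show "open U" using assms smooth_on_open by blast
    show "(\<lambda>x. 1 *\<^sub>R G (f x)) \<in> X"
      using smooth_on_const[OF smooth_on_open[OF assms(1)]] assms(2) by (rule mem)
    show "g differentiable at x" if "g \<in> X" "x \<in> U" for g x
    proof -
      from that obtain k G where g: "g = (\<lambda>x. k x *\<^sub>R G (f x))" "smooth_on U k" "smooth_on W G"
        unfolding X_def by blast
      show ?thesis
        unfolding g(1) by (rule differentiableI[OF der[OF g(2,3) that(2)]])
    qed
    show "\<exists>h\<in>add_closure X. \<forall>x\<in>U. frechet_derivative g (at x) v = h x" if "g \<in> X" for g v
    proof -
      from that obtain k G where g: "g = (\<lambda>x. k x *\<^sub>R G (f x))" "smooth_on U k" "smooth_on W G"
        unfolding X_def by blast
      define h where "h = (\<lambda>x. (\<Sum>b\<in>Basis. (k x * (frechet_derivative f (at x) v \<bullet> b)) *\<^sub>R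
          frechet_derivative G (at (f x)) b) + frechet_derivative k (at x) v *\<^sub>R G (f x))"
      have lin: "k x *\<^sub>R frechet_derivative G (at (f x)) (frechet_derivative f (at x) v)
          = (\<Sum>b\<in>Basis. (k x * (frechet_derivative f (at x) v \<bullet> b)) *\<^sub>R
          frechet_derivative G (at (f x)) b)" if "x \<in> U" for x
      proof -
        have "linear (frechet_derivative G (at (f x)))"
          using that g assms smooth_on_differentiable linear_frechet_derivative by blast
        then have "frechet_derivative G (at (f x)) (frechet_derivative f (at x) v)
          = (\<Sum>b\<in>Basis. (frechet_derivative f (at x) v \<bullet> b) *\<^sub>R frechet_derivative G (at (f x)) b)"
          by (subst euclidean_representation[symmetric, of "frechet_derivative f (at x) v"])
            (simp only: linear_sum linear_cmul)
        then show ?thesis by (simp add: scaleR_sum_right)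
      qed
      have "\<forall>x\<in>U. frechet_derivative g (at x) v = h x"
        unfolding g(1) h_def using lin by (simp add: frechet_derivative_eqI[OF der[OF g(2,3)]] del: scaleR_scaleR)
      moreover have "smooth_on U (\<lambda>x. k x * (frechet_derivative f (at x) v \<bullet> b))" for b
        using assms g by (intro smooth_on_mult smooth_on_inner smooth_on_frechet_derivative
            smooth_on_const) (auto simp: smooth_on_open)
      then have "h \<in> add_closure X"
        unfolding h_def using g(2,3)
        by (intro add_closure.add add_closure_sum add_closure.base mem finite_Basis
            smooth_on_frechet_derivative)
      ultimately show ?thesis by (rule bexI)
    qed
  qed
  then show ?thesis by simp
qed

lemma smooth_on_linear_compose:
  assumes "smooth_on U f" "bounded_linear L"
  shows "smooth_on U (\<lambda>x. L (f x))"
  using smooth_on_bilinear[OF bounded_bilinear.comp[OF bounded_bilinear_scaleR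
      bounded_linear_ident assms(2)] smooth_on_const[OF smooth_on_open, of U f 1]] assms(1) by simp

lemma smooth_on_diff:
  assumes "smooth_on U f" "smooth_on U g"
  shows "smooth_on U (\<lambda>x. f x - g x)"
  using smooth_on_add[OF assms(1) smooth_on_linear_compose[OF assms(2)
      bounded_linear_minus[OF bounded_linear_ident]]] by simp

lemma smooth_on_sum:
  assumes "open U" "finite I" "\<And>i. i \<in> I \<Longrightarrow> smooth_on U (f i)"
  shows "smooth_on U (\<lambda>x. \<Sum>i\<in>I. f i x)"
  using assms(2,3) by (induction I) (auto intro: smooth_on_add smooth_on_const assms(1))

lemma smooth_on_prod:
  fixes f :: "'i \<Rightarrow> 'a::real_normed_vector \<Rightarrow> 'b::{real_normed_field}"
  assumes "open U" "finite I" "\<And>i. i \<in> I \<Longrightarrow> smooth_on U (f i)"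
  shows "smooth_on U (\<lambda>x. \<Prod>i\<in>I. f i x)"
  using assms(2,3) by (induction I) (auto intro: smooth_on_mult smooth_on_const assms(1))

lemma smooth_on_power:
  fixes f :: "'a::real_normed_vector \<Rightarrow> 'b::{real_normed_field}"
  assumes "smooth_on U f"
  shows "smooth_on U (\<lambda>x. f x ^ k)"
  using smooth_on_prod[of U "{..<k}" "\<lambda>i. f"] assms by (simp add: smooth_on_open)

text \<open>The constant factor \<open>c\<close> in the family absorbs the direction of
  differentiation: along \<open>v\<close> it becomes \<open>v * c\<close>, and the other factor
  stays holomorphic.\<close>

lemma smooth_on_holomorphic:
  assumes "f holomorphic_on U" "open U"
  shows "smooth_on U f"
proof -
  define X where "X = {\<lambda>x. g x * c |g c. g holomorphic_on U}"
  have mem: "(\<lambda>x. g x * c) \<in> X" if "g holomorphic_on U" for g c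
    unfolding X_def using that by blast
  have der: "((\<lambda>x. g x * c) has_derivative (\<lambda>v. deriv g x * (v * c))) (at x)"
    if "g holomorphic_on U" "x \<in> U" for g c x
  proof -
    have "((\<lambda>x. g x * c) has_field_derivative deriv g x * c) (at x)"
      using that assms(2) holomorphic_derivI DERIV_cmult_right by blast
    moreover have "(*) (deriv g x * c) = (\<lambda>v. deriv g x * (v * c))"
      by (auto simp: mult_ac)
    ultimately show ?thesis
      by (simp add: has_field_derivative_def)
  qed
  have "smooth_on U (\<lambda>x. f x * 1)"
  proof (rule smooth_on_coinduct[where X = X])
    fix g v
    assume "g \<in> X"
    then obtain k c where g: "g = (\<lambda>x. k x * c)" "k holomorphic_on U"
      unfolding X_def by blast
    have "\<forall>x\<in>U. frechet_derivative g (at x) v = deriv k x * (v * c)"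
      unfolding g(1) using frechet_derivative_eqI[OF der[OF g(2)]] by simp
    moreover have "(\<lambda>x. deriv k x * (v * c)) \<in> add_closure X"
      using g(2) assms(2) by (intro add_closure.base mem holomorphic_deriv)
    ultimately show "\<exists>h\<in>add_closure X. \<forall>x\<in>U. frechet_derivative g (at x) v = h x"
      by (rule bexI)
  next
    fix g x
    assume "g \<in> X" "x \<in> U"
    then obtain k c where g: "g = (\<lambda>x. k x * c)" "k holomorphic_on U"
      unfolding X_def by blast
    show "g differentiable at x"
      unfolding g(1) by (rule differentiableI[OF der[OF g(2) \<open>x \<in> U\<close>]])
  qed (use assms mem[OF assms(1), of 1] in auto)
  then show ?thesis by simp
qed

lemma bounded_linear_axis: "bounded_linear (axis j :: complex \<Rightarrow> complex^'n::finite)"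
  unfolding linear_conv_bounded_linear[symmetric]
  by (intro linearI) (auto simp: axis_def vec_eq_iff)

lemma sum_axis_cvec: "(\<Sum>j\<in>UNIV. axis j (x $ j)) = (x :: complex^'n::finite)"
  by (simp add: vec_eq_iff axis_def if_distrib cong: if_cong)

lemma smooth_on_vec:
  fixes f :: "'a::real_normed_vector \<Rightarrow> complex^'n::finite"
  assumes "open U" "\<And>j. smooth_on U (\<lambda>x. f x $ j)"
  shows "smooth_on U f"
proof -
  have "smooth_on U (\<lambda>x. \<Sum>j\<in>UNIV. axis j (f x $ j))"
    by (intro smooth_on_sum assms smooth_on_linear_compose[OF _ bounded_linear_axis]) auto
  then show ?thesis by (simp add: sum_axis_cvec)
qed

subsection \<open>Order of vanishing and Taylor expansion\<close>

text \<open>The bound holds on a full neighbourhood including 0 itself, so positive order forces the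
  value 0 at 0, which \<open>O[at 0]\<close> does not. Order 0 is local boundedness.\<close>

definition vanishes :: "nat \<Rightarrow> ('a::real_normed_vector \<Rightarrow> 'b::real_normed_vector) \<Rightarrow> bool" where
  "vanishes m f \<longleftrightarrow> (\<exists>C. \<forall>\<^sub>F z in nhds 0. norm (f z) \<le> C * norm z ^ m)"

lemma vanishesI: "(\<forall>\<^sub>F z in nhds 0. norm (f z) \<le> C * norm z ^ m) \<Longrightarrow> vanishes m f"
  unfolding vanishes_def by blast

lemma vanishesE:
  assumes "vanishes m f"
  obtains C where "C > 0" "\<forall>\<^sub>F z in nhds 0. norm (f z) \<le> C * norm z ^ m"
proof -
  obtain C where C: "\<forall>\<^sub>F z in nhds 0. norm (f z) \<le> C * norm z ^ m"
    using assms unfolding vanishes_def by blast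
  have "\<forall>\<^sub>F z in nhds 0. norm (f z) \<le> (\<bar>C\<bar> + 1) * norm z ^ m"
    using C by eventually_elim (smt (verit) mult_right_mono norm_ge_zero zero_le_power)
  then show thesis
    by (intro that[of "\<bar>C\<bar> + 1"]) auto
qed

lemma vanishes_cong:
  "(\<forall>\<^sub>F z in nhds 0. f z = g z) \<Longrightarrow> vanishes m f \<longleftrightarrow> vanishes m g"
  unfolding vanishes_def
  by (intro ex_cong1 eventually_subst) (auto elim: eventually_mono)

lemma vanishes_zero: "vanishes m (\<lambda>x. 0)"
  by (rule vanishesI[of _ 0]) simp

lemma vanishes_add:
  assumes "vanishes m f" "vanishes m g"
  shows "vanishes m (\<lambda>x. f x + g x)"
proof -
  obtain C D where "\<forall>\<^sub>F z in nhds 0. norm (f z) \<le> C * norm z ^ m"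
      "\<forall>\<^sub>F z in nhds 0. norm (g z) \<le> D * norm z ^ m"
    using assms unfolding vanishes_def by blast
  then have "\<forall>\<^sub>F z in nhds 0. norm (f z + g z) \<le> (C + D) * norm z ^ m"
    by eventually_elim (simp add: distrib_right norm_triangle_mono)
  then show ?thesis by (rule vanishesI)
qed

lemma vanishes_sum:
  "finite I \<Longrightarrow> (\<And>i. i \<in> I \<Longrightarrow> vanishes m (f i)) \<Longrightarrow> vanishes m (\<lambda>x. \<Sum>i\<in>I. f i x)"
  by (induction I rule: finite_induct) (auto intro: vanishes_add vanishes_zero)

lemma vanishes_bilinear:
  assumes B: "bounded_bilinear B" and "vanishes m f" "vanishes n g"
  shows "vanishes (m + n) (\<lambda>x. B (f x) (g x))"
proof -
  obtain K where K: "0 \<le> K" "\<And>a b. norm (B a b) \<le> norm a * norm b * K"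
    using bounded_bilinear.nonneg_bounded[OF B] by blast
  obtain C where C: "C > 0" "\<forall>\<^sub>F z in nhds 0. norm (f z) \<le> C * norm z ^ m"
    using assms(2) by (rule vanishesE)
  obtain D where D: "D > 0" "\<forall>\<^sub>F z in nhds 0. norm (g z) \<le> D * norm z ^ n"
    using assms(3) by (rule vanishesE)
  have "\<forall>\<^sub>F z in nhds 0. norm (B (f z) (g z)) \<le> (C * D * K) * norm z ^ (m + n)"
    using C(2) D(2)
  proof eventually_elim
    case (elim z)
    then have "norm (f z) * norm (g z) * K \<le> (C * norm z ^ m) * (D * norm z ^ n) * K"
      using C(1) K(1) by (intro mult_right_mono mult_mono) auto
    then show ?case
      using K(2)[of "f z" "g z"] by (simp add: power_add mult_ac)
  qed
  then show ?thesis by (rule vanishesI)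
qed

lemmas vanishes_mult = vanishes_bilinear[OF bounded_bilinear_mult]
lemmas vanishes_scaleR = vanishes_bilinear[OF bounded_bilinear_scaleR]

lemma vanishes_const_0: "vanishes 0 (\<lambda>x. c)"
  by (rule vanishesI[of _ "norm c"]) simp

lemma vanishes_linear:
  assumes "vanishes m f" "bounded_linear L"
  shows "vanishes m (\<lambda>x. L (f x))"
  using vanishes_bilinear[OF bounded_bilinear.comp[OF bounded_bilinear_scaleR
      bounded_linear_ident assms(2)] vanishes_const_0 assms(1), of 1] by simp

lemma vanishes_dominated:
  fixes f :: "'a::real_normed_vector \<Rightarrow> 'b::real_normed_vector" and g :: "'a \<Rightarrow> 'c::real_normed_vector"
  assumes "\<forall>\<^sub>F z in nhds 0. norm (f z) \<le> C * norm (g z)" "vanishes m g"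
  shows "vanishes m f"
proof -
  obtain B where "\<forall>\<^sub>F z in nhds 0. norm (g z) \<le> B * norm z ^ m"
    using assms(2) unfolding vanishes_def by blast
  with assms(1) have "\<forall>\<^sub>F z in nhds 0. norm (f z) \<le> (\<bar>C\<bar> * B) * norm z ^ m"
  proof eventually_elim
    case (elim z)
    have "C * norm (g z) \<le> \<bar>C\<bar> * (B * norm z ^ m)"
      using elim(2) by (intro mult_mono) auto
    then show ?case using elim(1) by simp
  qed
  then show ?thesis by (rule vanishesI)
qed

lemma vanishes_uminus: "vanishes m f \<Longrightarrow> vanishes m (\<lambda>x. - f x)"
  unfolding vanishes_def by simp

lemma vanishes_diff: "vanishes m f \<Longrightarrow> vanishes m g \<Longrightarrow> vanishes m (\<lambda>x. f x - g x)"
  using vanishes_add[of m f "\<lambda>x. - g x"] vanishes_uminus[of m g] by simp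

lemma vanishes_mono:
  assumes "vanishes n f" "m \<le> n"
  shows "vanishes m f"
proof -
  obtain C where C: "C > 0" "\<forall>\<^sub>F z in nhds 0. norm (f z) \<le> C * norm z ^ n"
    using assms vanishesE by blast
  have "\<forall>\<^sub>F z in nhds (0::'a). norm z < 1"
    using eventually_nhds_ball[of 1 "0::'a"] by (simp add: ball_def)
  with C(2) have "\<forall>\<^sub>F z in nhds 0. norm (f z) \<le> C * norm z ^ m"
  proof eventually_elim
    case (elim z)
    then have "C * norm z ^ n \<le> C * norm z ^ m"
      using C(1) assms(2) by (intro mult_left_mono power_decreasing) auto
    then show ?case using elim by simp
  qed
  then show ?thesis by (rule vanishesI)
qed

lemma vanishes_inner_const: "vanishes 1 (\<lambda>z::'a::real_inner. z \<bullet> b)"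
  by (rule vanishesI[of _ "norm b"]) (simp add: Cauchy_Schwarz_ineq2 mult.commute)

lemma vanishes_Suc_tendsto:
  assumes "vanishes (Suc m) f" shows "(f \<longlongrightarrow> 0) (nhds 0)"
proof -
  obtain C where C: "\<forall>\<^sub>F z in nhds 0. norm (f z) \<le> C * norm z ^ 1"
    using vanishes_mono[OF assms, of 1] unfolding vanishes_def by auto
  have "((\<lambda>z::'a. C * norm z ^ 1) \<longlongrightarrow> C * norm (0::'a) ^ 1) (nhds 0)"
    by (intro tendsto_intros) (simp add: filterlim_ident)
  then show ?thesis
    using Lim_null_comparison[OF C] by simp
qed

lemma vanishes_compose:
  assumes "vanishes m f" "vanishes 1 g"
  shows "vanishes m (\<lambda>x. f (g x))"
proof -
  obtain C where C: "C > 0" "\<forall>\<^sub>F z in nhds 0. norm (f z) \<le> C * norm z ^ m"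
    using assms vanishesE by blast
  obtain D where D: "D > 0" "\<forall>\<^sub>F z in nhds 0. norm (g z) \<le> D * norm z ^ 1"
    using assms vanishesE by blast
  have "\<forall>\<^sub>F z in nhds 0. norm (f (g z)) \<le> C * norm (g z) ^ m"
    using eventually_compose_filterlim[OF C(2) vanishes_Suc_tendsto[of 0 g]] assms(2) by simp
  then have "\<forall>\<^sub>F z in nhds 0. norm (f (g z)) \<le> (C * D ^ m) * norm z ^ m"
    using D(2)
  proof eventually_elim
    case (elim z)
    have "C * norm (g z) ^ m \<le> C * (D * norm z) ^ m"
      using elim C by (intro mult_left_mono power_mono) auto
    then show ?case using elim by (simp add: power_mult_distrib mult_ac)
  qed
  then show ?thesis by (rule vanishesI)
qed

lemma vanishes_zero_at: "vanishes (Suc m) f \<Longrightarrow> f 0 = 0"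
  unfolding vanishes_def by (auto dest: eventually_nhds_x_imp_x)

lemma continuous_vanishes_0:
  assumes "isCont f 0" shows "vanishes 0 f"
proof -
  have "\<forall>\<^sub>F z in nhds 0. dist (f z) (f 0) < 1"
    using assms by (auto simp: isCont_def tendsto_at_iff_tendsto_nhds dest: tendstoD[of _ _ _ 1])
  then have "\<forall>\<^sub>F z in nhds 0. norm (f z) \<le> (norm (f 0) + 1) * norm z ^ 0"
    by eventually_elim (metis add.commute dist_norm less_eq_real_def mult.right_neutral
        norm_triangle_sub order_trans power_0 add_mono_thms_linordered_semiring(3))
  then show ?thesis by (rule vanishesI)
qed

lemma differentiable_vanishes_1:
  assumes "f differentiable at 0" "f 0 = 0" shows "vanishes 1 f"
proof -
  obtain L where L: "(f has_derivative L) (at 0)"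
    using assms differentiable_def by blast
  then obtain K where K: "\<And>x. norm (L x) \<le> norm x * K"
    using has_derivative_bounded_linear bounded_linear.bounded by blast
  obtain d where d: "d > 0" "\<And>y. norm (y - 0) < d \<Longrightarrow> norm (f y - f 0 - L (y - 0)) \<le> 1 * norm (y - 0)"
    using L unfolding has_derivative_at_alt by (meson zero_less_one)
  have "\<forall>\<^sub>F z in nhds (0::'a). norm z < d"
    using eventually_nhds_ball[of d "0::'a"] d by (simp add: ball_def)
  then have "\<forall>\<^sub>F z in nhds 0. norm (f z) \<le> (1 + K) * norm z ^ 1"
  proof eventually_elim
    case (elim z)
    then have "norm (f z - L z) \<le> norm z" using d(2)[of z] assms(2) by simp
    then have "norm (f z) \<le> norm z + norm (L z)" by (smt (verit) norm_triangle_sub)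
    then show ?case using K[of z] by (simp add: algebra_simps)
  qed
  then show ?thesis by (rule vanishesI)
qed

text \<open>On the ray through z the lowest remaining term has size r^k; dividing by r^k and letting
  r tend to 0 from the right isolates it. Only positive dilations occur, so the terms may mix z with
  its conjugate.\<close>

lemma homogeneous_sum_vanishes:
  fixes f :: "nat \<Rightarrow> 'a::real_normed_vector \<Rightarrow> 'b::real_normed_vector"
  assumes hom: "\<And>k r z. k < m \<Longrightarrow> r > 0 \<Longrightarrow> f k (r *\<^sub>R z) = r ^ k *\<^sub>R f k z"
    and van: "vanishes m (\<lambda>z. \<Sum>k<m. f k z)" and "k < m"
  shows "f k z = 0"
  using \<open>k < m\<close>
proof (induction k rule: less_induct)
  case (less k)
  obtain C where C: "\<forall>\<^sub>F z in nhds 0. norm (\<Sum>k<m. f k z) \<le> C * norm z ^ m"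
    using van unfolding vanishes_def by blast
  have lim0: "((\<lambda>r::real. r *\<^sub>R z) \<longlongrightarrow> 0) (at_right 0)"
    by (rule tendsto_eq_intros refl tendsto_ident_at | simp)+
  have ev: "\<forall>\<^sub>F r in at_right (0::real). norm (\<Sum>j\<in>{k..<m}. r ^ (j - k) *\<^sub>R f j z)
      \<le> C * norm z ^ m * r ^ (m - k)"
    using eventually_compose_filterlim[OF C lim0] eventually_at_right_less[of 0]
  proof eventually_elim
    case (elim r)
    have "(\<Sum>j<m. f j (r *\<^sub>R z)) = (\<Sum>j<m. r ^ j *\<^sub>R f j z)"
      using hom elim by simp
    also have "\<dots> = (\<Sum>j\<in>{k..<m}. r ^ j *\<^sub>R f j z)"
      using less by (intro sum.mono_neutral_right) (auto simp: not_le)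
    also have "\<dots> = r ^ k *\<^sub>R (\<Sum>j\<in>{k..<m}. r ^ (j - k) *\<^sub>R f j z)"
      unfolding scaleR_sum_right
      by (intro sum.cong) (auto simp flip: power_add)
    finally have "r ^ k * norm (\<Sum>j\<in>{k..<m}. r ^ (j - k) *\<^sub>R f j z) \<le> C * (r * norm z) ^ m"
      using elim by simp
    also have "\<dots> = r ^ k * (C * norm z ^ m * r ^ (m - k))"
      using less.prems by (simp add: power_mult_distrib flip: power_add)
    finally show ?case using elim by simp
  qed
  have "((\<lambda>r::real. norm (\<Sum>j\<in>{k..<m}. r ^ (j - k) *\<^sub>R f j z))
      \<longlongrightarrow> norm (\<Sum>j\<in>{k..<m}. 0 ^ (j - k) *\<^sub>R f j z)) (at_right 0)"
    by (intro tendsto_intros)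
  moreover have "(\<Sum>j\<in>{k..<m}. (0::real) ^ (j - k) *\<^sub>R f j z) = (\<Sum>j\<in>{k..<m}. if j = k then f j z else 0)"
    by (intro sum.cong) (auto simp: power_0_left)
  then have "(\<Sum>j\<in>{k..<m}. (0::real) ^ (j - k) *\<^sub>R f j z) = f k z"
    using less.prems by simp
  moreover have "((\<lambda>r::real. C * norm z ^ m * r ^ (m - k)) \<longlongrightarrow> C * norm z ^ m * 0 ^ (m - k)) (at_right 0)"
    by (intro tendsto_intros)
  ultimately have "norm (f k z) \<le> C * norm z ^ m * 0 ^ (m - k)"
    using tendsto_le[OF _ _ _ ev] by fastforce
  then show ?case using less.prems by (simp add: power_0_left)
qed

section \<open>Homogeneous polynomials in real coordinates and Taylor's formula\<close>

inductive hpoly :: "nat \<Rightarrow> ('a::euclidean_space \<Rightarrow> 'b::real_normed_vector) \<Rightarrow> bool" where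
  const: "hpoly 0 (\<lambda>z. c)"
| inner: "hpoly k f \<Longrightarrow> b \<in> Basis \<Longrightarrow> hpoly (Suc k) (\<lambda>z. (z \<bullet> b) *\<^sub>R f z)"
| add: "hpoly k f \<Longrightarrow> hpoly k g \<Longrightarrow> hpoly k (\<lambda>z. f z + g z)"

lemma hpoly_zero: "hpoly k (\<lambda>z::'a::euclidean_space. 0)"
proof (induction k)
  case (Suc k)
  from hpoly.inner[OF this, of "SOME b. b \<in> Basis"] show ?case
    by (simp add: some_in_eq)
qed (rule hpoly.const)

lemma hpoly_scaleR: "hpoly k f \<Longrightarrow> hpoly k (\<lambda>z. c *\<^sub>R f z)"
proof (induction rule: hpoly.induct)
  case (inner k f b)
  then have "hpoly (Suc k) (\<lambda>z. (z \<bullet> b) *\<^sub>R (c *\<^sub>R f z))" by (intro hpoly.inner)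
  then show ?case by (simp add: mult.commute)
qed (auto simp: scaleR_add_right intro: hpoly.intros)

lemma hpoly_sum:
  "finite I \<Longrightarrow> (\<And>i. i \<in> I \<Longrightarrow> hpoly k (f i)) \<Longrightarrow> hpoly k (\<lambda>z. \<Sum>i\<in>I. f i z)"
  by (induction I rule: finite_induct) (auto intro: hpoly.add hpoly_zero)

lemma hpoly_homogeneous: "hpoly k f \<Longrightarrow> f (r *\<^sub>R z) = r ^ k *\<^sub>R f z"
  by (induction rule: hpoly.induct) (auto simp: scaleR_add_right mult_ac)

lemma hpoly_smooth: "hpoly k f \<Longrightarrow> smooth_on UNIV f"
proof (induction rule: hpoly.induct)
  case (inner k f b)
  moreover have "smooth_on UNIV (\<lambda>z::'a. z \<bullet> b)"
    by (intro smooth_on_bounded_linear open_UNIV bounded_linear_inner_left)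
  ultimately show ?case by (intro smooth_on_scaleR)
qed (auto intro: smooth_on_const smooth_on_add)

lemma hpoly_vanishes: "hpoly k f \<Longrightarrow> vanishes k f"
proof (induction rule: hpoly.induct)
  case (const c)
  show ?case by (rule vanishesI[of _ "norm c"]) simp
next
  case (inner k f b)
  then show ?case
    using vanishes_scaleR[OF vanishes_inner_const, of k f b] by simp
qed (rule vanishes_add)

text \<open>Euler's identity, obtained by differentiating
  \<open>f (s *\<^sub>R z) = s ^ k *\<^sub>R f z\<close> at s = 1.\<close>

lemma hpoly_euler:
  assumes "hpoly k f"
  shows "frechet_derivative f (at z) z = real k *\<^sub>R f z"
proof -
  let ?D = "frechet_derivative f (at z)"
  have D: "(f has_derivative ?D) (at z)"
    using hpoly_smooth[OF assms] by (intro smooth_on_has_derivative[of UNIV]) auto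
  have "((\<lambda>s::real. s *\<^sub>R z) has_derivative (\<lambda>h. h *\<^sub>R z)) (at 1)"
    by (auto intro!: derivative_eq_intros)
  with D have "((\<lambda>s::real. f (s *\<^sub>R z)) has_derivative (\<lambda>h. ?D (h *\<^sub>R z))) (at 1)"
    by (intro has_derivative_compose[where f = "\<lambda>s::real. s *\<^sub>R z" and g = f]) auto
  moreover have "((\<lambda>s::real. s ^ k *\<^sub>R f z) has_derivative (\<lambda>h. (real k * h) *\<^sub>R f z)) (at 1)"
    by (auto intro!: derivative_eq_intros)
  moreover have "(\<lambda>s::real. f (s *\<^sub>R z)) = (\<lambda>s::real. s ^ k *\<^sub>R f z)"
    using hpoly_homogeneous[OF assms] by blast
  ultimately have "(\<lambda>h. ?D (h *\<^sub>R z)) = (\<lambda>h. (real k * h) *\<^sub>R f z)"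
    using has_derivative_unique by metis
  from fun_cong[OF this, of 1] show ?thesis by simp
qed

lemma linear_basis_expansion:
  fixes L :: "'a::euclidean_space \<Rightarrow> 'b::real_vector"
  assumes "linear L" shows "L v = (\<Sum>b\<in>Basis. (v \<bullet> b) *\<^sub>R L b)"
  by (subst euclidean_representation[symmetric, of v])
    (simp only: linear_sum[OF assms] linear_cmul[OF assms])

text \<open>Integration along the segment from 0 to z, in the form of the mean value inequality. On
  that segment only derivatives in the radial direction occur, and the hypothesis controls exactly
  these.\<close>

lemma vanishes_of_radial_derivative:
  fixes H :: "'a::real_normed_vector \<Rightarrow> 'b::real_normed_vector"
  assumes W: "open W" "0 \<in> W" and H: "\<And>x. x \<in> W \<Longrightarrow> (H has_derivative D x) (at x)" "H 0 = 0"
    and van: "vanishes (Suc m) (\<lambda>z. D z z)"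
  shows "vanishes (Suc m) H"
proof -
  obtain C where C: "C > 0" "\<forall>\<^sub>F z in nhds 0. norm (D z z) \<le> C * norm z ^ Suc m"
    using van vanishesE by blast
  have "\<forall>\<^sub>F z in nhds 0. z \<in> W \<and> norm (D z z) \<le> C * norm z ^ Suc m"
    using C(2) eventually_nhds_in_open[OF W] by (rule eventually_conj[rotated])
  then obtain d where d: "d > 0" "\<And>z. norm z < d \<Longrightarrow> z \<in> W \<and> norm (D z z) \<le> C * norm z ^ Suc m"
    unfolding eventually_nhds_metric by auto
  have "norm (H z) \<le> C * norm z ^ Suc m" if z: "norm z < d" for z
  proof -
    have small: "norm (s *\<^sub>R z) < d" if "0 \<le> s" "s \<le> 1" for s
      using that z mult_left_le_one_le[of "norm z" s] by auto
    have der: "((\<lambda>s. H (s *\<^sub>R z)) has_vector_derivative D (s *\<^sub>R z) z) (at s)"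
      if "0 \<le> s" "s \<le> 1" for s
    proof -
      have HD: "(H has_derivative D (s *\<^sub>R z)) (at (s *\<^sub>R z))"
        using H d small[OF that] by blast
      have "((\<lambda>s::real. s *\<^sub>R z) has_derivative (\<lambda>h. h *\<^sub>R z)) (at s)"
        by (auto intro!: derivative_eq_intros)
      from has_derivative_compose[OF this HD] show ?thesis
        using has_derivative_bounded_linear[OF HD]
        by (simp add: has_vector_derivative_def linear_simps)
    qed
    have "norm (H (1 *\<^sub>R z) - H (0 *\<^sub>R z)) \<le> C * norm z ^ Suc m * 1 - C * norm z ^ Suc m * 0"
    proof (rule differentiable_bound_general)
      show "continuous_on {0..1} (\<lambda>s. H (s *\<^sub>R z))"
        using der by (intro continuous_at_imp_continuous_on ballI)
          (auto intro: has_vector_derivative_continuous)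
      fix s :: real assume s: "0 < s" "s < 1"
      then have sz: "norm (s *\<^sub>R z) < d" using small by simp
      \<comment> \<open>The velocity at s z is the radial derivative there divided by s; the lost
        factor is recovered from the power of \<open>norm (s *\<^sub>R z)\<close>.\<close>
      have lin: "D (s *\<^sub>R z) (s *\<^sub>R z) = s *\<^sub>R D (s *\<^sub>R z) z"
        using d(2)[OF sz] H has_derivative_bounded_linear by (blast intro: linear_simps)
      have "s * norm (D (s *\<^sub>R z) z) \<le> C * (s * norm z) ^ Suc m"
        using d(2)[OF sz] s unfolding lin by simp
      also have "\<dots> = s * (s ^ m * (C * norm z ^ Suc m))"
        by (simp add: power_mult_distrib)
      finally have "norm (D (s *\<^sub>R z) z) \<le> s ^ m * (C * norm z ^ Suc m)"
        using s by simp
      also have "\<dots> \<le> 1 * (C * norm z ^ Suc m)"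
        using s C by (intro mult_right_mono) (auto simp: power_le_one)
      finally show "norm (D (s *\<^sub>R z) z) \<le> C * norm z ^ Suc m" by simp
      show "((\<lambda>s. H (s *\<^sub>R z)) has_vector_derivative D (s *\<^sub>R z) z) (at s)"
        using der s by simp
      show "((\<lambda>s. C * norm z ^ Suc m * s) has_vector_derivative C * norm z ^ Suc m) (at s)"
        by (auto intro!: derivative_eq_intros simp flip: has_real_derivative_iff_has_vector_derivative)
    qed (auto intro!: continuous_intros)
    then show ?thesis using H(2) by simp
  qed
  then have "\<forall>\<^sub>F z in nhds 0. norm (H z) \<le> C * norm z ^ Suc m"
    unfolding eventually_nhds_metric using d(1) by auto
  then show ?thesis by (rule vanishesI)
qed

lemma smooth_vanishes_0:
  assumes "smooth_on W H" "0 \<in> W" shows "vanishes 0 H"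
  using assms by (intro continuous_vanishes_0 differentiable_imp_continuous_within
      smooth_on_differentiable)

text \<open>Induction on m through the partial derivatives of \<open>H\<close>. Only the radial
  derivative of the remainder has to be controlled, so the expansions of the partial derivatives can
  be chosen independently of each other.\<close>

lemma taylor_hpoly:
  fixes H :: "'a::euclidean_space \<Rightarrow> 'b::real_normed_vector"
  assumes "smooth_on W H" "0 \<in> W"
  shows "\<exists>P. (\<forall>k. hpoly k (P k)) \<and> vanishes m (\<lambda>z. H z - (\<Sum>k<m. P k z))"
  using assms(1)
proof (induction m arbitrary: H)
  case 0
  then show ?case
    using smooth_vanishes_0[OF _ assms(2)] by (auto intro!: exI[of _ "\<lambda>k z. 0"] hpoly_zero)
next
  case (Suc m)
  have "\<exists>P. (\<forall>k. hpoly k (P k)) \<and>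
      vanishes m (\<lambda>z. frechet_derivative H (at z) b - (\<Sum>k<m. P k z))" for b
    using Suc.IH[OF smooth_on_frechet_derivative[OF Suc.prems]] .
  then obtain P where P: "\<And>b k. hpoly k (P b k)"
      "\<And>b. vanishes m (\<lambda>z. frechet_derivative H (at z) b - (\<Sum>k<m. P b k z))"
    by metis
  \<comment> \<open>The radial derivative of the part of degree k + 1 has to be the sum of the
    \<open>(z \<bullet> b) *\<^sub>R P b k z\<close>; by Euler's identity it is k + 1 times the part
    itself, hence the factor \<open>1 / real (Suc k)\<close>.\<close>
  define Q where "Q = (\<lambda>k z. case k of 0 \<Rightarrow> H 0
    | Suc k \<Rightarrow> \<Sum>b\<in>Basis. (z \<bullet> b) *\<^sub>R ((1 / real (Suc k)) *\<^sub>R P b k z))"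
  have Q: "hpoly k (Q k)" for k
  proof (cases k)
    case 0
    then show ?thesis by (simp add: Q_def hpoly.const)
  next
    case (Suc j)
    have "hpoly (Suc j) (\<lambda>z. \<Sum>b\<in>Basis. (z \<bullet> b) *\<^sub>R ((1 / real (Suc j)) *\<^sub>R P b j z))"
      by (intro hpoly_sum hpoly.inner hpoly_scaleR P) auto
    then show ?thesis using Suc by (simp add: Q_def)
  qed
  define D where "D = (\<lambda>z v. frechet_derivative H (at z) v - (\<Sum>k<Suc m. frechet_derivative (Q k) (at z) v))"
  have "vanishes (Suc m) (\<lambda>z. H z - (\<Sum>k<Suc m. Q k z))"
  proof (rule vanishes_of_radial_derivative[where D = D and W = W])
    show "((\<lambda>z. H z - (\<Sum>k<Suc m. Q k z)) has_derivative D x) (at x)" if "x \<in> W" for x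
      unfolding D_def using that
      by (intro has_derivative_diff has_derivative_sum smooth_on_has_derivative[OF Suc.prems]
          smooth_on_has_derivative[OF hpoly_smooth[OF Q]]) auto
    have "(\<Sum>k<Suc m. Q k 0) = (\<Sum>k<Suc m. if k = 0 then H 0 else 0)"
      by (intro sum.cong) (auto simp: Q_def split: nat.splits)
    then show "H 0 - (\<Sum>k<Suc m. Q k 0) = 0"
      by simp
    have eq: "D z z = (\<Sum>b\<in>Basis. (z \<bullet> b) *\<^sub>R (frechet_derivative H (at z) b - (\<Sum>k<m. P b k z)))"
      if "z \<in> W" for z
    proof -
      have 1: "frechet_derivative H (at z) z = (\<Sum>b\<in>Basis. (z \<bullet> b) *\<^sub>R frechet_derivative H (at z) b)"
        using that Suc.prems
        by (intro linear_basis_expansion linear_frechet_derivative smooth_on_differentiable)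
      have "(\<Sum>k<Suc m. frechet_derivative (Q k) (at z) z) = (\<Sum>k<Suc m. real k *\<^sub>R Q k z)"
        by (simp add: hpoly_euler[OF Q])
      also have "\<dots> = (\<Sum>k<m. real (Suc k) *\<^sub>R Q (Suc k) z)"
        by (subst sum.lessThan_Suc_shift) simp
      also have "\<dots> = (\<Sum>k<m. \<Sum>b\<in>Basis. (z \<bullet> b) *\<^sub>R P b k z)"
        unfolding Q_def nat.case scaleR_sum_right by (intro sum.cong refl) simp
      also have "\<dots> = (\<Sum>b\<in>Basis. (z \<bullet> b) *\<^sub>R (\<Sum>k<m. P b k z))"
        unfolding scaleR_sum_right by (rule sum.swap)
      finally show ?thesis
        unfolding D_def 1 by (simp add: scaleR_diff_right sum_subtractf)
    qed
    have "vanishes (1 + m) (\<lambda>z. \<Sum>b\<in>Basis. (z \<bullet> b) *\<^sub>R (frechet_derivative H (at z) b - (\<Sum>k<m. P b k z)))"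
      by (intro vanishes_sum vanishes_scaleR vanishes_inner_const P finite_Basis)
    moreover have "\<forall>\<^sub>F z in nhds 0. D z z
        = (\<Sum>b\<in>Basis. (z \<bullet> b) *\<^sub>R (frechet_derivative H (at z) b - (\<Sum>k<m. P b k z)))"
      using eventually_nhds_in_open[OF smooth_on_open[OF Suc.prems] assms(2)]
      by eventually_elim (rule eq)
    ultimately show "vanishes (Suc m) (\<lambda>z. D z z)"
      using vanishes_cong by fastforce
  qed (use Suc.prems assms(2) in \<open>auto simp: smooth_on_open\<close>)
  then show ?case using Q by blast
qed

lemma vanishes_of_dderiv_zero:
  fixes H :: "'a::euclidean_space \<Rightarrow> 'b::real_normed_vector"
  assumes "smooth_on W H" "0 \<in> W" "\<And>vs. length vs < m \<Longrightarrow> dderiv vs H 0 = 0"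
  shows "vanishes m H"
  using assms(1,3)
proof (induction m arbitrary: H)
  case 0
  then show ?case using smooth_vanishes_0 assms(2) by blast
next
  case (Suc m)
  let ?D = "\<lambda>z. frechet_derivative H (at z)"
  have "vanishes m (\<lambda>z. ?D z b)" for b
    by (intro Suc.IH smooth_on_frechet_derivative Suc.prems)
      (use Suc.prems(2)[of "b # _"] in simp)
  then have "vanishes (1 + m) (\<lambda>z. \<Sum>b\<in>Basis. (z \<bullet> b) *\<^sub>R ?D z b)"
    by (intro vanishes_sum vanishes_scaleR vanishes_inner_const finite_Basis)
  moreover have "\<forall>\<^sub>F z in nhds 0. ?D z z = (\<Sum>b\<in>Basis. (z \<bullet> b) *\<^sub>R ?D z b)"
    using eventually_nhds_in_open[OF smooth_on_open[OF Suc.prems(1)] assms(2)]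
    by eventually_elim (intro linear_basis_expansion linear_frechet_derivative
        smooth_on_differentiable[OF Suc.prems(1)])
  ultimately have "vanishes (Suc m) (\<lambda>z. ?D z z)"
    using vanishes_cong by fastforce
  then show ?case
    using assms(2) Suc.prems(2)[of "[]"]
    by (intro vanishes_of_radial_derivative[OF smooth_on_open[OF Suc.prems(1)] _
        smooth_on_has_derivative[OF Suc.prems(1)]]) auto
qed

text \<open>A nonzero leading part P of the derivative along v would make G change by about s0
  e^(k+1) P(z) between e z and e (z + s0 v), too much for a function of size e^(k+2). After division
  by e^(k+1), first e tends to 0, then the continuity error \<eta>.\<close>

lemma hpoly_derivative_zero:
  fixes G :: "'a::euclidean_space \<Rightarrow> 'b::real_normed_vector"
  assumes W: "open W" "0 \<in> W" and G: "\<And>x. x \<in> W \<Longrightarrow> (G has_derivative D x) (at x)"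
    and "vanishes (k + 2) G" and P: "hpoly k P" and "vanishes (Suc k) (\<lambda>z. D z v - P z)"
  shows "P z = 0"
proof -
  obtain A where A: "A > 0" "\<forall>\<^sub>F z in nhds 0. norm (G z) \<le> A * norm z ^ (k + 2)"
    using assms(4) vanishesE by blast
  obtain B where B: "B > 0" "\<forall>\<^sub>F z in nhds 0. norm (D z v - P z) \<le> B * norm z ^ Suc k"
    using assms(6) vanishesE by blast
  have "\<forall>\<^sub>F x in nhds 0. x \<in> W \<and> norm (G x) \<le> A * norm x ^ (k + 2) \<and>
      norm (D x v - P x) \<le> B * norm x ^ Suc k"
    using A(2) B(2) eventually_nhds_in_open[OF W] by eventually_elim simp
  then obtain d where d: "d > 0" "\<And>x. norm x < d \<Longrightarrow> x \<in> W \<and>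
      norm (G x) \<le> A * norm x ^ (k + 2) \<and> norm (D x v - P x) \<le> B * norm x ^ Suc k"
    unfolding eventually_nhds_metric by auto
  have "norm (P z) \<le> 0 + \<eta>" if "\<eta> > 0" for \<eta> :: real
  proof -
    have "isCont P z"
      using hpoly_smooth[OF P] smooth_on_differentiable[of UNIV P z]
      by (simp add: differentiable_imp_continuous_within)
    moreover have "((\<lambda>s::real. z + s *\<^sub>R v) \<longlongrightarrow> z) (at_right 0)"
      by (rule tendsto_eq_intros refl tendsto_ident_at | simp)+
    ultimately have "((\<lambda>s::real. P (z + s *\<^sub>R v)) \<longlongrightarrow> P z) (at_right 0)"
      by (rule isCont_tendsto_compose)
    then have "\<forall>\<^sub>F s in at_right (0::real). dist (P (z + s *\<^sub>R v)) (P z) < \<eta>"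
      using that by (rule tendstoD)
    then obtain s1 where s1: "s1 > 0" "\<And>s. 0 < s \<Longrightarrow> s < s1 \<Longrightarrow> dist (P (z + s *\<^sub>R v)) (P z) < \<eta>"
      unfolding eventually_at_right_field by blast
    define s0 where "s0 = s1 / 2"
    have s0: "s0 > 0" "\<And>s. 0 < s \<Longrightarrow> s < s0 \<Longrightarrow> dist (P (z + s *\<^sub>R v)) (P z) < \<eta>"
      using s1 by (auto simp: s0_def)
    define R where "R = norm z + s0 * norm v + 1"
    have R: "R > 0" "\<And>s. 0 \<le> s \<Longrightarrow> s \<le> s0 \<Longrightarrow> norm (z + s *\<^sub>R v) \<le> R"
    proof -
      show "R > 0" using s0 by (simp add: R_def add_nonneg_pos)
      fix s :: real assume "0 \<le> s" "s \<le> s0"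
      then have "s * norm v \<le> s0 * norm v" by (intro mult_right_mono) auto
      then show "norm (z + s *\<^sub>R v) \<le> R"
        using norm_triangle_ineq[of z "s *\<^sub>R v"] \<open>0 \<le> s\<close> by (simp add: R_def)
    qed
    have est: "norm (P z) \<le> \<eta> + (B * R ^ Suc k + 2 * A * R ^ (k + 2) / s0) * e"
      if e: "e > 0" "e < d / R" for e
    proof -
      have small: "norm (e *\<^sub>R (z + s *\<^sub>R v)) < d" if "0 \<le> s" "s \<le> s0" for s
      proof -
        have "e * norm (z + s *\<^sub>R v) \<le> e * R" using R that e by (intro mult_left_mono) auto
        also have "\<dots> < d" using e R by (simp add: field_simps)
        finally show ?thesis using e by simp
      qed
      have hom: "P (e *\<^sub>R x) = e ^ k *\<^sub>R P x" for x
        using hpoly_homogeneous[OF P] .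
      \<comment> \<open>G along the short segment minus the growth predicted by the single value
        \<open>P z\<close>. The mean value inequality bounds its increment, which leaves the
        predicted growth to be controlled by the endpoint values of G.\<close>
      define \<phi> where "\<phi> = (\<lambda>s. G (e *\<^sub>R (z + s *\<^sub>R v)) - (s * e ^ Suc k) *\<^sub>R P z)"
      have der: "(\<phi> has_vector_derivative
          (e *\<^sub>R D (e *\<^sub>R (z + s *\<^sub>R v)) v - e ^ Suc k *\<^sub>R P z)) (at s)"
        if "0 \<le> s" "s \<le> s0" for s
      proof -
        have GD: "(G has_derivative D (e *\<^sub>R (z + s *\<^sub>R v))) (at (e *\<^sub>R (z + s *\<^sub>R v)))"
          using G d small[OF that] by blast
        have "((\<lambda>s::real. e *\<^sub>R (z + s *\<^sub>R v)) has_derivative (\<lambda>h. h *\<^sub>R (e *\<^sub>R v))) (at s)"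
          by (auto intro!: derivative_eq_intros simp: mult.commute)
        from has_derivative_compose[OF this GD]
        have "((\<lambda>s. G (e *\<^sub>R (z + s *\<^sub>R v))) has_vector_derivative
            e *\<^sub>R D (e *\<^sub>R (z + s *\<^sub>R v)) v) (at s)"
          using has_derivative_bounded_linear[OF GD]
          by (simp add: has_vector_derivative_def linear_simps)
        moreover have "((\<lambda>s. (s * e ^ Suc k) *\<^sub>R P z) has_vector_derivative e ^ Suc k *\<^sub>R P z) (at s)"
          by (auto intro!: derivative_eq_intros simp: has_vector_derivative_def)
        ultimately show ?thesis
          unfolding \<phi>_def by (rule has_vector_derivative_diff)
      qed
      have GR: "norm (G (e *\<^sub>R (z + s *\<^sub>R v))) \<le> A * (e * R) ^ (k + 2)" if "0 \<le> s" "s \<le> s0" for s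
      proof -
        have "A * norm (e *\<^sub>R (z + s *\<^sub>R v)) ^ (k + 2) \<le> A * (e * R) ^ (k + 2)"
          using A e R that by (intro mult_left_mono power_mono) auto
        then show ?thesis using d(2)[OF small[OF that]] by simp
      qed
      let ?K = "e ^ Suc k * (\<eta> + B * R ^ Suc k * e)"
      have "norm (\<phi> s0 - \<phi> 0) \<le> ?K * s0 - ?K * 0"
      proof (rule differentiable_bound_general)
        show "continuous_on {0..s0} \<phi>"
          using der by (intro continuous_at_imp_continuous_on ballI)
            (auto intro: has_vector_derivative_continuous)
        fix s assume s: "0 < s" "s < s0"
        then show "(\<phi> has_vector_derivative
          (e *\<^sub>R D (e *\<^sub>R (z + s *\<^sub>R v)) v - e ^ Suc k *\<^sub>R P z)) (at s)"
          using der by simp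
        show "((\<lambda>s. ?K * s) has_vector_derivative ?K) (at s)"
          by (auto intro!: derivative_eq_intros simp flip: has_real_derivative_iff_has_vector_derivative)
        let ?x = "e *\<^sub>R (z + s *\<^sub>R v)"
        have "e *\<^sub>R D ?x v - e ^ Suc k *\<^sub>R P z
            = e *\<^sub>R (D ?x v - P ?x) + e ^ Suc k *\<^sub>R (P (z + s *\<^sub>R v) - P z)"
          unfolding hom by (simp add: scaleR_diff_right)
        also have "norm \<dots> \<le> e * norm (D ?x v - P ?x) + e ^ Suc k * norm (P (z + s *\<^sub>R v) - P z)"
          using e by (intro norm_triangle_le) simp
        also have "\<dots> \<le> e * (B * norm ?x ^ Suc k) + e ^ Suc k * \<eta>"
          using d(2)[OF small, of s] s s0(2)[OF s] e by (intro add_mono mult_left_mono) (auto simp: dist_norm)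
        also have "\<dots> \<le> e * (B * (e * R) ^ Suc k) + e ^ Suc k * \<eta>"
          using R(2)[of s] s e B by (intro add_mono mult_left_mono power_mono) auto
        also have "\<dots> = ?K" by (simp add: power_mult_distrib algebra_simps)
        finally show "norm (e *\<^sub>R D ?x v - e ^ Suc k *\<^sub>R P z) \<le> ?K" .
      qed (use s0 in \<open>auto intro!: continuous_intros\<close>)
      moreover have "s0 * e ^ Suc k * norm (P z)
          \<le> norm (G (e *\<^sub>R (z + s0 *\<^sub>R v))) + norm (G (e *\<^sub>R (z + 0 *\<^sub>R v))) + norm (\<phi> s0 - \<phi> 0)"
      proof -
        have "s0 * e ^ Suc k * norm (P z) = norm ((s0 * e ^ Suc k) *\<^sub>R P z)"
          using s0 e by (simp add: abs_mult)
        also have "(s0 * e ^ Suc k) *\<^sub>R P z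
            = G (e *\<^sub>R (z + s0 *\<^sub>R v)) - G (e *\<^sub>R (z + 0 *\<^sub>R v)) - (\<phi> s0 - \<phi> 0)"
          by (simp add: \<phi>_def)
        also have "norm \<dots> \<le> norm (G (e *\<^sub>R (z + s0 *\<^sub>R v)) - G (e *\<^sub>R (z + 0 *\<^sub>R v))) + norm (\<phi> s0 - \<phi> 0)"
          by (rule norm_triangle_ineq4)
        also have "\<dots> \<le> norm (G (e *\<^sub>R (z + s0 *\<^sub>R v))) + norm (G (e *\<^sub>R (z + 0 *\<^sub>R v))) + norm (\<phi> s0 - \<phi> 0)"
          by (intro add_right_mono norm_triangle_ineq4)
        finally show ?thesis .
      qed
      ultimately have "s0 * e ^ Suc k * norm (P z) \<le> 2 * (A * (e * R) ^ (k + 2)) + ?K * s0"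
        using GR[of s0] GR[of 0] s0 by simp
      also have "\<dots> = s0 * e ^ Suc k * (\<eta> + (B * R ^ Suc k + 2 * A * R ^ (k + 2) / s0) * e)"
        using s0 by (simp add: power_mult_distrib field_simps)
      finally show ?thesis using s0 e by simp
    qed
    have "((\<lambda>e. \<eta> + (B * R ^ Suc k + 2 * A * R ^ (k + 2) / s0) * e) \<longlongrightarrow>
        \<eta> + (B * R ^ Suc k + 2 * A * R ^ (k + 2) / s0) * 0) (at_right 0)"
      by (intro tendsto_intros)
    moreover have "\<forall>\<^sub>F e in at_right 0. norm (P z) \<le> \<eta> + (B * R ^ Suc k + 2 * A * R ^ (k + 2) / s0) * e"
      unfolding eventually_at_right_field using est d R by (intro exI[of _ "d / R"]) auto
    ultimately have "norm (P z) \<le> \<eta> + (B * R ^ Suc k + 2 * A * R ^ (k + 2) / s0) * 0"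
      by (intro tendsto_lowerbound) auto
    then show ?thesis by simp
  qed
  then have "norm (P z) \<le> 0" by (rule field_le_epsilon)
  then show ?thesis by simp
qed

text \<open>A bound on size cannot be differentiated for general functions. Here the derivative has
  a Taylor expansion of its own, and the preceding lemma removes its homogeneous parts of degree
  below m one after the other.\<close>

lemma vanishes_derivative:
  fixes G :: "'a::euclidean_space \<Rightarrow> 'b::real_normed_vector"
  assumes G: "smooth_on W G" "0 \<in> W" and van: "vanishes (Suc m) G"
  shows "vanishes m (\<lambda>x. frechet_derivative G (at x) v)"
proof -
  let ?D = "\<lambda>x. frechet_derivative G (at x)"
  obtain P where P: "\<And>k. hpoly k (P k)" "vanishes m (\<lambda>z. ?D z v - (\<Sum>k<m. P k z))"
    using taylor_hpoly[OF smooth_on_frechet_derivative[OF G(1)] G(2)] by blast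
  have zero: "P k z = 0" if "k < m" for k z
    using that
  proof (induction k arbitrary: z rule: less_induct)
    case (less k)
    have "vanishes (Suc k) (\<lambda>z. (?D z v - (\<Sum>k<m. P k z)) + (\<Sum>j\<in>{k<..<m}. P j z))"
      using less.prems by (intro vanishes_add vanishes_sum vanishes_mono[OF P(2)]
          vanishes_mono[OF hpoly_vanishes[OF P(1)]]) auto
    moreover have "(\<Sum>j<m. P j x) = P k x + (\<Sum>j\<in>{k<..<m}. P j x)" for x
    proof -
      have "{..<m} = {..<k} \<union> insert k {k<..<m}" using less.prems by auto
      then have "(\<Sum>j<m. P j x) = (\<Sum>j\<in>{..<k}. P j x) + (\<Sum>j\<in>insert k {k<..<m}. P j x)"
        by (metis (no_types, lifting) finite_greaterThanLessThan finite_insert finite_lessThan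
            sum.union_disjoint disjoint_iff greaterThanLessThan_iff insertE lessThan_iff less_asym less_irrefl)
      then show ?thesis using less by simp
    qed
    ultimately have "vanishes (Suc k) (\<lambda>z. ?D z v - P k z)" by (simp add: algebra_simps)
    moreover have "vanishes (k + 2) G"
      using van less.prems by (rule_tac vanishes_mono) auto
    ultimately show ?case
      using G(2) P(1) by (intro hpoly_derivative_zero[OF smooth_on_open[OF G(1)] _
          smooth_on_has_derivative[OF G(1)], where v = v]) auto
  qed
  then show ?thesis using P(2) by simp
qed

text \<open>Together with \<open>vanishes_of_dderiv_zero\<close> this translates flatness, a
  condition on all iterated derivatives, into vanishing to every order.\<close>

lemma dderiv_zero_of_vanishes:
  fixes G :: "'a::euclidean_space \<Rightarrow> 'b::real_normed_vector"
  assumes "smooth_on W G" "0 \<in> W" "vanishes (Suc (length vs)) G"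
  shows "dderiv vs G 0 = 0"
  using assms
proof (induction vs arbitrary: G)
  case Nil
  then show ?case using vanishes_zero_at by fastforce
next
  case (Cons v vs)
  have "dderiv vs (\<lambda>x. frechet_derivative G (at x) v) 0 = 0"
    using Cons.prems by (intro Cons.IH smooth_on_frechet_derivative vanishes_derivative) auto
  then show ?case by simp
qed

subsection \<open>Holomorphic maps, Lipschitz bounds and comparison of defining functions\<close>

lemma isCont_tendsto_nhds: "isCont f x \<Longrightarrow> (f \<longlongrightarrow> f x) (nhds x)"
  unfolding isCont_def tendsto_at_iff_tendsto_nhds .

lemma norm_smult_cvec: "norm (c *s v) = norm c * norm (v :: complex^'n::finite)"
  unfolding norm_vec_def by (simp add: norm_mult L2_set_right_distrib)

lemma norm_le_sum_cvec: "norm (v :: complex^'n::finite) \<le> (\<Sum>j\<in>UNIV. norm (v $ j))"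
  unfolding norm_vec_def by (rule L2_set_le_sum) simp

lemma has_derivative_cvecI:
  fixes f :: "'a::real_normed_vector \<Rightarrow> complex^'n::finite"
  assumes "\<And>j. ((\<lambda>x. f x $ j) has_derivative (\<lambda>h. f' h $ j)) F"
  shows "(f has_derivative f') F"
proof -
  have "((\<lambda>x. \<Sum>j\<in>UNIV. axis j (f x $ j)) has_derivative (\<lambda>h. \<Sum>j\<in>UNIV. axis j (f' h $ j))) F"
    by (intro has_derivative_sum bounded_linear.has_derivative[OF bounded_linear_axis] assms)
  then show ?thesis by (simp add: sum_axis_cvec)
qed

lemma has_derivative_cvec_nth:
  fixes f :: "'a::real_normed_vector \<Rightarrow> complex^'n::finite"
  shows "(f has_derivative f') F \<Longrightarrow> ((\<lambda>x. f x $ j) has_derivative (\<lambda>h. f' h $ j)) F"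
  by (rule bounded_linear.has_derivative[OF bounded_linear_vec_nth])

definition hol_germ :: "(complex \<Rightarrow> complex^'n::finite) \<Rightarrow> bool" where
  "hol_germ c \<longleftrightarrow> (\<forall>j. (\<lambda>t. c t $ j) analytic_on {0})"

lemma hol_germ_iff: "hol_germ c \<longleftrightarrow> (\<exists>\<epsilon>>0. \<forall>j. (\<lambda>t. c t $ j) holomorphic_on ball 0 \<epsilon>)"
proof
  assume "hol_germ c"
  then have "\<forall>j. \<exists>e>0. (\<lambda>t. c t $ j) holomorphic_on ball 0 e"
    by (auto simp: hol_germ_def analytic_on_def)
  then obtain e where e: "\<And>j. e j > 0" "\<And>j. (\<lambda>t. c t $ j) holomorphic_on ball 0 (e j)"
    by metis
  show "\<exists>\<epsilon>>0. \<forall>j. (\<lambda>t. c t $ j) holomorphic_on ball 0 \<epsilon>"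
  proof (intro exI[of _ "Min (range e)"] conjI allI)
    show "Min (range e) > 0" using e by simp
    fix j
    show "(\<lambda>t. c t $ j) holomorphic_on ball 0 (Min (range e))"
      by (rule holomorphic_on_subset[OF e(2)[of j]]) (simp add: subset_ball)
  qed
next
  assume "\<exists>\<epsilon>>0. \<forall>j. (\<lambda>t. c t $ j) holomorphic_on ball 0 \<epsilon>"
  then show "hol_germ c"
    unfolding hol_germ_def analytic_on_def by auto
qed

lemma holomorphic_curve_has_derivative:
  fixes c :: "complex \<Rightarrow> complex^'n::finite"
  assumes "open S" "t \<in> S" "\<And>j. (\<lambda>t. c t $ j) holomorphic_on S"
  shows "(c has_derivative (\<lambda>h. h *s (\<chi> j. deriv (\<lambda>t. c t $ j) t))) (at t)"
proof (rule has_derivative_cvecI)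
  fix j
  have "((\<lambda>t. c t $ j) has_field_derivative deriv (\<lambda>t. c t $ j) t) (at t)"
    using assms holomorphic_derivI by blast
  then show "((\<lambda>t. c t $ j) has_derivative
      (\<lambda>h. (h *s (\<chi> j. deriv (\<lambda>t. c t $ j) t)) $ j)) (at t)"
    by (simp add: has_field_derivative_def mult.commute[of _ "deriv _ _"])
qed

lemma holo_map_on_open: "holo_map_on U f \<Longrightarrow> open U"
  by (simp add: holo_map_on_def)

lemma holo_map_on_frechet:
  assumes "holo_map_on U f" "x \<in> U"
  shows "(f has_derivative frechet_derivative f (at x)) (at x)"
    and "frechet_derivative f (at x) (c *s v) = c *s frechet_derivative f (at x) v"
proof -
  obtain L where L: "(f has_derivative L) (at x)" "\<forall>c v. L (c *s v) = c *s L v"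
    using assms unfolding holo_map_on_def by auto
  have "frechet_derivative f (at x) = L"
    using L(1) by (rule frechet_derivative_eqI)
  then show "(f has_derivative frechet_derivative f (at x)) (at x)"
    "frechet_derivative f (at x) (c *s v) = c *s frechet_derivative f (at x) v"
    using L by auto
qed

lemma holo_map_on_curve:
  fixes c :: "complex \<Rightarrow> complex^'n::finite" and f :: "complex^'n \<Rightarrow> complex^'m::finite"
  assumes f: "holo_map_on U f" and S: "open S" "c ` S \<subseteq> U"
    and c: "\<And>j. (\<lambda>t. c t $ j) holomorphic_on S"
  shows "(\<lambda>t. f (c t) $ j) holomorphic_on S"
proof (rule holomorphic_onI)
  fix t assume t: "t \<in> S"
  then obtain L where L: "(f has_derivative L) (at (c t))" "\<And>a v. L (a *s v) = a *s L v"
    using f S unfolding holo_map_on_def by blast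
  let ?c' = "\<chi> j. deriv (\<lambda>t. c t $ j) t"
  have "((\<lambda>t. f (c t) $ j) has_derivative (\<lambda>h. L (h *s ?c') $ j)) (at t)"
    by (intro has_derivative_cvec_nth
        has_derivative_compose[OF holomorphic_curve_has_derivative[OF S(1) t c] L(1)])
  moreover have "(\<lambda>h. L (h *s ?c') $ j) = (*) (L ?c' $ j)"
    by (auto simp: L(2))
  ultimately have "((\<lambda>t. f (c t) $ j) has_field_derivative L ?c' $ j) (at t)"
    by (simp add: has_field_derivative_def)
  then show "(\<lambda>t. f (c t) $ j) field_differentiable at t within S"
    unfolding field_differentiable_def using has_field_derivative_at_within by blast
qed

lemma hol_germ_continuous: "hol_germ c \<Longrightarrow> isCont c 0"
proof -
  assume "hol_germ c"
  then obtain e where "e > 0" "\<And>j. (\<lambda>t. c t $ j) holomorphic_on ball 0 e"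
    unfolding hol_germ_iff by blast
  then have "c differentiable at 0"
    using holomorphic_curve_has_derivative[of "ball 0 e" 0 c] unfolding differentiable_def by auto
  then show ?thesis by (rule differentiable_imp_continuous_within)
qed

lemma hol_germ_eventually_in:
  assumes "hol_germ c" "open U" "c 0 \<in> U"
  shows "\<forall>\<^sub>F t in nhds 0. c t \<in> U"
  using hol_germ_continuous[OF assms(1)] assms(2,3)
  by (metis isCont_def tendsto_at_iff_tendsto_nhds topological_tendstoD)

lemma hol_germ_ball:
  fixes c :: "complex \<Rightarrow> complex^'n::finite"
  assumes "hol_germ c" "open U" "c 0 \<in> U"
  obtains e where "e > 0" "c ` ball 0 e \<subseteq> U" "\<And>j. (\<lambda>t. c t $ j) holomorphic_on ball 0 e"
proof -
  obtain d where d: "d > 0" "\<And>j. (\<lambda>t. c t $ j) holomorphic_on ball 0 d"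
    using assms(1) unfolding hol_germ_iff by blast
  obtain d' where d': "d' > 0" "\<And>t. t \<in> ball 0 d' \<Longrightarrow> c t \<in> U"
    using hol_germ_eventually_in[OF assms] unfolding eventually_nhds_metric by (auto simp: dist_commute)
  show thesis
    by (rule that[of "min d d'"])
      (use d d' in \<open>auto intro: holomorphic_on_subset[OF d(2)]\<close>)
qed

lemma holo_map_on_hol_germ:
  assumes f: "holo_map_on U f" and "hol_germ c" "c 0 \<in> U"
  shows "hol_germ (\<lambda>t. f (c t))"
proof -
  have "open U" using f unfolding holo_map_on_def by blast
  then obtain e where "e > 0" "c ` ball 0 e \<subseteq> U" "\<And>j. (\<lambda>t. c t $ j) holomorphic_on ball 0 e"
    using hol_germ_ball assms by blast
  then show ?thesis
    using holo_map_on_curve[OF f, of "ball 0 e" c] unfolding hol_germ_iff by auto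
qed

lemma holo_map_on_continuous: "holo_map_on U f \<Longrightarrow> continuous_on U f"
  unfolding holo_map_on_def
  by (meson continuous_at_imp_continuous_on has_derivative_continuous)

text \<open>The regularity that the comparison of defining functions asks of the function to be
  bounded. It survives composition with coordinate maps, for which \<open>holo_map_on\<close>
  provides no smoothness directly.\<close>

definition lipschitz_near :: "('a::metric_space \<Rightarrow> 'b::metric_space) \<Rightarrow> 'a \<Rightarrow> bool" where
  "lipschitz_near f p \<longleftrightarrow> (\<exists>d>0. \<exists>K. \<forall>x\<in>ball p d. \<forall>y\<in>ball p d. dist (f x) (f y) \<le> K * dist x y)"

lemma lipschitz_near_of_derivative_bound:
  fixes f :: "'a::real_normed_vector \<Rightarrow> 'b::real_normed_vector"
  assumes der: "\<And>x. x \<in> ball p d \<Longrightarrow> (f has_derivative f' x) (at x)" and "0 \<le> K" "d > 0"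
    and bound: "\<And>x v. x \<in> ball p d \<Longrightarrow> norm (f' x v) \<le> K * norm v"
  shows "lipschitz_near f p"
proof -
  have "norm (f x - f y) \<le> K * norm (x - y)" if "x \<in> ball p d" "y \<in> ball p d" for x y
  proof (rule differentiable_bound[where S = "ball p d" and f' = f'])
    show "(f has_derivative f' x) (at x within ball p d)" if "x \<in> ball p d" for x
      using der that has_derivative_at_withinI by blast
    show "onorm (f' x) \<le> K" if "x \<in> ball p d" for x
      using \<open>0 \<le> K\<close> bound[OF that] by (intro onorm_bound) (auto simp: mult.commute)
  qed (use that in auto)
  then show ?thesis
    unfolding lipschitz_near_def dist_norm using \<open>d > 0\<close> by blast
qed

text \<open>Only pointwise complex differentiability is assumed of a holomorphic map, so the bound on the
  derivative comes from Cauchy's inequality on complex lines.\<close>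

lemma holo_map_on_lipschitz_near:
  fixes f :: "complex^'a::finite \<Rightarrow> complex^'b::finite"
  assumes f: "holo_map_on U f" and "p \<in> U"
  shows "lipschitz_near f p"
proof -
  have "open U" using f unfolding holo_map_on_def by blast
  then obtain R where R: "R > 0" "cball p R \<subseteq> U"
    using \<open>p \<in> U\<close> open_contains_cball by blast
  have "compact (f ` cball p R)"
    using R holo_map_on_continuous[OF f] by (intro compact_continuous_image) (auto intro: continuous_on_subset)
  from compact_imp_bounded[OF this] obtain B where B: "\<And>x. x \<in> cball p R \<Longrightarrow> norm (f x) \<le> B"
    unfolding bounded_iff by blast
  define d where "d = R / 2"
  have d: "d > 0" using R by (simp add: d_def)
  define D where "D = (\<lambda>x. frechet_derivative f (at x))"
  have D: "(f has_derivative D x) (at x)" "\<And>c v. D x (c *s v) = c *s D x v" if "x \<in> U" for x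
    using holo_map_on_frechet[OF f that] by (auto simp: D_def)
  have B0: "0 \<le> B" using order_trans[OF norm_ge_zero B[of p]] R by simp
  have bound: "norm (D x v) \<le> (real CARD('b) * B / d) * norm v" if x: "x \<in> ball p d" for x v
  proof (cases "v = 0")
    case True
    have "x \<in> U" using x R d by (auto simp: d_def)
    then have "D x v = 0"
      using True has_derivative_bounded_linear[OF D(1)] by (simp add: linear_simps)
    then show ?thesis using True by simp
  next
    case False
    \<comment> \<open>With this radius the disc x + t v stays within distance d of x, hence in
      \<open>cball p R\<close>. Cauchy's inequality then gives the bound \<open>B / r\<close>, which
      is proportional to \<open>norm v\<close>.\<close>
    define r where "r = d / norm v"
    have r: "r > 0" using d False by (simp add: r_def)
    define c where "c = (\<lambda>t. x + t *s v)"
    have cder: "(c has_derivative (\<lambda>h. h *s v)) (at t)" for t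
      unfolding c_def by (rule has_derivative_cvecI) (auto intro!: derivative_eq_intros)
    have cR: "c t \<in> cball p R" if "t \<in> cball 0 r" for t
    proof -
      have "norm (t *s v) \<le> d"
        using that False by (simp add: norm_smult_cvec r_def field_simps)
      then show ?thesis
        using x dist_triangle_le[of p x "c t" R] unfolding c_def d_def
        by (simp add: dist_norm)
    qed
    have "open S \<Longrightarrow> c ` S \<subseteq> U \<Longrightarrow> (\<lambda>t. f (c t) $ j) holomorphic_on S" for S j
      using f by (rule holo_map_on_curve) (auto simp: c_def intro!: holomorphic_intros)
    moreover have "c -` U \<inter> UNIV = c -` U" "open (c -` U)"
    proof -
      have "continuous_on UNIV c"
        by (intro continuous_at_imp_continuous_on ballI has_derivative_continuous[OF cder])
      then show "open (c -` U)" using \<open>open U\<close> by (simp add: open_vimage)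
    qed simp
    ultimately have hol: "(\<lambda>t. f (c t) $ j) holomorphic_on c -` U" for j
      by blast
    have sub: "cball 0 r \<subseteq> c -` U" using cR R(2) by blast
    have comp: "norm (D x v $ j) \<le> B / r" for j
    proof -
      have "norm ((deriv ^^ 1) (\<lambda>t. f (c t) $ j) 0) \<le> fact 1 * B / r ^ 1"
      proof (rule Cauchy_inequality)
        show "(\<lambda>t. f (c t) $ j) holomorphic_on ball 0 r"
          using hol sub ball_subset_cball by (meson holomorphic_on_subset order_trans)
        show "continuous_on (cball 0 r) (\<lambda>t. f (c t) $ j)"
          using hol sub holomorphic_on_imp_continuous_on holomorphic_on_subset by blast
        show "norm (f (c t) $ j) \<le> B" if "norm (0 - t) = r" for t
          using that cR[of t] order_trans[OF Finite_Cartesian_Product.norm_nth_le B[of "c t"]] by auto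
      qed (use r in auto)
      moreover have "((\<lambda>t. f (c t) $ j) has_field_derivative D x v $ j) (at 0)"
      proof -
        have "x \<in> U" using subsetD[OF sub, of 0] r by (simp add: c_def)
        then have "(f has_derivative D x) (at (c 0))"
          using D(1)[of x] by (simp add: c_def)
        from has_derivative_cvec_nth[OF has_derivative_compose[OF cder[of 0] this], of j]
        have "((\<lambda>t. f (c t) $ j) has_derivative (\<lambda>h. D x (h *s v) $ j)) (at 0)" .
        moreover have "(\<lambda>h. D x (h *s v) $ j) = (*) (D x v $ j)"
          using D(2)[OF \<open>x \<in> U\<close>] by auto
        ultimately show ?thesis by (simp add: has_field_derivative_def)
      qed
      ultimately show ?thesis by (simp add: DERIV_imp_deriv)
    qed
    have "norm (D x v) \<le> (\<Sum>j::'b\<in>UNIV. B / r)"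
      using norm_le_sum_cvec sum_mono[OF comp] by (rule order_trans)
    then show ?thesis by (simp add: r_def mult_ac)
  qed
  have "ball p d \<subseteq> U" using R d by (auto simp: d_def)
  then show ?thesis
    using bound D(1) B0 d
    by (intro lipschitz_near_of_derivative_bound[where f' = D and d = d and K = "real CARD('b) * B / d"]) auto
qed

lemma smooth_on_lipschitz_near:
  fixes f :: "'a::euclidean_space \<Rightarrow> 'b::real_normed_vector"
  assumes f: "smooth_on U f" and "p \<in> U"
  shows "lipschitz_near f p"
proof -
  obtain R where R: "R > 0" "cball p R \<subseteq> U"
    using \<open>p \<in> U\<close> open_contains_cball smooth_on_open[OF f] by blast
  let ?D = "\<lambda>x. frechet_derivative f (at x)"
  have "\<exists>B. \<forall>x\<in>cball p R. norm (?D x b) \<le> B" for b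
  proof -
    have "compact ((\<lambda>x. ?D x b) ` cball p R)"
      using R smooth_on_continuous[OF smooth_on_frechet_derivative[OF f]]
      by (intro compact_continuous_image) (auto intro: continuous_on_subset)
    from compact_imp_bounded[OF this] show ?thesis
      by (auto simp: bounded_iff)
  qed
  then obtain B where B: "\<And>b x. x \<in> cball p R \<Longrightarrow> norm (?D x b) \<le> B b"
    by metis
  have ballU: "ball p R \<subseteq> U" using R by auto
  have B0: "0 \<le> B b" for b
    using order_trans[OF norm_ge_zero B[of p b]] R by simp
  have bound: "norm (?D x v) \<le> (\<Sum>b\<in>Basis. B b) * norm v" if "x \<in> ball p R" for x v
  proof -
    have "?D x v = (\<Sum>b\<in>Basis. (v \<bullet> b) *\<^sub>R ?D x b)"
      using that R f by (intro linear_basis_expansion linear_frechet_derivative smooth_on_differentiable) auto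
    also have "norm \<dots> \<le> (\<Sum>b\<in>Basis. norm v * B b)"
      using that B by (intro sum_norm_le) (auto intro!: mult_mono Basis_le_norm)
    finally show ?thesis by (simp add: sum_distrib_left sum_distrib_right mult.commute)
  qed
  show ?thesis
    using bound smooth_on_has_derivative[OF f subsetD[OF ballU]] B0 R(1)
    by (intro lipschitz_near_of_derivative_bound[where f' = ?D and d = R and K = "\<Sum>b\<in>Basis. B b"]) (auto intro: sum_nonneg)
qed

text \<open>From \<open>x\<close> a zero of \<open>r\<close> is reached by moving a distance comparable to \<open>\<bar>r x\<bar>\<close> in a direction
  in which \<open>r\<close> increases.\<close>

lemma defining_function_comparison:
  fixes r \<rho> :: "'a::euclidean_space \<Rightarrow> real"
  assumes r: "smooth_on U r" "p \<in> U" "r p = 0" "frechet_derivative r (at p) \<noteq> (\<lambda>v. 0)"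
    and "lipschitz_near \<rho> p" and zero: "\<And>x. x \<in> U' \<Longrightarrow> r x = 0 \<Longrightarrow> \<rho> x = 0" and U': "open U'" "p \<in> U'"
  shows "\<exists>C. \<forall>\<^sub>F x in nhds p. \<bar>\<rho> x\<bar> \<le> C * \<bar>r x\<bar>"
proof -
  let ?D = "\<lambda>x. frechet_derivative r (at x)"
  obtain d K where lip: "d > 0"
    "\<And>x y. x \<in> ball p d \<Longrightarrow> y \<in> ball p d \<Longrightarrow> \<bar>\<rho> x - \<rho> y\<bar> \<le> K * norm (x - y)"
    using assms(5) unfolding lipschitz_near_def dist_norm real_norm_def by metis
  have lin: "linear (?D p)" using r smooth_on_differentiable linear_frechet_derivative by blast
  obtain u where u: "?D p u \<noteq> 0" using r(4) by auto
  define v where "v = (if ?D p u > 0 then u else - u)"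
  have v: "?D p v > 0" using u linear_neg[OF lin, of u] by (auto simp: v_def)
  have v0: "norm v > 0" using v linear_0[OF lin] by auto
  \<comment> \<open>Half the derivative at p, so that c is a lower bound for the derivative along v
    at all nearby points.\<close>
  define c where "c = ?D p v / 2"
  have c: "c > 0" using v by (simp add: c_def)
  have "continuous_on U (\<lambda>x. ?D x v)"
    by (intro smooth_on_continuous smooth_on_frechet_derivative r)
  then have "isCont (\<lambda>x. ?D x v) p"
    using r smooth_on_open continuous_on_eq_continuous_at by blast
  then have "((\<lambda>x. ?D x v) \<longlongrightarrow> ?D p v) (nhds p)"
    by (rule isCont_tendsto_nhds)
  moreover have "c < ?D p v" using v by (simp add: c_def)
  ultimately have "\<forall>\<^sub>F x in nhds p. ?D x v > c"
    by (rule order_tendstoD)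
  then have "\<forall>\<^sub>F x in nhds p. ?D x v > c \<and> x \<in> U \<and> x \<in> ball p d \<and> x \<in> U'"
    using r lip(1) U' smooth_on_open[OF r(1)]
    by (intro eventually_conj eventually_nhds_in_open) auto
  then obtain e where e: "e > 0" "\<And>x. dist x p < e \<Longrightarrow> ?D x v > c \<and> x \<in> U \<and> x \<in> ball p d \<and> x \<in> U'"
    unfolding eventually_nhds_metric by blast
  \<comment> \<open>Starting within e / 2 of p, parameters up to s0 along v do not leave the ball of
    radius e.\<close>
  define s0 where "s0 = e / (2 * norm v)"
  have s0: "s0 > 0" using e v0 by (simp add: s0_def)
  have "isCont r p"
    using r smooth_on_differentiable differentiable_imp_continuous_within by blast
  then have "(r \<longlongrightarrow> 0) (nhds p)"
    using isCont_tendsto_nhds r(3) by fastforce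
  then have "\<forall>\<^sub>F x in nhds p. dist (r x) 0 < c * s0"
    using c s0 by (intro tendstoD) auto
  moreover have "\<forall>\<^sub>F x in nhds p. dist x p < e / 2"
    unfolding eventually_nhds_metric using e by (auto intro!: exI[of _ "e/2"])
  ultimately have "\<forall>\<^sub>F x in nhds p. \<bar>\<rho> x\<bar> \<le> (\<bar>K\<bar> * norm v / c) * \<bar>r x\<bar>"
  proof eventually_elim
    case (elim x)
    \<comment> \<open>Along v the function r grows at rate at least c, so over a parameter length t
      it makes up for its value at x: it is nonpositive at - t and nonnegative at t.\<close>
    define t where "t = \<bar>r x\<bar> / c"
    have t: "0 \<le> t" "t < s0" using elim c by (auto simp: t_def field_simps)
    have near: "dist (x + s *\<^sub>R v) p < e" if "\<bar>s\<bar> \<le> t" for s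
    proof -
      have "\<bar>s\<bar> * norm v \<le> s0 * norm v" using that t by (intro mult_right_mono) auto
      also have "\<dots> = e / 2" using v0 by (simp add: s0_def)
      finally show ?thesis
        using elim norm_triangle_ineq[of "x - p" "s *\<^sub>R v"] by (simp add: dist_norm algebra_simps)
    qed
    have der: "((\<lambda>s. r (x + s *\<^sub>R v)) has_real_derivative ?D (x + s *\<^sub>R v) v) (at s)" if "\<bar>s\<bar> \<le> t" for s
    proof -
      have rd: "(r has_derivative ?D (x + s *\<^sub>R v)) (at (x + s *\<^sub>R v))"
        using e(2)[OF near[OF that]] r smooth_on_has_derivative by blast
      have "((\<lambda>s. x + s *\<^sub>R v) has_derivative (\<lambda>h. h *\<^sub>R v)) (at s)"
        by (auto intro!: derivative_eq_intros)
      from has_derivative_compose[OF this rd] show ?thesis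
        using has_derivative_bounded_linear[OF rd]
        by (simp add: has_field_derivative_def linear_simps mult_commute_abs)
    qed
    have mono: "r (x + a *\<^sub>R v) - c * a \<le> r (x + b *\<^sub>R v) - c * b" if "- t \<le> a" "a \<le> b" "b \<le> t" for a b
    proof (rule DERIV_nonneg_imp_nondecreasing[OF that(2)])
      fix s assume "a \<le> s" "s \<le> b"
      then have s: "\<bar>s\<bar> \<le> t" using that by auto
      then show "\<exists>y. ((\<lambda>s. r (x + s *\<^sub>R v) - c * s) has_real_derivative y) (at s) \<and> 0 \<le> y"
        using e(2)[OF near[OF s]]
        by (intro exI[of _ "?D (x + s *\<^sub>R v) v - c"] conjI) (auto intro!: derivative_eq_intros der)
    qed
    have ct: "c * t = \<bar>r x\<bar>" using c by (simp add: t_def)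
    have "r (x + (- t) *\<^sub>R v) \<le> 0" "0 \<le> r (x + t *\<^sub>R v)"
      using mono[of "-t" 0] mono[of 0 t] t ct by auto
    moreover have "\<forall>s. - t \<le> s \<and> s \<le> t \<longrightarrow> isCont (\<lambda>s. r (x + s *\<^sub>R v)) s"
      using der DERIV_isCont by (meson abs_le_iff minus_le_iff)
    ultimately obtain s where s: "- t \<le> s" "s \<le> t" "r (x + s *\<^sub>R v) = 0"
      using IVT[of "\<lambda>s. r (x + s *\<^sub>R v)" "- t" 0 t] t by auto
    then have st: "\<bar>s\<bar> \<le> t" by auto
    have "dist x p < e" using near[of 0] t by simp
    then have "\<bar>\<rho> x - \<rho> (x + s *\<^sub>R v)\<bar> \<le> K * norm (x - (x + s *\<^sub>R v))"
      using e(2) near[OF st] by (intro lip(2)) auto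
    moreover have "\<rho> (x + s *\<^sub>R v) = 0"
      using e(2)[OF near[OF st]] s by (intro zero) auto
    ultimately have "\<bar>\<rho> x\<bar> \<le> K * (\<bar>s\<bar> * norm v)" by simp
    also have "\<dots> \<le> \<bar>K\<bar> * (t * norm v)"
      using st by (intro mult_mono) auto
    also have "\<dots> = (\<bar>K\<bar> * norm v / c) * \<bar>r x\<bar>"
      by (simp add: t_def)
    finally show ?case .
  qed
  then show ?thesis by blast
qed

section \<open>The model function 2 Re w + F and its comparison with arbitrary defining
  functions\<close>

lemma zpart_bounded_linear: "bounded_linear zpart"
  unfolding linear_conv_bounded_linear[symmetric] zpart_def
  by (intro linearI) (auto simp: vec_eq_iff)

lemma wpart_bounded_linear: "bounded_linear wpart"
  unfolding linear_conv_bounded_linear[symmetric] wpart_def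
  by (intro linearI) auto

lemma bounded_linear_2Re_wpart: "bounded_linear (\<lambda>y. 2 * Re (wpart y))"
  by (intro bounded_linear_const_mult bounded_linear_compose[OF bounded_linear_Re]
      wpart_bounded_linear)

definition rho :: "(complex^'n::finite \<Rightarrow> real) \<Rightarrow> complex^('n option) \<Rightarrow> real" where
  "rho F y = 2 * Re (wpart y) + F (zpart y)"

lemma rho_lipschitz_near:
  assumes "smooth_on W F" "zpart q \<in> W"
  shows "lipschitz_near (rho F) q"
proof -
  let ?V = "zpart -` W"
  have V: "open ?V"
    by (intro open_vimage smooth_on_open[OF assms(1)] linear_continuous_on zpart_bounded_linear)
  have "smooth_on ?V (\<lambda>y. 2 * Re (wpart y) + F (zpart y))"
  proof (rule smooth_on_add)
    show "smooth_on ?V (\<lambda>y. 2 * Re (wpart y))"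
      by (rule smooth_on_bounded_linear[OF V bounded_linear_2Re_wpart])
    show "smooth_on ?V (\<lambda>y. F (zpart y))"
      by (rule smooth_on_compose[OF smooth_on_bounded_linear[OF V zpart_bounded_linear] assms(1)]) auto
  qed
  then have "smooth_on ?V (rho F)" by (simp add: rho_def[abs_def])
  from smooth_on_lipschitz_near[OF this, of q] show ?thesis
    using assms(2) by simp
qed

lemma lipschitz_near_isCont:
  assumes "lipschitz_near f p" shows "isCont f p"
proof -
  obtain d K where d: "d > 0" "\<And>x y. x \<in> ball p d \<Longrightarrow> y \<in> ball p d \<Longrightarrow> dist (f x) (f y) \<le> K * dist x y"
    using assms unfolding lipschitz_near_def by metis
  have "((\<lambda>x. dist (f x) (f p)) \<longlongrightarrow> 0) (at p)"
  proof (rule tendsto_sandwich)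
    show "\<forall>\<^sub>F x in at p. 0 \<le> dist (f x) (f p)" by simp
    show "\<forall>\<^sub>F x in at p. dist (f x) (f p) \<le> K * dist x p"
      unfolding eventually_at using d by (auto intro!: exI[of _ d] simp: dist_commute)
    have "((\<lambda>x. K * dist x p) \<longlongrightarrow> K * dist p p) (at p)"
      by (intro tendsto_intros)
    then show "((\<lambda>x. K * dist x p) \<longlongrightarrow> 0) (at p)"
      by simp
  qed simp
  then show ?thesis
    unfolding isCont_def by (rule tendsto_dist_iff[THEN iffD2])
qed

lemma lipschitz_near_compose:
  assumes "lipschitz_near f p" "lipschitz_near g (f p)"
  shows "lipschitz_near (\<lambda>x. g (f x)) p"
proof -
  obtain d K where d: "d > 0" "\<And>x y. x \<in> ball p d \<Longrightarrow> y \<in> ball p d \<Longrightarrow> dist (f x) (f y) \<le> K * dist x y"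
    using assms(1) unfolding lipschitz_near_def by metis
  obtain e L where e: "e > 0" "\<And>x y. x \<in> ball (f p) e \<Longrightarrow> y \<in> ball (f p) e \<Longrightarrow> dist (g x) (g y) \<le> L * dist x y"
    using assms(2) unfolding lipschitz_near_def by metis
  have "\<forall>\<^sub>F x in nhds p. dist (f x) (f p) < e"
    using isCont_tendsto_nhds[OF lipschitz_near_isCont[OF assms(1)]] e(1) by (rule tendstoD)
  then obtain d' where d': "d' > 0" "\<And>x. dist x p < d' \<Longrightarrow> dist (f x) (f p) < e"
    unfolding eventually_nhds_metric by blast
  have "dist (g (f x)) (g (f y)) \<le> \<bar>L\<bar> * \<bar>K\<bar> * dist x y"
    if xy: "x \<in> ball p (min d d')" "y \<in> ball p (min d d')" for x y
  proof -
    have "dist (g (f x)) (g (f y)) \<le> L * dist (f x) (f y)"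
      using xy d'(2)[of x] d'(2)[of y] by (intro e(2)) (auto simp: dist_commute)
    also have "\<dots> \<le> \<bar>L\<bar> * (\<bar>K\<bar> * dist x y)"
    proof (intro mult_mono)
      have "dist (f x) (f y) \<le> K * dist x y" using xy by (intro d(2)) auto
      also have "\<dots> \<le> \<bar>K\<bar> * dist x y" by (intro mult_right_mono) auto
      finally show "dist (f x) (f y) \<le> \<bar>K\<bar> * dist x y" .
    qed auto
    finally show ?thesis by (simp add: mult.assoc)
  qed
  moreover have "min d d' > 0" using d d' by simp
  ultimately show ?thesis
    unfolding lipschitz_near_def by blast
qed

lemma good_coord_inverse:
  assumes "good_coord M p U \<Phi> W F"
  shows "holo_map_on (\<Phi> ` U) (inv_into U \<Phi>)" "0 \<in> \<Phi> ` U" "inv_into U \<Phi> 0 = p" "open (\<Phi> ` U)"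
    "\<And>y. y \<in> \<Phi> ` U \<Longrightarrow> \<Phi> (inv_into U \<Phi> y) = y" "\<And>y. y \<in> \<Phi> ` U \<Longrightarrow> inv_into U \<Phi> y \<in> U"
    "\<And>x. x \<in> U \<Longrightarrow> inv_into U \<Phi> (\<Phi> x) = x"
proof -
  have *: "holo_map_on (\<Phi> ` U) (inv_into U \<Phi>)" "\<Phi> p = 0" "p \<in> U" "inj_on \<Phi> U" "open (\<Phi> ` U)"
    using assms unfolding good_coord_def by blast+
  show "holo_map_on (\<Phi> ` U) (inv_into U \<Phi>)" "open (\<Phi> ` U)" by fact+
  show "0 \<in> \<Phi> ` U" using * by (metis imageI)
  show "inv_into U \<Phi> 0 = p" using * by (metis inv_into_f_f)
  show "\<And>y. y \<in> \<Phi> ` U \<Longrightarrow> \<Phi> (inv_into U \<Phi> y) = y" by (simp add: f_inv_into_f)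
  show "\<And>y. y \<in> \<Phi> ` U \<Longrightarrow> inv_into U \<Phi> y \<in> U" by (simp add: inv_into_into)
  show "\<And>x. x \<in> U \<Longrightarrow> inv_into U \<Phi> (\<Phi> x) = x" using * by (simp add: inv_into_f_f)
qed

lemma good_coordD:
  assumes "good_coord M p U \<Phi> W F"
  shows "open U" "p \<in> U" "holo_map_on U \<Phi>" "\<Phi> p = 0" "0 \<in> W" "smooth_on W F" "F 0 = 0"
    "(F has_derivative (\<lambda>v. 0)) (at 0)" "\<And>x. x \<in> U \<Longrightarrow> zpart (\<Phi> x) \<in> W"
    "\<And>x. x \<in> U \<Longrightarrow> x \<in> M \<longleftrightarrow> rho F (\<Phi> x) = 0"
  using assms unfolding good_coord_def rho_def by blast+

lemma norm_axis_cvec: "norm (axis k a :: complex^'n::finite) = norm a"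
proof -
  have "(\<Sum>i\<in>UNIV. (norm (axis k a $ i :: complex))\<^sup>2) = (\<Sum>i\<in>UNIV. if i = k then (norm a)\<^sup>2 else 0)"
    by (intro sum.cong) (auto simp: axis_def)
  then show ?thesis
    by (simp add: norm_vec_def L2_set_def)
qed

lemma zpart_0 [simp]: "zpart 0 = 0"
  by (simp add: zpart_def vec_eq_iff)

text \<open>Near p the zeros of r lie on M, where the model function vanishes as well. The estimate
  carries orders of tangency measured by r over to the good coordinate.\<close>

lemma rho_le_defining_function:
  assumes gc: "good_coord M p U \<Phi> W F" and r: "local_defining_fn M p V r" and "p \<in> M"
  shows "\<exists>C. \<forall>\<^sub>F x in nhds p. \<bar>rho F (\<Phi> x)\<bar> \<le> C * \<bar>r x\<bar>"
proof -
  note g = good_coordD[OF gc]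
  have V: "open V" "p \<in> V" "smooth_on V r" "frechet_derivative r (at p) \<noteq> (\<lambda>v. 0)" "M \<inter> V = {x\<in>V. r x = 0}"
    using r unfolding local_defining_fn_def by auto
  have lip: "lipschitz_near (\<lambda>x. rho F (\<Phi> x)) p"
    using lipschitz_near_compose[OF holo_map_on_lipschitz_near[OF g(3,2)]
        rho_lipschitz_near[OF g(6) g(9)[OF g(2)]]] .
  show ?thesis
  proof (rule defining_function_comparison[OF V(3,2) _ V(4) lip])
    show "r p = 0" using V \<open>p \<in> M\<close> by auto
    show "open (U \<inter> V)" "p \<in> U \<inter> V" using g(1,2) V(1,2) by auto
    show "rho F (\<Phi> x) = 0" if "x \<in> U \<inter> V" "r x = 0" for x
      using that V(5) g(10) by blast
  qed
qed

text \<open>For the opposite estimate a zero of the model function is reached explicitly by a shift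
  of Re w, so Lipschitz continuity of r in the coordinate suffices.\<close>

lemma defining_function_le_rho:
  assumes gc: "good_coord M p U \<Phi> W F" and r: "local_defining_fn M p V r"
  shows "\<exists>C. \<forall>\<^sub>F y in nhds 0. \<bar>r (inv_into U \<Phi> y)\<bar> \<le> C * \<bar>rho F y\<bar>"
proof -
  note g = good_coordD[OF gc] and i = good_coord_inverse[OF gc]
  let ?\<Psi> = "inv_into U \<Phi>"
  have V: "open V" "p \<in> V" "smooth_on V r" "M \<inter> V = {x\<in>V. r x = 0}"
    using r unfolding local_defining_fn_def by auto
  have "lipschitz_near (\<lambda>y. r (?\<Psi> y)) 0"
    using V(2) i(3)
    by (intro lipschitz_near_compose[OF holo_map_on_lipschitz_near[OF i(1,2)]]
        smooth_on_lipschitz_near[OF V(3)]) simp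
  then obtain d K where d: "d > 0"
    "\<And>x y. x \<in> ball 0 d \<Longrightarrow> y \<in> ball 0 d \<Longrightarrow> \<bar>r (?\<Psi> x) - r (?\<Psi> y)\<bar> \<le> K * norm (x - y)"
    unfolding lipschitz_near_def dist_norm real_norm_def by metis
  have "isCont ?\<Psi> 0"
    using i by (intro lipschitz_near_isCont holo_map_on_lipschitz_near[of "\<Phi> ` U"]) auto
  from topological_tendstoD[OF isCont_tendsto_nhds[OF this] V(1)]
  have "\<forall>\<^sub>F y in nhds 0. ?\<Psi> y \<in> V"
    using V(2) i(3) by simp
  then have "\<forall>\<^sub>F y in nhds 0. y \<in> ball 0 d \<and> y \<in> \<Phi> ` U \<and> ?\<Psi> y \<in> V"
    using i d by (intro eventually_conj eventually_nhds_in_open) auto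
  \<comment> \<open>The shift lowers 2 Re w by exactly \<open>rho F y\<close> and leaves z alone, so
    \<open>s y\<close> lies on the zero set of the model function, at distance \<bar>rho F y\<bar> /
    2 from y.\<close>
  moreover define s where "s = (\<lambda>y. y - axis None (complex_of_real (rho F y / 2)) :: complex^('a option))"
  have s: "isCont s 0"
  proof -
    have "isCont (rho F) 0"
      using g by (intro lipschitz_near_isCont rho_lipschitz_near[of W]) auto
    then have "isCont (\<lambda>y. complex_of_real (rho F y / 2)) 0"
      by (intro continuous_intros) auto
    then show ?thesis
      unfolding s_def
      by (intro continuous_diff continuous_ident bounded_linear.isCont[OF bounded_linear_axis])
  qed
  have "rho F 0 = 0" using g by (simp add: rho_def wpart_def)
  then have "s 0 = 0" by (simp add: s_def axis_def vec_eq_iff)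
  then have "filterlim s (nhds 0) (nhds 0)" using isCont_tendsto_nhds[OF s] by simp
  ultimately have "\<forall>\<^sub>F y in nhds 0. s y \<in> ball 0 d \<and> s y \<in> \<Phi> ` U \<and> ?\<Psi> (s y) \<in> V"
    by (rule eventually_compose_filterlim)
  moreover have "\<forall>\<^sub>F y in nhds (0::complex^('a option)). y \<in> ball 0 d"
    using d by (intro eventually_nhds_in_open) auto
  ultimately have "\<forall>\<^sub>F y in nhds 0. \<bar>r (?\<Psi> y)\<bar> \<le> (K / 2) * \<bar>rho F y\<bar>"
  proof eventually_elim
    case (elim y)
    have "Re (wpart (s y)) = Re (wpart y) - rho F y / 2" "zpart (s y) = zpart y"
      by (simp_all add: s_def wpart_def zpart_def axis_def)
    then have "rho F (s y) = 2 * Re (wpart y) + F (zpart y) - rho F y"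
      by (simp only: rho_def[of F "s y"]) simp
    then have "rho F (s y) = 0"
      by (simp add: rho_def)
    then have "?\<Psi> (s y) \<in> M"
      using elim g(10)[of "?\<Psi> (s y)"] i by auto
    then have "r (?\<Psi> (s y)) = 0" using elim V by auto
    moreover have ns: "norm (y - s y) = \<bar>rho F y\<bar> / 2"
      by (simp add: s_def norm_axis_cvec)
    moreover have "\<bar>r (?\<Psi> y) - r (?\<Psi> (s y))\<bar> \<le> K * norm (y - s y)"
      using elim by (intro d(2)) auto
    ultimately show ?case unfolding ns by simp
  qed
  then show ?thesis by blast
qed

lemma hol_germ_vanishes_1:
  assumes "hol_germ c" "c 0 = 0" shows "vanishes 1 c"
proof -
  obtain e where "e > 0" "\<And>j. (\<lambda>t. c t $ j) holomorphic_on ball 0 e"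
    using assms unfolding hol_germ_iff by blast
  then have "c differentiable at 0"
    using holomorphic_curve_has_derivative[of "ball 0 e" 0 c] unfolding differentiable_def by auto
  then show ?thesis using assms by (intro differentiable_vanishes_1)
qed

lemma has_fps_expansion_vanishes:
  fixes f :: "complex \<Rightarrow> complex"
  assumes "f has_fps_expansion G"
  shows "vanishes N (\<lambda>t. f t - (\<Sum>i<N. fps_nth G i * t ^ i))"
proof -
  have G: "fps_conv_radius G > 0" "\<forall>\<^sub>F z in nhds 0. eval_fps G z = f z"
    using assms unfolding has_fps_expansion_def by auto
  have "vanishes N (\<lambda>t::complex. t ^ N)"
    by (rule vanishesI[of _ 1]) (intro always_eventually allI, simp add: norm_power)
  moreover have "vanishes 0 (eval_fps (fps_shift N G))"
    using G by (intro continuous_vanishes_0 continuous_eval_fps) (auto simp: zero_ereal_def)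
  ultimately have "vanishes (N + 0) (\<lambda>t. t ^ N * eval_fps (fps_shift N G) t)"
    by (rule vanishes_mult)
  moreover have "\<forall>\<^sub>F t in nhds 0. f t - (\<Sum>i<N. fps_nth G i * t ^ i) = t ^ N * eval_fps (fps_shift N G) t"
  proof -
    have "\<forall>\<^sub>F t in nhds 0. t \<in> eball 0 (fps_conv_radius G)"
      using G by (intro eventually_nhds_in_open) (auto simp: zero_ereal_def)
    with G(2) show ?thesis
    proof eventually_elim
      case (elim t)
      then have t: "ereal (norm t) < fps_conv_radius G" by (simp add: in_eball_iff)
      have "f t = (\<Sum>n. fps_nth G (n + N) * t ^ (n + N)) + (\<Sum>i<N. fps_nth G i * t ^ i)"
        unfolding elim(1)[symmetric] eval_fps_def
        by (rule suminf_split_initial_segment[OF summable_fps[OF t]])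
      also have "(\<Sum>n. fps_nth G (n + N) * t ^ (n + N)) = (\<Sum>n. t ^ N * (fps_nth (fps_shift N G) n * t ^ n))"
        by (simp add: power_add mult_ac)
      also have "\<dots> = t ^ N * eval_fps (fps_shift N G) t"
        unfolding eval_fps_def using t by (intro suminf_mult summable_fps) simp
      finally show ?case by simp
    qed
  qed
  ultimately show ?thesis
    using vanishes_cong by fastforce
qed

lemma analytic_vanishes:
  "f analytic_on {0} \<Longrightarrow> vanishes N (\<lambda>t. f t - (\<Sum>i<N. fps_nth (fps_expansion f 0) i * t ^ i))"
  by (intro has_fps_expansion_vanishes analytic_at_imp_has_fps_expansion_0)

lemma fps_expansion_nth_01:
  "fps_nth (fps_expansion f 0) 0 = f 0" "fps_nth (fps_expansion f 0) (Suc 0) = deriv f 0"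
  by (simp_all add: fps_expansion_def)

text \<open>The hypothesis of Bloom--Graham infinite type enters only through the following discs.\<close>

lemma tangent_discs:
  assumes bg: "bg_type_infinite M p" and gc: "good_coord M p U \<Phi> W F" and "p \<in> M" and m: "m \<ge> 2"
    and F2: "vanishes 2 F"
  shows "\<exists>c. hol_germ c \<and> c 0 = 0 \<and> vanishes m (\<lambda>t. rho F (c t)) \<and>
    (\<forall>j. deriv (\<lambda>t. c t $ Some j) 0 = v $ j)"
proof -
  note g = good_coordD[OF gc] and i = good_coord_inverse[OF gc]
  let ?\<Psi> = "inv_into U \<Phi>"
  obtain V r where r: "local_defining_fn M p V r"
    and ex: "\<exists>V' (\<phi> :: complex^'a \<Rightarrow> complex^('a option)). 0 \<in> V' \<and> holo_map_on V' \<phi> \<and> \<phi> 0 = p \<and>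
      inj (frechet_derivative \<phi> (at 0)) \<and> (\<lambda>\<zeta>. r (\<phi> \<zeta>)) \<in> O[at 0](\<lambda>\<zeta>. norm \<zeta> ^ m)"
    using bg unfolding bg_type_infinite_def by blast
  from ex obtain V' and \<phi> :: "complex^'a \<Rightarrow> complex^('a option)" where \<phi>: "0 \<in> V'" "holo_map_on V' \<phi>"
    "\<phi> 0 = p" "inj (frechet_derivative \<phi> (at 0))" "(\<lambda>\<zeta>. r (\<phi> \<zeta>)) \<in> O[at 0](\<lambda>\<zeta>. norm \<zeta> ^ m)"
    by blast
  have "r p = 0" using r \<open>p \<in> M\<close> unfolding local_defining_fn_def by blast
  have r\<phi>: "vanishes m (\<lambda>\<zeta>. r (\<phi> \<zeta>))"
  proof -
    from \<phi>(5) obtain C where "\<forall>\<^sub>F \<zeta> in at 0. norm (r (\<phi> \<zeta>)) \<le> C * norm (norm \<zeta> ^ m)"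
      by (rule landau_o.bigE)
    then have "\<forall>\<^sub>F \<zeta> in nhds 0. norm (r (\<phi> \<zeta>)) \<le> C * norm \<zeta> ^ m"
      unfolding eventually_at_filter
      by (rule eventually_mono) (use \<open>r p = 0\<close> \<phi>(3) m in \<open>auto simp: norm_power power_0_left\<close>)
    then show ?thesis by (rule vanishesI)
  qed
  define D where "D = (\<lambda>u. frechet_derivative \<Phi> (at p) (frechet_derivative \<phi> (at 0) u))"
  define c where "c = (\<lambda>u t. \<Phi> (\<phi> (t *s u)))"
  have line: "hol_germ (\<lambda>t. t *s u)" for u :: "complex^'a"
    unfolding hol_germ_def by (auto intro!: analytic_intros)
  have line\<phi>: "hol_germ (\<lambda>t. \<phi> (t *s u))" for u
    using holo_map_on_hol_germ[OF \<phi>(2) line] \<phi>(1) by simp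
  have c0: "c u 0 = 0" for u using \<phi> g by (simp add: c_def)
  have hol: "hol_germ (c u)" for u
    unfolding c_def using holo_map_on_hol_germ[OF g(3) line\<phi>] g(2) \<phi>(3) by simp
  have D\<phi>: "(\<phi> has_derivative frechet_derivative \<phi> (at 0)) (at 0)"
    and D\<Phi>: "(\<Phi> has_derivative frechet_derivative \<Phi> (at p)) (at p)"
    using holo_map_on_frechet(1) \<phi> g by blast+
  have DD: "((\<lambda>\<zeta>. \<Phi> (\<phi> \<zeta>)) has_derivative D) (at 0)"
    using has_derivative_compose[OF D\<phi>, of \<Phi>] D\<Phi> \<phi>(3) by (simp add: D_def[abs_def])
  have Dmult: "D (t *s u) = t *s D u" for t u
    using holo_map_on_frechet(2) \<phi> g by (metis D_def)
  have dc: "deriv (\<lambda>t. c u t $ j) 0 = D u $ j" for u j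
  proof -
    have "((\<lambda>t. t *s u) has_derivative (\<lambda>h. h *s u)) (at 0)"
      by (rule has_derivative_cvecI) (auto intro!: derivative_eq_intros)
    from has_derivative_cvec_nth[OF has_derivative_compose[OF this, of "\<lambda>\<zeta>. \<Phi> (\<phi> \<zeta>)" D], of j]
    have "((\<lambda>t. c u t $ j) has_derivative (\<lambda>h. D (h *s u) $ j)) (at 0)"
      using DD by (simp add: c_def)
    moreover have "(\<lambda>h. D (h *s u) $ j) = (*) (D u $ j)" by (auto simp: Dmult)
    ultimately show ?thesis
      by (simp add: has_field_derivative_def DERIV_imp_deriv)
  qed
  have van: "vanishes m (\<lambda>t. rho F (c u t))" for u
  proof -
    obtain C where C: "\<forall>\<^sub>F x in nhds p. \<bar>rho F (\<Phi> x)\<bar> \<le> C * \<bar>r x\<bar>"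
      using rho_le_defining_function[OF gc r \<open>p \<in> M\<close>] by blast
    have "filterlim (\<lambda>t. \<phi> (t *s u)) (nhds p) (nhds 0)"
      using isCont_tendsto_nhds[OF hol_germ_continuous[OF line\<phi>[of u]]] \<phi>(3) by simp
    from eventually_compose_filterlim[OF C this]
    have 1: "\<forall>\<^sub>F t in nhds 0. norm (rho F (c u t)) \<le> C * norm (r (\<phi> (t *s u)))" by (simp add: c_def)
    have "vanishes m (\<lambda>t. r (\<phi> (t *s u)))"
      by (rule vanishes_compose[OF r\<phi> hol_germ_vanishes_1[OF line]]) simp
    then show ?thesis by (rule vanishes_dominated[OF 1])
  qed
  \<comment> \<open>Since F has order two, the linear part of the model function along the disc is 2
    Re (a t). It vanishes because m is at least 2; evaluating at t = 1 and t = \<i> gives a = 0, so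
    the disc is tangent to w = 0.\<close>
  have w0: "D u $ None = 0" for u
  proof -
    let ?a = "D u $ None"
    have an: "(\<lambda>t. c u t $ None) analytic_on {0}" using hol unfolding hol_germ_def by blast
    have "vanishes 2 (\<lambda>t. c u t $ None - (\<Sum>i<2. fps_nth (fps_expansion (\<lambda>t. c u t $ None) 0) i * t ^ i))"
      by (rule analytic_vanishes[OF an])
    then have "vanishes 2 (\<lambda>t. c u t $ None - ?a * t)"
      using c0[of u] by (simp add: numeral_2_eq_2 fps_expansion_nth_01 dc)
    then have "vanishes 2 (\<lambda>t. 2 * Re (c u t $ None - ?a * t))"
      by (rule vanishes_linear) (intro bounded_linear_const_mult bounded_linear_Re)
    moreover have "vanishes 2 (\<lambda>t. F (zpart (c u t)))"
    proof (rule vanishes_compose[OF F2])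
      show "vanishes 1 (\<lambda>t. zpart (c u t))"
        by (rule vanishes_linear[OF hol_germ_vanishes_1[OF hol c0] zpart_bounded_linear])
    qed
    moreover have "vanishes 2 (\<lambda>t. rho F (c u t))"
      using van m by (rule vanishes_mono)
    ultimately have "vanishes 2 (\<lambda>t. rho F (c u t) - F (zpart (c u t)) - 2 * Re (c u t $ None - ?a * t))"
      by (intro vanishes_diff)
    then have v2: "vanishes 2 (\<lambda>t. 2 * Re (?a * t))"
      by (simp add: rho_def wpart_def)
    have "vanishes 2 (\<lambda>t. \<Sum>k<2::nat. if k = 1 then 2 * Re (?a * t) else 0)"
      using v2 by (simp add: numeral_2_eq_2)
    then have "(if 1 = (1::nat) then 2 * Re (?a * t) else 0) = 0" for t
      by (rule homogeneous_sum_vanishes[rotated]) (auto simp: algebra_simps)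
    from this[of 1] this[of \<i>] show ?thesis by (simp add: complex_eq_iff)
  qed
  have lin: "linear (\<lambda>u. zpart (D u))"
    using bounded_linear_compose[OF zpart_bounded_linear has_derivative_bounded_linear[OF DD]]
    by (simp add: bounded_linear.linear)
  \<comment> \<open>\<open>D\<close> is injective because \<phi> is an immersion and \<Phi> is
    invertible. Its image lies in w = 0, so injectivity survives the projection to z, and equality
    of dimensions then yields every direction v.\<close>
  have "inj (\<lambda>u. zpart (D u))"
    unfolding linear_injective_0[OF lin]
  proof (intro allI impI)
    fix u assume "zpart (D u) = 0"
    then have "D u $ j = 0" for j
      using w0[of u] by (cases j) (auto simp: zpart_def vec_eq_iff)
    then have "D u = 0" by (simp add: vec_eq_iff)
    have "(?\<Psi> has_derivative frechet_derivative ?\<Psi> (at 0)) (at 0)"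
      using holo_map_on_frechet(1) i by blast
    then have "((\<lambda>x. ?\<Psi> (\<Phi> x)) has_derivative
        (\<lambda>h. frechet_derivative ?\<Psi> (at 0) (frechet_derivative \<Phi> (at p) h))) (at p)"
      using has_derivative_compose[OF D\<Phi>, of ?\<Psi>] g(4) by simp
    moreover have "((\<lambda>x. ?\<Psi> (\<Phi> x)) has_derivative (\<lambda>h. h)) (at p)"
      by (rule has_derivative_transform_within_open[OF has_derivative_ident g(1,2)]) (simp add: i(7))
    ultimately have "frechet_derivative ?\<Psi> (at 0) (frechet_derivative \<Phi> (at p) h) = h" for h
      using has_derivative_unique by (metis (no_types, lifting))
    from this[of "frechet_derivative \<phi> (at 0) u"]
    have "frechet_derivative ?\<Psi> (at 0) 0 = frechet_derivative \<phi> (at 0) u"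
      using \<open>D u = 0\<close> by (simp add: D_def)
    moreover have "frechet_derivative ?\<Psi> (at 0) 0 = 0"
      using holo_map_on_frechet(1)[OF i(1,2)] has_derivative_bounded_linear
      by (blast intro: linear_simps)
    moreover have "frechet_derivative \<phi> (at 0) 0 = 0"
      using D\<phi> has_derivative_bounded_linear by (blast intro: linear_simps)
    ultimately show "u = 0" using \<phi>(4) by (metis injD)
  qed
  then have "surj (\<lambda>u. zpart (D u))"
    using linear_injective_imp_surjective[OF lin] by blast
  then obtain u where "v = zpart (D u)" by (metis surjD)
  then show ?thesis
    using c0[of u] hol[of u] van[of u] dc[of u] by (intro exI[of _ "c u"]) (simp add: zpart_def)
qed

subsection \<open>The Taylor series is pure\<close>

definition zmono :: "('n::finite \<Rightarrow> nat) \<Rightarrow> complex^'n \<Rightarrow> complex" where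
  "zmono \<alpha> z = (\<Prod>j\<in>UNIV. z $ j ^ \<alpha> j)"

text \<open>The index bounds the degrees of the monomials from below, so it records the order at 0
  and leaves the degree free.\<close>

definition hol_poly :: "nat \<Rightarrow> (complex^'n::finite \<Rightarrow> complex) \<Rightarrow> bool" where
  "hol_poly d Q \<longleftrightarrow> (\<exists>S a. finite S \<and> (\<forall>\<alpha>\<in>S. d \<le> sum \<alpha> UNIV) \<and> Q = (\<lambda>z. \<Sum>\<alpha>\<in>S. a \<alpha> * zmono \<alpha> z))"

lemma zmono_mult_var: "z $ j * zmono \<alpha> z = zmono (\<alpha>(j := Suc (\<alpha> j))) z"
proof -
  have "zmono (\<alpha>(j := Suc (\<alpha> j))) z = z $ j ^ Suc (\<alpha> j) * (\<Prod>i\<in>UNIV - {j}. z $ i ^ \<alpha> i)"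
    unfolding zmono_def by (subst prod.remove[of _ j]) (auto intro!: prod.cong)
  moreover have "zmono \<alpha> z = z $ j ^ \<alpha> j * (\<Prod>i\<in>UNIV - {j}. z $ i ^ \<alpha> i)"
    unfolding zmono_def by (subst prod.remove[of _ j]) auto
  ultimately show ?thesis by simp
qed

lemma sum_upd_Suc: "sum (\<alpha>(j := Suc (\<alpha> j))) UNIV = Suc (sum \<alpha> (UNIV :: 'n::finite set))"
  by (simp add: sum.remove[of _ j])

lemma hol_poly_zmono: "d \<le> sum \<alpha> UNIV \<Longrightarrow> hol_poly d (\<lambda>z. c * zmono \<alpha> z)"
  unfolding hol_poly_def by (intro exI[of _ "{\<alpha>}"] exI[of _ "\<lambda>_. c"]) auto

lemma hol_poly_zero: "hol_poly d (\<lambda>z. 0)"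
  unfolding hol_poly_def by (intro exI[of _ "{}"]) auto

lemma hol_poly_add:
  assumes "hol_poly d P" "hol_poly d Q" shows "hol_poly d (\<lambda>z. P z + Q z)"
proof -
  obtain S a where S: "finite S" "\<forall>\<alpha>\<in>S. d \<le> sum \<alpha> UNIV" "P = (\<lambda>z. \<Sum>\<alpha>\<in>S. a \<alpha> * zmono \<alpha> z)"
    using assms(1) unfolding hol_poly_def by blast
  obtain T b where T: "finite T" "\<forall>\<alpha>\<in>T. d \<le> sum \<alpha> UNIV" "Q = (\<lambda>z. \<Sum>\<alpha>\<in>T. b \<alpha> * zmono \<alpha> z)"
    using assms(2) unfolding hol_poly_def by blast
  let ?a = "\<lambda>\<alpha>. if \<alpha> \<in> S then a \<alpha> else 0" and ?b = "\<lambda>\<alpha>. if \<alpha> \<in> T then b \<alpha> else 0"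
  have "P z = (\<Sum>\<alpha>\<in>S \<union> T. ?a \<alpha> * zmono \<alpha> z)" "Q z = (\<Sum>\<alpha>\<in>S \<union> T. ?b \<alpha> * zmono \<alpha> z)" for z
    unfolding S(3) T(3) using S(1) T(1) by (intro sum.mono_neutral_cong_left; auto)+
  then have "(\<lambda>z. P z + Q z) = (\<lambda>z. \<Sum>\<alpha>\<in>S \<union> T. (?a \<alpha> + ?b \<alpha>) * zmono \<alpha> z)"
    by (simp add: distrib_right sum.distrib)
  then show ?thesis
    unfolding hol_poly_def using S T by (intro exI[of _ "S \<union> T"]) auto
qed

lemma hol_poly_sum:
  "finite I \<Longrightarrow> (\<And>i. i \<in> I \<Longrightarrow> hol_poly d (f i)) \<Longrightarrow> hol_poly d (\<lambda>z. \<Sum>i\<in>I. f i z)"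
  by (induction I rule: finite_induct) (auto intro: hol_poly_add hol_poly_zero)

lemma hol_poly_weaken: "hol_poly d Q \<Longrightarrow> d' \<le> d \<Longrightarrow> hol_poly d' Q"
  unfolding hol_poly_def using order_trans by blast

lemma hol_poly_cmult: "hol_poly d Q \<Longrightarrow> hol_poly d (\<lambda>z. c * Q z)"
proof -
  assume "hol_poly d Q"
  then obtain S a where S: "finite S" "\<forall>\<alpha>\<in>S. d \<le> sum \<alpha> UNIV" "Q = (\<lambda>z. \<Sum>\<alpha>\<in>S. a \<alpha> * zmono \<alpha> z)"
    unfolding hol_poly_def by blast
  have "hol_poly d (\<lambda>z. \<Sum>\<alpha>\<in>S. (c * a \<alpha>) * zmono \<alpha> z)"
    using S by (intro hol_poly_sum hol_poly_zmono) auto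
  then show ?thesis by (simp add: S(3) sum_distrib_left mult.assoc)
qed

lemma hol_poly_mult_var:
  assumes "hol_poly d Q" shows "hol_poly (Suc d) (\<lambda>z. z $ j * Q z)"
proof -
  obtain S a where S: "finite S" "\<forall>\<alpha>\<in>S. d \<le> sum \<alpha> UNIV" "Q = (\<lambda>z. \<Sum>\<alpha>\<in>S. a \<alpha> * zmono \<alpha> z)"
    using assms unfolding hol_poly_def by blast
  have "hol_poly (Suc d) (\<lambda>z. \<Sum>\<alpha>\<in>S. a \<alpha> * zmono (\<alpha>(j := Suc (\<alpha> j))) z)"
    using S(1,2) sum_upd_Suc[of _ j] by (intro hol_poly_sum hol_poly_zmono) (auto simp del: fun_upd_apply)
  moreover have "z $ j * Q z = (\<Sum>\<alpha>\<in>S. a \<alpha> * zmono (\<alpha>(j := Suc (\<alpha> j))) z)" for z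
    unfolding S(3) sum_distrib_left by (simp add: zmono_mult_var[symmetric] mult_ac)
  ultimately show ?thesis by simp
qed

lemma hol_poly_var_power:
  "hol_poly d Q \<Longrightarrow> hol_poly d (\<lambda>z. z $ j ^ k * Q z)"
proof (induction k)
  case (Suc k)
  have "hol_poly (Suc d) (\<lambda>z. z $ j * (z $ j ^ k * Q z))"
    using Suc by (intro hol_poly_mult_var)
  then show ?case using hol_poly_weaken[of "Suc d" _ d] by (simp add: mult.assoc)
qed simp

lemma zmono_smooth: "smooth_on UNIV (zmono \<alpha>)"
  unfolding zmono_def[abs_def]
  by (intro smooth_on_prod smooth_on_power smooth_on_bounded_linear bounded_linear_vec_nth) auto

lemma hol_poly_smooth: "hol_poly d Q \<Longrightarrow> smooth_on UNIV Q"
  unfolding hol_poly_def by (auto intro!: smooth_on_sum smooth_on_mult smooth_on_const zmono_smooth)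

lemma zmono_vanishes: "vanishes (sum \<alpha> UNIV) (zmono \<alpha>)"
proof (rule vanishesI[of _ 1], intro always_eventually allI)
  fix z :: "complex^'a"
  have "norm (zmono \<alpha> z) = (\<Prod>j\<in>UNIV. norm (z $ j) ^ \<alpha> j)"
    by (simp add: zmono_def norm_power flip: prod_norm)
  also have "\<dots> \<le> (\<Prod>j\<in>UNIV. norm z ^ \<alpha> j)"
    by (intro prod_mono) (auto intro!: power_mono Finite_Cartesian_Product.norm_nth_le)
  finally show "norm (zmono \<alpha> z) \<le> 1 * norm z ^ sum \<alpha> UNIV"
    by (simp add: power_sum)
qed

lemma hol_poly_vanishes:
  assumes "hol_poly d Q" shows "vanishes d Q"
proof -
  obtain S a where S: "finite S" "\<forall>\<alpha>\<in>S. d \<le> sum \<alpha> UNIV" "Q = (\<lambda>z. \<Sum>\<alpha>\<in>S. a \<alpha> * zmono \<alpha> z)"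
    using assms unfolding hol_poly_def by blast
  have "vanishes d (\<lambda>z. \<Sum>\<alpha>\<in>S. a \<alpha> * zmono \<alpha> z)"
    using S(1,2) by (intro vanishes_sum vanishes_linear[where L = "(*) _"] bounded_linear_mult_right
        vanishes_mono[OF zmono_vanishes]) auto
  then show ?thesis by (simp add: S(3))
qed

lemma zmono_curve_analytic:
  assumes "hol_germ c" shows "(\<lambda>t. zmono \<alpha> (c t)) analytic_on {0}"
  using assms unfolding zmono_def hol_germ_def by (intro analytic_intros) auto

lemma hol_poly_curve_analytic:
  assumes "hol_poly d Q" "hol_germ c" shows "(\<lambda>t. Q (c t)) analytic_on {0}"
proof -
  obtain S a where S: "finite S" "Q = (\<lambda>z. \<Sum>\<alpha>\<in>S. a \<alpha> * zmono \<alpha> z)"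
    using assms unfolding hol_poly_def by blast
  show ?thesis
    unfolding S(2) by (intro analytic_intros zmono_curve_analytic assms)
qed

text \<open>The splitting into parts of bidegree (p, k - p) in z and its conjugate, recorded through
  their behaviour under complex dilations. The top part is a holomorphic polynomial; it will supply
  the next term of S.\<close>

lemma hpoly_bidegree:
  fixes f :: "complex^'n::finite \<Rightarrow> complex"
  assumes "hpoly k f"
  shows "\<exists>g. (\<forall>p\<le>k. \<forall>t z. g p (t *s z) = t ^ p * cnj t ^ (k - p) * g p z) \<and>
    (\<forall>p z. g p differentiable at z) \<and> hol_poly k (g k) \<and> (\<forall>z. f z = (\<Sum>p\<le>k. g p z))"
  using assms
proof (induction rule: hpoly.induct)
  case (const c)
  have "hol_poly 0 (\<lambda>z::complex^'n. c * zmono (\<lambda>_. 0) z)" by (rule hol_poly_zmono) simp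
  then show ?case
    by (intro exI[of _ "\<lambda>_ _. c"]) (auto simp: zmono_def)
next
  case (add k f g)
  then obtain f' g' where
    "(\<forall>p\<le>k. \<forall>t z. f' p (t *s z) = t ^ p * cnj t ^ (k - p) * f' p z) \<and>
    (\<forall>p z. f' p differentiable at z) \<and> hol_poly k (f' k) \<and> (\<forall>z. f z = (\<Sum>p\<le>k. f' p z))"
    "(\<forall>p\<le>k. \<forall>t z. g' p (t *s z) = t ^ p * cnj t ^ (k - p) * g' p z) \<and>
    (\<forall>p z. g' p differentiable at z) \<and> hol_poly k (g' k) \<and> (\<forall>z. g z = (\<Sum>p\<le>k. g' p z))"
    by blast
  then show ?case
    by (intro exI[of _ "\<lambda>p z. f' p z + g' p z"])
      (auto simp: sum.distrib algebra_simps intro: hol_poly_add)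
next
  case (inner k f b)
  then obtain g where g: "\<And>p t z. p \<le> k \<Longrightarrow> g p (t *s z) = t ^ p * cnj t ^ (k - p) * g p z"
    "\<And>p z. g p differentiable at z" "hol_poly k (g k)" "\<And>z. f z = (\<Sum>p\<le>k. g p z)"
    by blast
  obtain j u where b: "b = axis j u"
    using inner(2) unfolding Basis_vec_def by blast
  \<comment> \<open>A real coordinate is half of \<open>cnj u * z $ j\<close> plus half of its
    conjugate. The first summand raises the holomorphic degree p, the second the antiholomorphic
    one.\<close>
  define g' where "g' = (\<lambda>p z. (if p = 0 then 0 else cnj u / 2 * (z $ j * g (p - 1) z))
    + (if p \<le> k then u / 2 * cnj (z $ j) * g p z else 0))"
  have inn: "complex_of_real (z \<bullet> b) = cnj u / 2 * z $ j + u / 2 * cnj (z $ j)" for z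
    unfolding b inner_axis by (simp add: complex_eq_iff inner_complex_def field_simps)
  have "g' p (t *s z) = t ^ p * cnj t ^ (Suc k - p) * g' p z" if "p \<le> Suc k" for p t z
  proof -
    have h1: "cnj u / 2 * ((t *s z) $ j * g (p - 1) (t *s z))
        = t ^ p * cnj t ^ (Suc k - p) * (cnj u / 2 * (z $ j * g (p - 1) z))" if "p \<noteq> 0"
      using g(1)[of "p - 1" t z] that \<open>p \<le> Suc k\<close> by (cases p) (auto simp: mult_ac)
    have h2: "u / 2 * cnj ((t *s z) $ j) * g p (t *s z)
        = t ^ p * cnj t ^ (Suc k - p) * (u / 2 * cnj (z $ j) * g p z)" if "p \<le> k"
      using g(1)[of p t z] that by (auto simp: Suc_diff_le mult_ac)
    show ?thesis
      unfolding g'_def using h1 h2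
      by (cases "p = 0"; cases "p \<le> k")
        (simp_all only: distrib_left if_True if_False mult_zero_right simp_thms)
  qed
  moreover have "g' p differentiable at z" for p z
  proof -
    have 1: "(\<lambda>z::complex^'n. z $ j) differentiable at z"
      by (intro bounded_linear_imp_differentiable bounded_linear_vec_nth)
    have 2: "(\<lambda>z::complex^'n. cnj (z $ j)) differentiable at z"
      by (intro bounded_linear_imp_differentiable bounded_linear_compose[OF bounded_linear_cnj]
          bounded_linear_vec_nth)
    show ?thesis
      unfolding g'_def using 1 2 g(2) by (cases "p = 0"; cases "p \<le> k") (auto intro!: differentiable_add differentiable_mult)
  qed
  moreover have "hol_poly (Suc k) (g' (Suc k))"
    unfolding g'_def using hol_poly_cmult[OF hol_poly_mult_var[OF g(3)], of "cnj u / 2" j] by simp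
  moreover have "(z \<bullet> b) *\<^sub>R f z = (\<Sum>p\<le>Suc k. g' p z)" for z
  proof -
    have "(\<Sum>p\<le>Suc k. g' p z) = (\<Sum>p\<le>Suc k. if p = 0 then 0 else cnj u / 2 * (z $ j * g (p - 1) z))
        + (\<Sum>p\<le>Suc k. if p \<le> k then u / 2 * cnj (z $ j) * g p z else 0)"
      unfolding g'_def by (rule sum.distrib)
    also have "(\<Sum>p\<le>Suc k. if p = 0 then 0 else cnj u / 2 * (z $ j * g (p - 1) z))
        = cnj u / 2 * z $ j * (\<Sum>p\<le>k. g p z)"
      by (subst sum.atMost_Suc_shift) (simp add: sum_distrib_left mult.assoc)
    also have "(\<Sum>p\<le>Suc k. if p \<le> k then u / 2 * cnj (z $ j) * g p z else 0)
        = u / 2 * cnj (z $ j) * (\<Sum>p\<le>k. g p z)"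
      by (simp add: sum_distrib_left)
    finally show ?thesis
      by (simp add: scaleR_conv_of_real inn g(4) algebra_simps)
  qed
  ultimately show ?case by blast
qed

text \<open>A nonzero polynomial has finitely many roots, and the circle is infinite. The square is
  there because \<open>t ^ k * (t ^ p * cnj t ^ (k - p))\<close> equals \<open>t ^ (2 * p)\<close>
  on the unit circle.\<close>

lemma trig_poly_zero:
  fixes e :: "nat \<Rightarrow> complex"
  assumes "\<And>t. norm t = 1 \<Longrightarrow> (\<Sum>p\<le>k. e p * (t\<^sup>2) ^ p) = 0" "p \<le> k"
  shows "e p = 0"
proof (rule ccontr)
  assume "e p \<noteq> 0"
  then have "finite {z. (\<Sum>i\<le>k. e i * z ^ i) = 0}"
    using assms(2) polyfun_finite_roots[of e k] by blast
  moreover have "sphere 0 1 \<subseteq> {z. (\<Sum>i\<le>k. e i * z ^ i) = 0}"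
  proof
    fix z :: complex assume "z \<in> sphere 0 1"
    then have "norm (csqrt z) = 1" by (simp add: norm_csqrt)
    from assms(1)[OF this] show "z \<in> {z. (\<Sum>i\<le>k. e i * z ^ i) = 0}" by simp
  qed
  moreover have "infinite (sphere (0::complex) 1)"
    using connected_uncountable[of "sphere (0::complex) 1" 1 "-1"] connected_sphere[of "0::complex" 1]
    by (auto dest: uncountable_infinite)
  ultimately show False using finite_subset by blast
qed

text \<open>Restricted to a tangent disc with direction \<open>v\<close>, the first possibly mixed homogeneous part of
  \<open>F\<close> must be harmonic in the parameter. Hence its components of mixed bidegree vanish at \<open>v\<close>.\<close>

lemma pure_homogeneous_part:
  fixes F :: "complex^'n::finite \<Rightarrow> real"
  assumes Q: "hol_poly 2 Q" and k: "k \<ge> 2" and P: "hpoly k P"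
    and FP: "vanishes (Suc k) (\<lambda>z. of_real (F z - 2 * Re (Q z)) - P z)"
    and g: "\<And>p t z. p \<le> k \<Longrightarrow> g p (t *s z) = t ^ p * cnj t ^ (k - p) * g p z"
      "\<And>p z. g p differentiable at z" "\<And>z. P z = (\<Sum>p\<le>k. g p z)"
    and c: "hol_germ c" "c 0 = 0" "vanishes (Suc k) (\<lambda>t. rho F (c t))"
      "\<And>j. deriv (\<lambda>t. c t $ Some j) 0 = v $ j"
  shows "P v = complex_of_real (2 * Re (g k v))"
proof -
  let ?z = "\<lambda>t. zpart (c t)"
  \<comment> \<open>The z-part of the disc divided by t, extended by v at t = 0. It differs from v
    by O(t), so \<open>g p\<close> along the disc has leading coefficient
    \<open>g p v\<close>.\<close>
  define y where "y = (\<lambda>t. if t = 0 then v else (1 / t) *s ?z t)"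
  have zy: "?z t = t *s y t" for t
    using c(2) by (simp add: y_def vec_eq_iff zpart_def)
  have z1: "vanishes 1 ?z"
    by (rule vanishes_linear[OF hol_germ_vanishes_1[OF c(1,2)] zpart_bounded_linear])
  have hz: "hol_germ ?z" using c(1) unfolding hol_germ_def zpart_def by simp
  have y1: "vanishes 1 (\<lambda>t. y t - v)"
  proof -
    have "vanishes 2 (\<lambda>t. c t $ Some j - v $ j * t)" for j
    proof -
      have an: "(\<lambda>t. c t $ Some j) analytic_on {0}" using c(1) unfolding hol_germ_def by blast
      have "vanishes 2 (\<lambda>t. c t $ Some j - (\<Sum>i<2. fps_nth (fps_expansion (\<lambda>t. c t $ Some j) 0) i * t ^ i))"
        by (rule analytic_vanishes[OF an])
      then show ?thesis
        using c(2,4) by (simp add: numeral_2_eq_2 fps_expansion_nth_01)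
    qed
    then have "vanishes 2 (\<lambda>t. \<Sum>j\<in>UNIV. axis j (c t $ Some j - v $ j * t))"
      by (intro vanishes_sum vanishes_linear[OF _ bounded_linear_axis]) auto
    moreover have "(\<Sum>j\<in>UNIV. axis j (c t $ Some j - v $ j * t)) = t *s (y t - v)" for t
    proof -
      have "t *s (y t - v) = ?z t - t *s v" by (simp add: zy vector_ssub_ldistrib)
      then show ?thesis
        using sum_axis_cvec[of "t *s (y t - v)"] by (simp add: zpart_def mult.commute)
    qed
    ultimately have "vanishes 2 (\<lambda>t. t *s (y t - v))" by simp
    then obtain C where "\<forall>\<^sub>F t in nhds 0. norm (t *s (y t - v)) \<le> C * norm t ^ 2"
      unfolding vanishes_def by blast
    then have "\<forall>\<^sub>F t in nhds 0. norm (y t - v) \<le> C * norm t ^ 1"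
    proof eventually_elim
      case (elim t)
      then have "norm t * norm (y t - v) \<le> norm t * (C * norm t)"
        unfolding norm_smult_cvec by (simp add: power2_eq_square mult_ac)
      then show ?case
        by (cases "t = 0") (simp_all add: y_def)
    qed
    then show ?thesis by (rule vanishesI)
  qed
  have gp: "vanishes (Suc k) (\<lambda>t. g p (?z t) - t ^ p * cnj t ^ (k - p) * g p v)" if "p \<le> k" for p
  proof -
    have "(\<lambda>h. g p (v + h) - g p v) differentiable at 0"
    proof (rule differentiable_diff)
      show "(\<lambda>h. g p (v + h)) differentiable at 0"
        using differentiable_compose[of "g p" "\<lambda>h. v + h" 0 UNIV] g(2)[of p v] by simp
    qed simp
    then have "vanishes 1 (\<lambda>h. g p (v + h) - g p v)" by (rule differentiable_vanishes_1) simp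
    from vanishes_compose[OF this y1] have "vanishes 1 (\<lambda>t. g p (y t) - g p v)" by simp
    moreover have "vanishes k (\<lambda>t. t ^ p * cnj t ^ (k - p))"
      by (rule vanishesI[of _ 1]) (use that in \<open>simp add: norm_mult norm_power flip: power_add\<close>)
    ultimately have "vanishes (k + 1) (\<lambda>t. t ^ p * cnj t ^ (k - p) * (g p (y t) - g p v))"
      by (intro vanishes_mult)
    then show ?thesis
      by (simp add: zy g(1)[OF that] right_diff_distrib)
  qed
  \<comment> \<open>The w-component and Q enter the model function through the real part of this
    holomorphic function, so they contribute harmonic terms only.\<close>
  define A where "A = (\<lambda>t. c t $ None + Q (?z t))"
  have "A analytic_on {0}"
    unfolding A_def using c(1) hol_poly_curve_analytic[OF Q hz]
    by (intro analytic_intros) (auto simp: hol_germ_def)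
  define a where "a = (\<lambda>i. fps_nth (fps_expansion A 0) i)"
  have A: "vanishes (Suc k) (\<lambda>t. A t - (\<Sum>i<Suc k. a i * t ^ i))"
    unfolding a_def by (rule analytic_vanishes) fact
  define H where "H = (\<lambda>t. \<Sum>p\<le>k. t ^ p * cnj t ^ (k - p) * g p v)"
  have sumv: "vanishes (Suc k) (\<lambda>t. complex_of_real (2 * Re (\<Sum>i<Suc k. a i * t ^ i)) + H t)"
  proof -
    have 1: "vanishes (Suc k) (\<lambda>t. complex_of_real (rho F (c t)))"
      by (rule vanishes_linear[OF c(3) bounded_linear_of_real])
    have 2: "vanishes (Suc k) (\<lambda>t. complex_of_real (2 * Re (A t - (\<Sum>i<Suc k. a i * t ^ i))))"
      by (rule vanishes_linear[OF A])
        (intro bounded_linear_compose[OF bounded_linear_of_real] bounded_linear_const_mult bounded_linear_Re)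
    have 3: "vanishes (Suc k) (\<lambda>t. of_real (F (?z t) - 2 * Re (Q (?z t))) - P (?z t))"
      by (rule vanishes_compose[OF FP z1])
    have 4: "vanishes (Suc k) (\<lambda>t. \<Sum>p\<le>k. g p (?z t) - t ^ p * cnj t ^ (k - p) * g p v)"
      by (intro vanishes_sum gp) auto
    have "vanishes (Suc k) (\<lambda>t. complex_of_real (rho F (c t))
      - complex_of_real (2 * Re (A t - (\<Sum>i<Suc k. a i * t ^ i)))
      - (of_real (F (?z t) - 2 * Re (Q (?z t))) - P (?z t))
      - (\<Sum>p\<le>k. g p (?z t) - t ^ p * cnj t ^ (k - p) * g p v))"
      by (intro vanishes_diff 1 2 3 4)
    moreover have "complex_of_real (rho F (c t))
      - complex_of_real (2 * Re (A t - (\<Sum>i<Suc k. a i * t ^ i)))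
      - (of_real (F (?z t) - 2 * Re (Q (?z t))) - P (?z t))
      - (\<Sum>p\<le>k. g p (?z t) - t ^ p * cnj t ^ (k - p) * g p v)
      = complex_of_real (2 * Re (\<Sum>i<Suc k. a i * t ^ i)) + H t" for t
      by (simp add: rho_def wpart_def A_def H_def g(3) sum_subtractf del: sum.lessThan_Suc)
    ultimately show ?thesis by (simp only:)
  qed
  \<comment> \<open>The terms of degree i in t of the model function along the disc; the part
    \<open>H\<close> that comes from P has degree k.\<close>
  define f where "f = (\<lambda>i t. complex_of_real (2 * Re (a i * t ^ i)) + (if i = k then H t else 0))"
  have fsum: "(\<Sum>i<Suc k. f i t) = complex_of_real (2 * Re (\<Sum>i<Suc k. a i * t ^ i)) + H t" for t
    unfolding f_def sum.distrib by (simp add: sum_distrib_left)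
  have Hhom: "H (r *\<^sub>R t) = r ^ k *\<^sub>R H t" for r :: real and t
  proof -
    have "(r *\<^sub>R t) ^ p * cnj (r *\<^sub>R t) ^ (k - p) * g p v = r ^ k *\<^sub>R (t ^ p * cnj t ^ (k - p) * g p v)"
      if "p \<le> k" for p
    proof -
      have "(r *\<^sub>R t) ^ p * cnj (r *\<^sub>R t) ^ (k - p) = of_real (r ^ p * r ^ (k - p)) * (t ^ p * cnj t ^ (k - p))"
        by (simp add: scaleR_conv_of_real power_mult_distrib)
      also have "r ^ p * r ^ (k - p) = r ^ k" using that by (simp flip: power_add)
      finally show ?thesis by (simp add: scaleR_conv_of_real)
    qed
    then show ?thesis unfolding H_def scaleR_sum_right by (intro sum.cong) auto
  qed
  have fk: "f k t = 0" for t
  proof (rule homogeneous_sum_vanishes[where m = "Suc k" and f = f])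
    show "vanishes (Suc k) (\<lambda>t. \<Sum>i<Suc k. f i t)" using sumv by (simp only: fsum)
    show "f i (r *\<^sub>R t) = r ^ i *\<^sub>R f i t" if "r > 0" for i r t
      using Hhom[of r t]
      by (auto simp: f_def scaleR_conv_of_real power_mult_distrib algebra_simps simp flip: of_real_power)
  qed simp
  \<comment> \<open>Coefficients in powers of t^2 after multiplication by t^k on the unit circle:
    there \<open>a k * t ^ k\<close> and its conjugate land on the exponents k and 0.\<close>
  define e where "e = (\<lambda>p. g p v + (if p = k then a k else 0) + (if p = 0 then cnj (a k) else 0))"
  have e: "e p = 0" if "p \<le> k" for p
  proof (rule trig_poly_zero[where e = e, OF _ that])
    fix t :: complex assume t: "norm t = 1"
    then have tc: "t * cnj t = 1" by (simp add: complex_norm_square[symmetric])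
    have pw: "t ^ k * (t ^ p * cnj t ^ (k - p)) = (t\<^sup>2) ^ p" if "p \<le> k" for p
    proof -
      have "t ^ k = t ^ p * t ^ (k - p)" using that by (simp flip: power_add)
      then have "t ^ k * (t ^ p * cnj t ^ (k - p)) = t ^ p * t ^ p * (t * cnj t) ^ (k - p)"
        by (simp add: power_mult_distrib)
      then show ?thesis using tc by (simp add: power2_eq_square power_mult_distrib)
    qed
    have "complex_of_real (2 * Re (a k * t ^ k)) = a k * t ^ k + cnj (a k) * cnj t ^ k"
      using complex_add_cnj[of "a k * t ^ k"] by simp
    then have "0 = t ^ k * (a k * t ^ k + cnj (a k) * cnj t ^ k + H t)"
      using fk[of t] by (simp add: f_def)
    also have "\<dots> = a k * (t\<^sup>2) ^ k + cnj (a k) + t ^ k * H t"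
      using pw[of k] pw[of 0] by (simp add: distrib_left mult_ac)
    also have "t ^ k * H t = (\<Sum>p\<le>k. g p v * (t\<^sup>2) ^ p)"
      unfolding H_def sum_distrib_left using pw by (intro sum.cong) (auto simp: mult_ac)
    also have "a k * (t\<^sup>2) ^ k + cnj (a k) + (\<Sum>p\<le>k. g p v * (t\<^sup>2) ^ p) = (\<Sum>p\<le>k. e p * (t\<^sup>2) ^ p)"
      unfolding e_def distrib_right sum.distrib
      by (simp add: if_distrib[of "\<lambda>x. x * _"] cong: if_cong)
    finally show "(\<Sum>p\<le>k. e p * (t\<^sup>2) ^ p) = 0" by simp
  qed
  \<comment> \<open>Both pure components are read off from \<open>a k\<close> and are therefore
    conjugate to each other. Since k > 0, the exponents 0 and k are distinct.\<close>
  have gk: "g k v = - a k" "g 0 v = - cnj (a k)"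
    using e[of k] e[of 0] k by (simp_all add: e_def eq_neg_iff_add_eq_0)
  have "P v = (\<Sum>p\<le>k. (if p = k then g k v else 0) + (if p = 0 then g 0 v else 0))"
  proof (unfold g(3), intro sum.cong refl)
    fix p assume "p \<in> {..k}"
    then show "g p v = (if p = k then g k v else 0) + (if p = 0 then g 0 v else 0)"
      using e[of p] k by (simp add: e_def split: if_splits)
  qed
  also have "\<dots> = g k v + g 0 v"
    unfolding sum.distrib by simp
  finally show ?thesis
    using gk by (simp add: complex_eq_iff)
qed

text \<open>Induction on the order. A disc tangent to order \<open>Suc k\<close> in each direction v
  shows that the part of degree k of F - 2 Re Q is 2 Re of its top component, and this component is
  absorbed into Q.\<close>

lemma taylor_pure:
  fixes F :: "complex^'n::finite \<Rightarrow> real"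
  assumes F: "smooth_on W F" "0 \<in> W" "vanishes 2 F"
    and discs: "\<And>m v. m \<ge> 2 \<Longrightarrow> \<exists>c. hol_germ c \<and> c 0 = 0 \<and> vanishes m (\<lambda>t. rho F (c t)) \<and>
      (\<forall>j. deriv (\<lambda>t. c t $ Some j) 0 = v $ j)"
    and "k \<ge> 2"
  shows "\<exists>Q. hol_poly 2 Q \<and> vanishes k (\<lambda>z. F z - 2 * Re (Q z))"
  using \<open>k \<ge> 2\<close>
proof (induction k rule: dec_induct)
  case base
  then show ?case using F(3) by (intro exI[of _ "\<lambda>z. 0"]) (simp add: hol_poly_zero)
next
  case (step k)
  then obtain Q where Q: "hol_poly 2 Q" "vanishes k (\<lambda>z. F z - 2 * Re (Q z))" by blast
  define H where "H = (\<lambda>z. complex_of_real (F z - 2 * Re (Q z)))"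
  have "smooth_on W (\<lambda>z. F z - 2 * Re (Q z))"
    using smooth_on_subset[OF hol_poly_smooth[OF Q(1)] smooth_on_open[OF F(1)]]
    by (intro smooth_on_diff F smooth_on_linear_compose[where L = "\<lambda>x. 2 * Re x"]
        bounded_linear_const_mult bounded_linear_Re) auto
  then have Hs: "smooth_on W H"
    unfolding H_def by (rule smooth_on_linear_compose[OF _ bounded_linear_of_real])
  have Hv: "vanishes k H"
    unfolding H_def by (rule vanishes_linear[OF Q(2) bounded_linear_of_real])
  obtain P where P: "\<And>i. hpoly i (P i)" "vanishes (Suc k) (\<lambda>z. H z - (\<Sum>i<Suc k. P i z))"
    using taylor_hpoly[OF Hs F(2)] by blast
  have P0: "P i z = 0" if "i < k" for i z
  proof (rule homogeneous_sum_vanishes[where m = k and f = P])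
    have "vanishes k (\<lambda>z. H z - (H z - (\<Sum>i<Suc k. P i z)) - P k z)"
      by (intro vanishes_diff Hv vanishes_mono[OF P(2)] hpoly_vanishes[OF P(1)]) simp
    then show "vanishes k (\<lambda>z. \<Sum>i<k. P i z)" by simp
  qed (use that hpoly_homogeneous[OF P(1)] in auto)
  have HP: "vanishes (Suc k) (\<lambda>z. H z - P k z)"
    using P(2) P0 by simp
  obtain g where g: "\<And>p t z. p \<le> k \<Longrightarrow> g p (t *s z) = t ^ p * cnj t ^ (k - p) * g p z"
    "\<And>p z. g p differentiable at z" "hol_poly k (g k)" "\<And>z. P k z = (\<Sum>p\<le>k. g p z)"
    using hpoly_bidegree[OF P(1)[of k]] by blast
  have Pk: "P k v = complex_of_real (2 * Re (g k v))" for v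
  proof -
    obtain c where "hol_germ c" "c 0 = 0" "vanishes (Suc k) (\<lambda>t. rho F (c t))"
      "\<And>j. deriv (\<lambda>t. c t $ Some j) 0 = v $ j"
      using discs[of "Suc k" v] step.hyps by auto
    then show ?thesis
      using HP g by (intro pure_homogeneous_part[OF Q(1) step.hyps(1) P(1), where g = g and c = c and F = F])
        (auto simp: H_def)
  qed
  have "vanishes (Suc k) (\<lambda>z. Re (H z - P k z))"
    by (rule vanishes_linear[OF HP bounded_linear_Re])
  then have "vanishes (Suc k) (\<lambda>z. F z - 2 * Re (Q z + g k z))"
    by (simp add: Pk H_def algebra_simps)
  moreover have "hol_poly 2 (\<lambda>z. Q z + g k z)"
    using Q(1) hol_poly_weaken[OF g(3) step.hyps(1)] by (rule hol_poly_add)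
  ultimately show ?case by blast
qed

subsection \<open>The Taylor coefficients and the formal composition\<close>

lemma wirt_smooth:
  assumes "smooth_on U g" shows "smooth_on U (wirt j g)"
proof -
  have "smooth_on U (\<lambda>x. frechet_derivative g (at x) (axis j 1) - \<i> * frechet_derivative g (at x) (axis j \<i>))"
    using assms by (intro smooth_on_diff smooth_on_mult smooth_on_const smooth_on_frechet_derivative)
      (auto simp: smooth_on_open)
  from smooth_on_linear_compose[OF this bounded_linear_divide[of 2]] show ?thesis
    by (simp add: wirt_def[abs_def])
qed

lemma foldr_wirt_smooth: "smooth_on U g \<Longrightarrow> smooth_on U (foldr wirt js g)"
  by (induction js) (auto intro: wirt_smooth)

lemma wirt_cong_open:
  assumes "open U" "x \<in> U" "\<And>y. y \<in> U \<Longrightarrow> f y = g y"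
  shows "wirt j f x = wirt j g x"
proof -
  have "frechet_derivative f (at x) = frechet_derivative g (at x)"
    using assms by (rule frechet_derivative_cong_open)
  then show ?thesis by (simp add: wirt_def)
qed

lemma wirt_add:
  assumes "smooth_on U f" "smooth_on U g" "x \<in> U"
  shows "wirt j (\<lambda>x. f x + g x) x = wirt j f x + wirt j g x"
proof -
  have "frechet_derivative (\<lambda>x. f x + g x) (at x)
      = (\<lambda>v. frechet_derivative f (at x) v + frechet_derivative g (at x) v)"
    using assms by (intro frechet_derivative_eqI has_derivative_add smooth_on_has_derivative)
  then show ?thesis by (simp add: wirt_def field_simps)
qed

lemma foldr_wirt_add:
  assumes "smooth_on U f" "smooth_on U g" "x \<in> U"
  shows "foldr wirt js (\<lambda>x. f x + g x) x = foldr wirt js f x + foldr wirt js g x"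
  using assms(3)
proof (induction js arbitrary: x)
  case (Cons j js)
  have "wirt j (foldr wirt js (\<lambda>x. f x + g x)) x = wirt j (\<lambda>x. foldr wirt js f x + foldr wirt js g x) x"
    using Cons by (intro wirt_cong_open[OF smooth_on_open[OF assms(1)]])
  also have "\<dots> = wirt j (foldr wirt js f) x + wirt j (foldr wirt js g) x"
    by (intro wirt_add[OF _ _ Cons.prems] foldr_wirt_smooth assms)
  finally show ?case by simp
qed simp

lemma wirt_zero: "wirt j (\<lambda>x. 0) = (\<lambda>x. 0)"
  by (simp add: wirt_def[abs_def])

lemma foldr_wirt_zero: "foldr wirt js (\<lambda>x. 0) = (\<lambda>x. 0)"
  by (induction js) (auto simp: wirt_zero)

lemma foldr_wirt_sum:
  assumes "open U" "x \<in> U" "finite I" "\<And>i. i \<in> I \<Longrightarrow> smooth_on U (f i)"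
  shows "foldr wirt js (\<lambda>x. \<Sum>i\<in>I. f i x) x = (\<Sum>i\<in>I. foldr wirt js (f i) x)"
  using assms(3,4)
proof (induction I rule: finite_induct)
  case (insert i I)
  then have "foldr wirt js (\<lambda>x. f i x + (\<Sum>i\<in>I. f i x)) x
      = foldr wirt js (f i) x + foldr wirt js (\<lambda>x. \<Sum>i\<in>I. f i x) x"
    using assms by (intro foldr_wirt_add[where U = U] smooth_on_sum) auto
  with insert show ?case by simp
qed (simp add: foldr_wirt_zero)

lemma foldr_wirt_vanishes:
  assumes "smooth_on W G" "0 \<in> W" "vanishes (m + length js) G"
  shows "vanishes m (foldr wirt js G)"
  using assms(3)
proof (induction js arbitrary: m)
  case (Cons j js)
  let ?H = "foldr wirt js G"
  have "vanishes (Suc m) ?H" using Cons by simp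
  then have "vanishes m (\<lambda>x. frechet_derivative ?H (at x) v)" for v
    by (rule vanishes_derivative[OF foldr_wirt_smooth[OF assms(1)] assms(2)])
  then have "vanishes m (\<lambda>x. frechet_derivative ?H (at x) (axis j 1) - \<i> * frechet_derivative ?H (at x) (axis j \<i>))"
    by (intro vanishes_diff vanishes_linear[where L = "(*) \<i>"] bounded_linear_mult_right)
  from vanishes_linear[OF this bounded_linear_divide[of 2]] show ?case
    by (simp add: wirt_def[abs_def])
qed simp

lemma directional_derivativeI:
  assumes "g differentiable at x" "((\<lambda>s. g (x + s *\<^sub>R v)) has_vector_derivative d) (at 0)"
  shows "frechet_derivative g (at x) v = d"
proof -
  let ?D = "frechet_derivative g (at x)"
  have D: "(g has_derivative ?D) (at x)" using assms(1) by (simp add: frechet_derivative_works)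
  have "((\<lambda>s::real. x + s *\<^sub>R v) has_derivative (\<lambda>h. h *\<^sub>R v)) (at 0)"
    by (auto intro!: derivative_eq_intros)
  from has_derivative_compose[OF this, of g ?D] D
  have "((\<lambda>s. g (x + s *\<^sub>R v)) has_vector_derivative ?D v) (at 0)"
    using has_derivative_bounded_linear[OF D] by (simp add: has_vector_derivative_def linear_simps)
  then show ?thesis using assms(2) vector_derivative_unique_at by blast
qed

lemma zmono_axis_derivative:
  "((\<lambda>s. zmono \<alpha> (x + s *\<^sub>R axis j a)) has_vector_derivative
    a * (of_nat (\<alpha> j) * zmono (\<alpha>(j := \<alpha> j - 1)) x)) (at 0)"
proof -
  let ?R = "\<Prod>i\<in>UNIV - {j}. x $ i ^ \<alpha> i"
  have eq: "zmono \<alpha> (x + s *\<^sub>R axis j a) = (x $ j + of_real s * a) ^ \<alpha> j * ?R" for s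
    unfolding zmono_def
    by (subst prod.remove[of _ j]) (auto simp: axis_def scaleR_conv_of_real[where 'a = complex] intro!: prod.cong)
  have "zmono (\<alpha>(j := \<alpha> j - 1)) x = x $ j ^ (\<alpha> j - 1) * ?R"
    unfolding zmono_def by (subst prod.remove[of _ j]) (auto intro!: prod.cong)
  moreover have "((\<lambda>s. (x $ j + of_real s * a) ^ \<alpha> j * ?R) has_vector_derivative
      (of_nat (\<alpha> j) * a * x $ j ^ (\<alpha> j - 1)) * ?R) (at 0)"
  proof -
    have "((\<lambda>z. (x $ j + z * a) ^ \<alpha> j * ?R) has_field_derivative
      (of_nat (\<alpha> j) * a * x $ j ^ (\<alpha> j - 1)) * ?R) (at (of_real 0))"
      by (auto intro!: derivative_eq_intros)
    from has_vector_derivative_real_field[OF this] show ?thesis .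
  qed
  ultimately show ?thesis unfolding eq by (simp add: mult_ac)
qed

lemma zmono_differentiable: "zmono \<alpha> differentiable at x"
  using smooth_on_differentiable[OF zmono_smooth] by blast

lemma wirt_zmono:
  "wirt j (\<lambda>z. c * zmono \<alpha> z) = (\<lambda>z. (c * of_nat (\<alpha> j)) * zmono (\<alpha>(j := \<alpha> j - 1)) z)"
proof
  fix x
  have "frechet_derivative (\<lambda>z. c * zmono \<alpha> z) (at x) (axis j a)
      = c * (a * (of_nat (\<alpha> j) * zmono (\<alpha>(j := \<alpha> j - 1)) x))" for a
    by (intro directional_derivativeI has_vector_derivative_mult_right zmono_axis_derivative
        differentiable_mult differentiable_const zmono_differentiable)
  then show "wirt j (\<lambda>z. c * zmono \<alpha> z) x = (c * of_nat (\<alpha> j)) * zmono (\<alpha>(j := \<alpha> j - 1)) x"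
    unfolding wirt_def by (simp add: algebra_simps)
qed

lemma wirt_cnj_zmono: "wirt j (\<lambda>z. cnj (c * zmono \<alpha> z)) = (\<lambda>z. 0)"
proof
  fix x
  have "frechet_derivative (\<lambda>z. cnj (c * zmono \<alpha> z)) (at x) (axis j a)
      = cnj (c * (a * (of_nat (\<alpha> j) * zmono (\<alpha>(j := \<alpha> j - 1)) x)))" for a
  proof (rule directional_derivativeI)
    have "(\<lambda>z. c * zmono \<alpha> z) differentiable at x"
      by (intro differentiable_mult differentiable_const zmono_differentiable)
    then show "(\<lambda>z. cnj (c * zmono \<alpha> z)) differentiable at x"
      unfolding differentiable_def using bounded_linear.has_derivative[OF bounded_linear_cnj] by blast
    show "((\<lambda>s. cnj (c * zmono \<alpha> (x + s *\<^sub>R axis j a))) has_vector_derivative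
      cnj (c * (a * (of_nat (\<alpha> j) * zmono (\<alpha>(j := \<alpha> j - 1)) x)))) (at 0)"
      by (intro has_vector_derivative_cnj has_vector_derivative_mult_right zmono_axis_derivative)
  qed
  then show "wirt j (\<lambda>z. cnj (c * zmono \<alpha> z)) x = 0"
    unfolding wirt_def by (simp add: mult.left_commute[of \<i> "cnj c"])
qed

lemma zmono_0: "zmono \<alpha> 0 = (if \<alpha> = (\<lambda>_. 0) then 1 else 0)"
  by (auto simp: zmono_def fun_eq_iff power_0_left)

text \<open>One Wirtinger derivative annihilates an antiholomorphic monomial; for the empty list the
  nonconstant monomial itself is 0 at the origin.\<close>

lemma foldr_wirt_cnj_zmono:
  "\<alpha> \<noteq> (\<lambda>_. 0) \<Longrightarrow> foldr wirt js (\<lambda>z. cnj (c * zmono \<alpha> z)) 0 = 0"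
proof -
  assume \<alpha>: "\<alpha> \<noteq> (\<lambda>_. 0)"
  have "foldr wirt js (\<lambda>z. cnj (c * zmono \<alpha> z)) = (\<lambda>z. 0)" if "js \<noteq> []"
    using that
  proof (induction js)
    case (Cons j js)
    then show ?case by (cases "js = []") (auto simp: wirt_zero wirt_cnj_zmono simp del: complex_cnj_mult)
  qed simp
  then show ?thesis using \<alpha> by (cases "js = []") (auto simp: zmono_0)
qed

text \<open>The truncated subtraction is harmless: if an index occurs more often than its exponent
  allows, the falling factorial contains the factor 0.\<close>

lemma foldr_wirt_zmono:
  "foldr wirt js (\<lambda>z. c * zmono \<alpha> z) = (\<lambda>z. (c * of_nat (\<Prod>j\<in>UNIV. \<Prod>i<count (mset js) j. \<alpha> j - i))
    * zmono (\<lambda>j. \<alpha> j - count (mset js) j) z)"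
proof (induction js)
  case (Cons j js)
  let ?n = "count (mset js)"
  have "(\<Prod>i\<in>UNIV. \<Prod>l<count (mset (j # js)) i. \<alpha> i - l)
      = (\<Prod>l<Suc (?n j). \<alpha> j - l) * (\<Prod>i\<in>UNIV - {j}. \<Prod>l<?n i. \<alpha> i - l)"
    by (subst prod.remove[of _ j]) (auto intro!: prod.cong)
  moreover have "(\<Prod>i\<in>UNIV. \<Prod>l<?n i. \<alpha> i - l)
      = (\<Prod>l<?n j. \<alpha> j - l) * (\<Prod>i\<in>UNIV - {j}. \<Prod>l<?n i. \<alpha> i - l)"
    by (subst prod.remove[of _ j]) auto
  ultimately have 1: "(\<Prod>i\<in>UNIV. \<Prod>l<count (mset (j # js)) i. \<alpha> i - l)
      = (\<Prod>i\<in>UNIV. \<Prod>l<?n i. \<alpha> i - l) * (\<alpha> j - ?n j)"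
    by simp
  have 2: "(\<lambda>i. \<alpha> i - ?n i)(j := \<alpha> j - ?n j - 1) = (\<lambda>i. \<alpha> i - count (mset (j # js)) i)"
    by (auto simp: fun_eq_iff)
  show ?case
    unfolding foldr.simps o_def Cons wirt_zmono 1 2[symmetric] by (simp add: mult.assoc)
qed simp

lemma mi_list_count: "count (mset (mi_list \<alpha>)) j = \<alpha> j"
proof -
  have "finite {j. 0 < \<alpha> j}" by simp
  then have "count (Abs_multiset \<alpha>) = \<alpha>" by simp
  moreover obtain js where "mset js = Abs_multiset \<alpha>" using ex_mset by blast
  ultimately have "\<exists>js. \<forall>j. count (mset js) j = \<alpha> j" by metis
  from someI_ex[OF this] show ?thesis unfolding mi_list_def by simp
qed

lemma length_mi_list: "length (mi_list \<alpha>) = sum \<alpha> UNIV"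
proof -
  have "length (mi_list \<alpha>) = size (mset (mi_list \<alpha>))" by simp
  also have "\<dots> = (\<Sum>j\<in>set_mset (mset (mi_list \<alpha>)). count (mset (mi_list \<alpha>)) j)"
    by (rule size_multiset_overloaded_eq)
  also have "\<dots> = (\<Sum>j\<in>UNIV. count (mset (mi_list \<alpha>)) j)"
    by (rule sum.mono_neutral_left) (auto simp: not_in_iff)
  finally show ?thesis by (simp only: mi_list_count)
qed

lemma foldr_wirt_mi_list_zmono:
  "foldr wirt (mi_list \<beta>) (\<lambda>z. c * zmono \<alpha> z) 0 = (if \<alpha> = \<beta> then c * of_nat (\<Prod>j\<in>UNIV. fact (\<beta> j)) else 0)"
proof -
  have eq: "foldr wirt (mi_list \<beta>) (\<lambda>z. c * zmono \<alpha> z) 0 = (c * of_nat (\<Prod>j\<in>UNIV. \<Prod>i<\<beta> j. \<alpha> j - i))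
    * zmono (\<lambda>j. \<alpha> j - \<beta> j) 0"
    by (simp only: foldr_wirt_zmono mi_list_count)
  show ?thesis
  proof (cases "\<alpha> = \<beta>")
    case True
    have "(\<Prod>i<\<beta> j. \<beta> j - i) = fact (\<beta> j)" for j
      by (simp add: fact_prod_rev atLeast0LessThan)
    with True eq show ?thesis by (simp add: zmono_0)
  next
    case False
    then obtain j where "\<alpha> j \<noteq> \<beta> j" by auto
    show ?thesis
    proof (cases "\<exists>j. \<alpha> j < \<beta> j")
      case True
      then obtain j where "\<alpha> j < \<beta> j" by blast
      then have "(\<Prod>i<\<beta> j. \<alpha> j - i) = 0" by (intro prod_zero) auto
      then have "(\<Prod>j\<in>UNIV. \<Prod>i<\<beta> j. \<alpha> j - i) = 0" by (intro prod_zero) auto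
      then show ?thesis unfolding eq using False by simp
    next
      case True': False
      then have "\<alpha> j - \<beta> j \<noteq> 0" using \<open>\<alpha> j \<noteq> \<beta> j\<close> by (meson diff_is_0_eq le_antisym not_less)
      then have "zmono (\<lambda>j. \<alpha> j - \<beta> j) 0 = 0" unfolding zmono_0 by metis
      then show ?thesis unfolding eq using False by simp
    qed
  qed
qed

text \<open>2 Re Q is Q plus its conjugate. At 0 the derivatives in \<open>c_coeff\<close>
  annihilate the conjugate, and also the remainder, whose order N exceeds the number of derivatives
  taken.\<close>

lemma c_coeff_eq:
  fixes F :: "complex^'n::finite \<Rightarrow> real"
  assumes F: "smooth_on W F" "0 \<in> W" and S: "finite S" "\<forall>\<alpha>\<in>S. 2 \<le> sum \<alpha> UNIV"
    and van: "vanishes N (\<lambda>z. F z - 2 * Re (\<Sum>\<alpha>\<in>S. a \<alpha> * zmono \<alpha> z))" and "sum \<beta> UNIV < N"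
  shows "c_coeff F \<beta> = (if \<beta> \<in> S then a \<beta> else 0)"
proof -
  define Q where "Q = (\<lambda>z. \<Sum>\<alpha>\<in>S. a \<alpha> * zmono \<alpha> z)"
  define Q' where "Q' = (\<lambda>z. \<Sum>\<alpha>\<in>S. cnj (a \<alpha> * zmono \<alpha> z))"
  define G where "G = (\<lambda>z. complex_of_real (F z - 2 * Re (Q z)))"
  note W = smooth_on_open[OF F(1)]
  have sm: "smooth_on W (\<lambda>z. c * zmono \<alpha> z)" for c \<alpha>
    using W by (intro smooth_on_mult smooth_on_const smooth_on_subset[OF zmono_smooth]) auto
  have sm': "smooth_on W (\<lambda>z. cnj (c * zmono \<alpha> z))" for c \<alpha>
    by (rule smooth_on_linear_compose[OF sm bounded_linear_cnj])
  have Qs: "smooth_on W Q" "smooth_on W Q'"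
    unfolding Q_def Q'_def using W S(1) by (intro smooth_on_sum sm sm'; simp)+
  have Gs: "smooth_on W G"
    unfolding G_def
    by (intro smooth_on_linear_compose[OF _ bounded_linear_of_real] smooth_on_diff F
        smooth_on_linear_compose[OF Qs(1), where L = "\<lambda>x. 2 * Re x"] bounded_linear_const_mult bounded_linear_Re)
  have "Q' z = cnj (Q z)" for z
    by (simp add: Q_def Q'_def)
  then have "complex_of_real (F z) = (Q z + Q' z) + G z" for z
    unfolding G_def by (simp add: complex_eq_iff)
  then have "foldr wirt (mi_list \<beta>) (\<lambda>z. complex_of_real (F z)) 0
      = foldr wirt (mi_list \<beta>) (\<lambda>z. (Q z + Q' z) + G z) 0" by simp
  also have "\<dots> = foldr wirt (mi_list \<beta>) Q 0 + foldr wirt (mi_list \<beta>) Q' 0 + foldr wirt (mi_list \<beta>) G 0"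
    using Qs Gs F(2) by (simp add: foldr_wirt_add[where U = W] smooth_on_add)
  also have "foldr wirt (mi_list \<beta>) G 0 = 0"
  proof -
    have "vanishes N G"
      unfolding G_def Q_def by (rule vanishes_linear[OF van bounded_linear_of_real])
    then have "vanishes (Suc 0 + length (mi_list \<beta>)) G"
      using \<open>sum \<beta> UNIV < N\<close> by (rule_tac vanishes_mono) (auto simp: length_mi_list)
    from vanishes_zero_at[OF foldr_wirt_vanishes[OF Gs F(2) this]] show ?thesis .
  qed
  also have "foldr wirt (mi_list \<beta>) Q' 0 = 0"
  proof -
    have "\<alpha> \<noteq> (\<lambda>_. 0)" if "\<alpha> \<in> S" for \<alpha> using that S(2) by fastforce
    then show ?thesis
      unfolding Q'_def using foldr_wirt_sum[OF W F(2) S(1) sm'] by (simp add: foldr_wirt_cnj_zmono del: complex_cnj_mult)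
  qed
  also have "foldr wirt (mi_list \<beta>) Q 0 = (\<Sum>\<alpha>\<in>S. if \<alpha> = \<beta> then a \<alpha> * of_nat (\<Prod>j\<in>UNIV. fact (\<beta> j)) else 0)"
    unfolding Q_def using foldr_wirt_sum[OF W F(2) S(1) sm] by (simp add: foldr_wirt_mi_list_zmono)
  also have "\<dots> = (if \<beta> \<in> S then a \<beta> else 0) * of_nat (\<Prod>j\<in>UNIV. fact (\<beta> j))"
    using S(1) by simp
  finally show ?thesis
    unfolding c_coeff_def by simp
qed

lemma finite_multi_indices: "finite {\<alpha> :: 'n::finite \<Rightarrow> nat. \<forall>j. \<alpha> j \<le> N}"
proof -
  have "{\<alpha> :: 'n \<Rightarrow> nat. \<forall>j. \<alpha> j \<le> N} = PiE UNIV (\<lambda>_. {..N})" by (auto simp: PiE_def)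
  then show ?thesis by (simp add: finite_PiE)
qed

text \<open>Q may change with N, but its coefficients in degrees below N are those of S, so a
  partial sum of S can replace it. The box of exponents up to N contains every \<alpha> of degree
  below N, and the remaining monomials have order at least N.\<close>

lemma taylor_c_coeff:
  fixes F :: "complex^'n::finite \<Rightarrow> real"
  assumes F: "smooth_on W F" "0 \<in> W" and Q: "hol_poly 2 Q" "vanishes N (\<lambda>z. F z - 2 * Re (Q z))"
  shows "vanishes N (\<lambda>z. F z - 2 * Re (\<Sum>\<alpha>\<in>{\<alpha>. \<forall>j. \<alpha> j \<le> N}. c_coeff F \<alpha> * zmono \<alpha> z))"
proof -
  let ?B = "{\<alpha> :: 'n \<Rightarrow> nat. \<forall>j. \<alpha> j \<le> N}"
  obtain S a where S: "finite S" "\<forall>\<alpha>\<in>S. 2 \<le> sum \<alpha> UNIV" "Q = (\<lambda>z. \<Sum>\<alpha>\<in>S. a \<alpha> * zmono \<alpha> z)"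
    using Q(1) unfolding hol_poly_def by blast
  let ?a = "\<lambda>\<alpha>. if \<alpha> \<in> S then a \<alpha> else 0" and ?c = "\<lambda>\<alpha>. if \<alpha> \<in> ?B then c_coeff F \<alpha> else 0"
  have "Q z - (\<Sum>\<alpha>\<in>?B. c_coeff F \<alpha> * zmono \<alpha> z) = (\<Sum>\<alpha>\<in>S \<union> ?B. (?a \<alpha> - ?c \<alpha>) * zmono \<alpha> z)" for z
  proof -
    have "Q z = (\<Sum>\<alpha>\<in>S \<union> ?B. ?a \<alpha> * zmono \<alpha> z)"
      unfolding S(3) using S(1) finite_multi_indices by (intro sum.mono_neutral_cong_left) auto
    moreover have "(\<Sum>\<alpha>\<in>?B. c_coeff F \<alpha> * zmono \<alpha> z) = (\<Sum>\<alpha>\<in>S \<union> ?B. ?c \<alpha> * zmono \<alpha> z)"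
      using S(1) finite_multi_indices by (intro sum.mono_neutral_cong_left) auto
    ultimately show ?thesis by (simp only: left_diff_distrib sum_subtractf)
  qed
  moreover have "vanishes N (\<lambda>z. (?a \<alpha> - ?c \<alpha>) * zmono \<alpha> z)" for \<alpha>
  proof (cases "sum \<alpha> UNIV < N")
    case True
    have "\<alpha> j \<le> sum \<alpha> UNIV" for j by (rule member_le_sum) auto
    then have "\<alpha> \<in> ?B" using True by (auto intro: order_trans less_imp_le)
    moreover have "c_coeff F \<alpha> = ?a \<alpha>"
      using c_coeff_eq[OF F S(1,2) Q(2)[unfolded S(3)] True] .
    ultimately show ?thesis by (simp add: vanishes_zero)
  next
    case False
    then show ?thesis
      by (intro vanishes_linear[OF vanishes_mono[OF zmono_vanishes]] bounded_linear_mult_right) auto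
  qed
  then have "vanishes N (\<lambda>z. \<Sum>\<alpha>\<in>S \<union> ?B. (?a \<alpha> - ?c \<alpha>) * zmono \<alpha> z)"
    using S(1) finite_multi_indices by (intro vanishes_sum) auto
  ultimately have "vanishes N (\<lambda>z. Q z - (\<Sum>\<alpha>\<in>?B. c_coeff F \<alpha> * zmono \<alpha> z))" by (simp only:)
  then have "vanishes N (\<lambda>z. 2 * Re (Q z - (\<Sum>\<alpha>\<in>?B. c_coeff F \<alpha> * zmono \<alpha> z)))"
    by (rule vanishes_linear) (intro bounded_linear_const_mult bounded_linear_Re)
  from vanishes_add[OF Q(2) this] show ?thesis by simp
qed

lemma has_fps_expansion_ghat:
  "hol_germ \<gamma> \<Longrightarrow> (\<lambda>t. \<gamma> t $ j) has_fps_expansion ghat_fps \<gamma> j"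
  using analytic_at_imp_has_fps_expansion_0[of "\<lambda>t. \<gamma> t $ j"]
  by (simp add: hol_germ_def ghat_fps_def fps_expansion_def)

lemma has_fps_expansion_zmono:
  assumes "hol_germ \<gamma>"
  shows "(\<lambda>t. zmono \<alpha> (\<gamma> t)) has_fps_expansion (\<Prod>j\<in>UNIV. ghat_fps \<gamma> j ^ \<alpha> j)"
  unfolding zmono_def
  by (intro has_fps_expansion_prod has_fps_expansion_power has_fps_expansion_ghat assms)

lemma fps_prod_power_nth_zero:
  fixes f :: "'j::finite \<Rightarrow> complex fps"
  assumes "\<And>j. fps_nth (f j) 0 = 0" "k < sum \<alpha> UNIV"
  shows "fps_nth (\<Prod>j\<in>UNIV. f j ^ \<alpha> j) k = 0"
proof -
  have "f j = fps_X * fps_shift 1 (f j)" for j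
    using assms(1)[of j] by (simp add: fps_eq_iff fps_X_mult_nth)
  then have "(\<Prod>j\<in>UNIV. f j ^ \<alpha> j) = (\<Prod>j\<in>UNIV. (fps_X * fps_shift 1 (f j)) ^ \<alpha> j)"
    by metis
  also have "\<dots> = fps_X ^ sum \<alpha> UNIV * (\<Prod>j\<in>UNIV. fps_shift 1 (f j) ^ \<alpha> j)"
    by (simp add: power_mult_distrib prod.distrib power_sum)
  finally show ?thesis using assms(2) by (simp add: fps_X_power_mult_nth)
qed

text \<open>The exact sense in which F \<circ> \<gamma> has the Taylor series 2 Re (S \<circ>
  \<gamma>). A monomial with an exponent above k contributes nothing to t^k, so the box for N and
  the smaller box in \<open>S_comp\<close> give the same coefficient.\<close>

lemma F_curve_expansion:
  fixes F :: "complex^'n::finite \<Rightarrow> real"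
  assumes F: "smooth_on W F" "0 \<in> W" and Q: "hol_poly 2 Q" "vanishes N (\<lambda>z. F z - 2 * Re (Q z))"
    and \<gamma>: "hol_germ \<gamma>" "\<gamma> 0 = 0"
  shows "vanishes N (\<lambda>t. F (\<gamma> t) - 2 * Re (\<Sum>k<N. fps_nth (S_comp F \<gamma>) k * t ^ k))"
proof -
  let ?B = "\<lambda>N. {\<alpha> :: 'n \<Rightarrow> nat. \<forall>j. \<alpha> j \<le> N}"
  define E where "E = (\<Sum>\<alpha>\<in>?B N. fps_const (c_coeff F \<alpha>) * (\<Prod>j\<in>UNIV. ghat_fps \<gamma> j ^ \<alpha> j))"
  have "(\<lambda>t. \<Sum>\<alpha>\<in>?B N. c_coeff F \<alpha> * zmono \<alpha> (\<gamma> t)) has_fps_expansion E"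
    unfolding E_def
    by (intro has_fps_expansion_sum has_fps_expansion_mult has_fps_expansion_const has_fps_expansion_zmono \<gamma>(1))
  from has_fps_expansion_vanishes[OF this, of N]
  have "vanishes N (\<lambda>t. 2 * Re ((\<Sum>\<alpha>\<in>?B N. c_coeff F \<alpha> * zmono \<alpha> (\<gamma> t)) - (\<Sum>k<N. fps_nth E k * t ^ k)))"
    by (rule vanishes_linear) (intro bounded_linear_const_mult bounded_linear_Re)
  moreover have "vanishes N (\<lambda>t. F (\<gamma> t) - 2 * Re (\<Sum>\<alpha>\<in>?B N. c_coeff F \<alpha> * zmono \<alpha> (\<gamma> t)))"
    by (rule vanishes_compose[OF taylor_c_coeff[OF F Q] hol_germ_vanishes_1[OF \<gamma>]])
  ultimately have "vanishes N (\<lambda>t. 2 * Re ((\<Sum>\<alpha>\<in>?B N. c_coeff F \<alpha> * zmono \<alpha> (\<gamma> t)) - (\<Sum>k<N. fps_nth E k * t ^ k))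
    + (F (\<gamma> t) - 2 * Re (\<Sum>\<alpha>\<in>?B N. c_coeff F \<alpha> * zmono \<alpha> (\<gamma> t))))"
    by (rule vanishes_add)
  then have van: "vanishes N (\<lambda>t. F (\<gamma> t) - 2 * Re (\<Sum>k<N. fps_nth E k * t ^ k))"
    by (simp add: algebra_simps)
  have "fps_nth E k = fps_nth (S_comp F \<gamma>) k" if "k < N" for k
  proof -
    have g0: "fps_nth (ghat_fps \<gamma> j) 0 = 0" for j using \<gamma>(2) by (simp add: ghat_fps_def)
    let ?p = "\<lambda>\<alpha>. fps_nth (\<Prod>j\<in>UNIV. ghat_fps \<gamma> j ^ \<alpha> j) k"
    have "fps_nth E k = (\<Sum>\<alpha>\<in>?B N. c_coeff F \<alpha> * ?p \<alpha>)"
      by (simp add: E_def fps_sum_nth)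
    also have "\<dots> = (\<Sum>\<alpha>\<in>?B k. c_coeff F \<alpha> * ?p \<alpha>)"
    proof (rule sum.mono_neutral_right[OF finite_multi_indices])
      show "?B k \<subseteq> ?B N" using that by (auto intro: order_trans less_imp_le)
      show "\<forall>\<alpha>\<in>?B N - ?B k. c_coeff F \<alpha> * ?p \<alpha> = 0"
      proof
        fix \<alpha> assume "\<alpha> \<in> ?B N - ?B k"
        then obtain j where "k < \<alpha> j" by (auto simp: not_le)
        also have "\<alpha> j \<le> sum \<alpha> UNIV" by (rule member_le_sum) auto
        finally show "c_coeff F \<alpha> * ?p \<alpha> = 0"
          using fps_prod_power_nth_zero[of "ghat_fps \<gamma>", OF g0] by simp
      qed
    qed
    finally show ?thesis by (simp add: S_comp_def)
  qed
  then have "(\<Sum>k<N. fps_nth E k * t ^ k) = (\<Sum>k<N. fps_nth (S_comp F \<gamma>) k * t ^ k)" for t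
    by (intro sum.cong) auto
  with van show ?thesis by simp
qed

subsection \<open>Convergent solutions of formal equations along a curve\<close>

lemma fps_conv_radius_pos_of_bound:
  fixes f :: "complex fps"
  assumes "\<And>n. norm (fps_nth f n) \<le> C * q ^ n" "q > 0"
  shows "fps_conv_radius f > 0"
proof -
  define z where "z = complex_of_real (1 / (2 * q))"
  have z: "norm z = 1 / (2 * q)" using assms(2) by (simp add: z_def norm_divide)
  have "summable (\<lambda>n. fps_nth f n * z ^ n)"
  proof (rule summable_comparison_test)
    have "norm (fps_nth f n * z ^ n) \<le> C * (1 / 2) ^ n" for n
    proof -
      have "norm (fps_nth f n * z ^ n) \<le> (C * q ^ n) * (1 / (2 * q)) ^ n"
        unfolding norm_mult norm_power z using assms by (intro mult_right_mono) auto
      also have "\<dots> = C * (1 / 2) ^ n"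
        using assms(2) by (simp add: power_divide power_mult_distrib)
      finally show ?thesis .
    qed
    then show "\<exists>N. \<forall>n\<ge>N. norm (fps_nth f n * z ^ n) \<le> C * (1 / 2) ^ n" by blast
    show "summable (\<lambda>n. C * (1 / 2 :: real) ^ n)"
      by (intro summable_mult summable_geometric) auto
  qed
  then have "conv_radius (fps_nth f) \<ge> norm z" by (rule conv_radius_geI)
  moreover have "0 < norm z" using z assms(2) by simp
  ultimately show ?thesis
    unfolding fps_conv_radius_def by (metis ereal_less(2) less_le_trans)
qed

lemma fps_bound_of_conv_radius_pos:
  fixes f :: "complex fps"
  assumes "fps_conv_radius f > 0"
  shows "\<exists>C q. C > 0 \<and> q > 0 \<and> (\<forall>n. norm (fps_nth f n) \<le> C * q ^ n)"
proof -
  obtain r where r: "0 < r" "ereal r < fps_conv_radius f"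
    using ereal_dense2[OF assms] by (metis ereal_less(2) zero_ereal_def)
  have "summable (\<lambda>n. fps_nth f n * of_real r ^ n)"
    using r by (intro summable_fps) simp
  then have "Bseq (\<lambda>n. fps_nth f n * of_real r ^ n)"
    using summable_imp_Bseq by blast
  then obtain K where K: "K > 0" "\<And>n. norm (fps_nth f n * of_real r ^ n) \<le> K"
    unfolding Bseq_def by blast
  have "norm (fps_nth f n) \<le> K * (1 / r) ^ n" for n
    using K(2)[of n] r(1) by (simp add: norm_mult norm_power field_simps)
  then show ?thesis using K(1) r(1) by (intro exI[of _ K] exI[of _ "1 / r"]) auto
qed

lemma fps_uniform_bound:
  fixes f :: "'i \<Rightarrow> complex fps"
  assumes "finite I" "\<And>i. i \<in> I \<Longrightarrow> fps_conv_radius (f i) > 0"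
  shows "\<exists>C q. C > 0 \<and> q > 0 \<and> (\<forall>i\<in>I. \<forall>n. norm (fps_nth (f i) n) \<le> C * q ^ n)"
  using assms
proof (induction I rule: finite_induct)
  case empty
  show ?case by (intro exI[of _ 1]) auto
next
  case (insert i I)
  then obtain C q where C: "C > 0" "q > 0" "\<And>j n. j \<in> I \<Longrightarrow> norm (fps_nth (f j) n) \<le> C * q ^ n"
    by auto
  obtain D s where D: "D > 0" "s > 0" "\<And>n. norm (fps_nth (f i) n) \<le> D * s ^ n"
    using fps_bound_of_conv_radius_pos[of "f i"] insert.prems by auto
  have "norm (fps_nth (f j) n) \<le> max C D * max q s ^ n" if "j \<in> insert i I" for j n
  proof (cases "j = i")
    case True
    have "D * s ^ n \<le> max C D * max q s ^ n"
      using D C by (intro mult_mono power_mono) auto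
    then show ?thesis using D(3)[of n] True by simp
  next
    case False
    have "C * q ^ n \<le> max C D * max q s ^ n"
      using D C by (intro mult_mono power_mono) auto
    then show ?thesis using C(3)[of j n] False that by simp
  qed
  then show ?case using C D
    by (intro exI[of _ "max C D"] exI[of _ "max q s"]) auto
qed

text \<open>The rate R = (1 + 2 C) q is chosen so that the induction reproduces the bound: q R^n /
  (2 C) + q R^n = R^(n+1) / (2 C).\<close>

lemma geometric_convolution_bound:
  fixes C q :: real
  assumes "C > 0" "q > 0"
  shows "(\<Sum>k<n. ((1 + 2 * C) * q) ^ k * q ^ (n - k)) \<le> ((1 + 2 * C) * q) ^ n / (2 * C)"
proof (induction n)
  case (Suc n)
  let ?R = "(1 + 2 * C) * q"
  have "(\<Sum>k<Suc n. ?R ^ k * q ^ (Suc n - k)) = q * (\<Sum>k<n. ?R ^ k * q ^ (n - k)) + ?R ^ n * q"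
    unfolding sum_distrib_left by (simp add: Suc_diff_le mult_ac)
  also have "\<dots> \<le> q * (?R ^ n / (2 * C)) + ?R ^ n * q"
    using Suc assms by (intro add_right_mono mult_left_mono) auto
  also have "\<dots> = ?R ^ Suc n / (2 * C)"
    using assms(1) by (simp add: field_simps)
  finally show ?case .
qed (use assms in simp)

text \<open>\<open>A\<close> is a module over the polynomials in \<open>X\<^sup>m\<close>, and \<open>f\<close> lies in its \<open>X\<close>-adic closure. In each
  residue class modulo \<open>m\<close> choose an element of \<open>A\<close> of least order. Dividing \<open>f\<close> greedily by the
  multiples of these finitely many elements leaves no remainder, and since the elements converge
  the quotients grow at most geometrically.\<close>

lemma fps_module_division:
  fixes A :: "complex fps set" and f :: "complex fps"
  assumes m: "m > 0"
    and zero: "0 \<in> A" and add: "\<And>G H. G \<in> A \<Longrightarrow> H \<in> A \<Longrightarrow> G + H \<in> A"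
    and cmult: "\<And>c G. G \<in> A \<Longrightarrow> fps_const c * G \<in> A"
    and shift: "\<And>k G. G \<in> A \<Longrightarrow> fps_X ^ (m * k) * G \<in> A"
    and conv: "\<And>G. G \<in> A \<Longrightarrow> fps_conv_radius G > 0" "fps_conv_radius f > 0"
    and closure: "\<And>N. \<exists>G\<in>A. \<forall>n<N. fps_nth G n = fps_nth f n"
  shows "\<exists>b u. (\<forall>i<m. b i \<in> A \<and> fps_conv_radius (u i) > 0) \<and>
    f = (\<Sum>i<m. b i * (u i oo fps_X ^ m))"
proof -
  define L where "L = (\<lambda>n G. G \<in> A \<and> fps_nth G n = 1 \<and> (\<forall>k<n. fps_nth G k = 0))"
  define has where "has = (\<lambda>i. \<exists>n. n mod m = i \<and> (\<exists>G. L n G))"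
  define e where "e = (\<lambda>i. LEAST n. n mod m = i \<and> (\<exists>G. L n G))"
  define b where "b = (\<lambda>i. if has i then (SOME G. L (e i) G) else 0)"
  have e: "e i mod m = i \<and> (\<exists>G. L (e i) G)" if "has i" for i
    using that unfolding has_def e_def by (rule LeastI_ex)
  have b: "L (e i) (b i)" if "has i" for i
    using e[OF that] that by (auto simp: b_def intro: someI_ex)
  have e_le: "e i \<le> n" if "n mod m = i" "L n G" for i n G
    unfolding e_def by (rule Least_le) (use that in blast)
  have bA: "b i \<in> A" for i
    using b[of i] zero by (cases "has i") (auto simp: L_def b_def)
  \<comment> \<open>\<open>good n\<close> means that n is the order of some multiple, by a power of
    X^m, of the divisor chosen for its residue class. \<open>E n\<close> is that multiple, with
    leading coefficient 1, or else 0.\<close>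
  define good where "good = (\<lambda>n. has (n mod m) \<and> e (n mod m) \<le> n)"
  define E where "E = (\<lambda>n. if good n then fps_X ^ (n - e (n mod m)) * b (n mod m) else 0)"
  have E_nth: "fps_nth (E n) N = (if good n \<and> n \<le> N + e (n mod m) then fps_nth (b (n mod m)) (N + e (n mod m) - n) else 0)" for n N
    by (auto simp: E_def good_def fps_X_power_mult_nth)
  have dvd: "m dvd n - e (n mod m)" if "good n" for n
  proof -
    have "e (n mod m) mod m = n mod m" using that e unfolding good_def by blast
    then show ?thesis using that unfolding good_def by (metis mod_eq_dvd_iff_nat)
  qed
  have EA: "E n \<in> A" for n
    using dvd[of n] bA shift zero by (auto simp: E_def elim!: dvdE)
  have E_low: "fps_nth (E n) k = 0" if "k < n" for n k
    using that b[of "n mod m"] by (auto simp: E_nth good_def L_def)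
  have E_lead: "fps_nth (E n) n = (if good n then 1 else 0)" for n
    using b[of "n mod m"] by (auto simp: E_nth good_def L_def)
  define cl where "cl = {h. \<forall>N. \<exists>G\<in>A. \<forall>n<N. fps_nth G n = fps_nth h n}"
  \<comment> \<open>The order of a nonzero element of the closure is also the order of an element of
    A that agrees with it far enough, hence at least the minimum in its residue class. So every
    remainder can be reduced.\<close>
  have good: "good n" if h: "h \<in> cl" "\<forall>k<n. fps_nth h k = 0" "fps_nth h n \<noteq> 0" for h n
  proof -
    obtain G where G: "G \<in> A" "\<forall>k<Suc n. fps_nth G k = fps_nth h k"
      using h(1) unfolding cl_def by blast
    then have "L n (fps_const (1 / fps_nth h n) * G)"
      using h(2,3) cmult unfolding L_def by auto
    then show ?thesis
      unfolding good_def has_def using e_le by blast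
  qed
  have cl_step: "h - fps_const c * G \<in> cl" if h: "h \<in> cl" "G \<in> A" for h c G
    unfolding cl_def
  proof (intro CollectI allI)
    fix N
    obtain H where H: "H \<in> A" "\<forall>n<N. fps_nth H n = fps_nth h n"
      using h(1) unfolding cl_def by blast
    then show "\<exists>H\<in>A. \<forall>n<N. fps_nth H n = fps_nth (h - fps_const c * G) n"
      by (intro bexI[of _ "H + fps_const (- c) * G"]) (auto intro: add cmult h(2))
  qed
  \<comment> \<open>Greedy division: step n removes the coefficient of X^n from the remainder. If n
    is not good, that coefficient is 0 already.\<close>
  define R where "R = rec_nat f (\<lambda>n h. h - fps_const (fps_nth h n) * E n)"
  define a where "a = (\<lambda>n. fps_nth (R n) n)"
  have R_Suc: "R (Suc n) = R n - fps_const (a n) * E n" for n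
    by (simp add: R_def a_def)
  have R: "R n \<in> cl \<and> (\<forall>k<n. fps_nth (R n) k = 0)" for n
  proof (induction n)
    case 0
    then show ?case using closure by (simp add: R_def cl_def)
  next
    case (Suc n)
    have "fps_nth (R (Suc n)) k = 0" if "k < Suc n" for k
    proof (cases "k = n")
      case True
      have "a n * fps_nth (E n) n = a n"
        using good[of "R n" n] Suc by (auto simp: E_lead a_def)
      then show ?thesis using True by (simp add: R_Suc a_def)
    next
      case False
      then show ?thesis using that Suc E_low[of k n] by (simp add: R_Suc)
    qed
    then show ?case using Suc cl_step[OF _ EA] by (simp add: R_Suc)
  qed
  have f_R: "f = R n + (\<Sum>k<n. fps_const (a k) * E k)" for n
    by (induction n) (simp_all add: R_Suc, simp add: R_def)
  have f_nth: "fps_nth f N = (\<Sum>k\<le>N. a k * fps_nth (E k) N)" for N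
  proof -
    have "fps_nth f N = fps_nth (R (Suc N)) N + (\<Sum>k<Suc N. a k * fps_nth (E k) N)"
      by (subst f_R[of "Suc N"]) (simp add: fps_sum_nth)
    then show ?thesis using R[of "Suc N"] by (simp add: lessThan_Suc_atMost)
  qed
  have a_rec: "a n = fps_nth f n - (\<Sum>k<n. a k * fps_nth (E k) n)" for n
  proof -
    have "a n * fps_nth (E n) n = a n"
      using good[of "R n" n] R[of n] by (auto simp: E_lead a_def)
    then show ?thesis
      using f_nth[of n] by (simp flip: lessThan_Suc_atMost)
  qed
  \<comment> \<open>The index m stands for f itself, so that a single pair C, q serves f and all
    divisors shifted to order 0.\<close>
  have "\<exists>C q. C > 0 \<and> q > 0 \<and> (\<forall>i\<in>insert m {..<m}.
      \<forall>n. norm (fps_nth (if i = m then f else fps_shift (e i) (b i)) n) \<le> C * q ^ n)"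
    by (rule fps_uniform_bound) (use conv bA in auto)
  then obtain C q where C: "C > 0" "q > 0"
    "\<And>i n. i \<in> insert m {..<m} \<Longrightarrow> norm (fps_nth (if i = m then f else fps_shift (e i) (b i)) n) \<le> C * q ^ n"
    by blast
  have fC: "norm (fps_nth f n) \<le> C * q ^ n" for n
    using C(3)[of m n] by simp
  have EC: "norm (fps_nth (E k) n) \<le> C * q ^ (n - k)" if "k \<le> n" for k n
  proof -
    have "k mod m < m" using m by simp
    then have "norm (fps_nth (b (k mod m)) (n - k + e (k mod m))) \<le> C * q ^ (n - k)"
      using C(3)[of "k mod m" "n - k"] by simp
    moreover have "n + e (k mod m) - k = n - k + e (k mod m)" using that by simp
    ultimately show ?thesis using C(1,2) by (auto simp: E_nth)
  qed
  define S where "S = (1 + 2 * C) * q"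
  have "0 < C * q" using C(1,2) by simp
  then have S: "S > 0" "q \<le> S" using C(2) by (simp_all add: S_def distrib_right)
  \<comment> \<open>The recursion is a convolution. Of the constant 2 C, one half accounts for f and
    the other for the sum over earlier coefficients.\<close>
  have aS: "norm (a n) \<le> 2 * C * S ^ n" for n
  proof (induction n rule: less_induct)
    case (less n)
    have "norm (a n) \<le> norm (fps_nth f n) + norm (\<Sum>k<n. a k * fps_nth (E k) n)"
      by (subst a_rec) (rule norm_triangle_ineq4)
    also have "\<dots> \<le> C * q ^ n + (\<Sum>k<n. (2 * C * S ^ k) * (C * q ^ (n - k)))"
    proof (intro add_mono fC sum_norm_le)
      fix k assume "k \<in> {..<n}"
      then show "norm (a k * fps_nth (E k) n) \<le> (2 * C * S ^ k) * (C * q ^ (n - k))"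
        unfolding norm_mult using less EC[of k n] C S by (intro mult_mono) auto
    qed
    also have "(\<Sum>k<n. (2 * C * S ^ k) * (C * q ^ (n - k))) = 2 * C * C * (\<Sum>k<n. S ^ k * q ^ (n - k))"
      unfolding sum_distrib_left by (simp add: mult_ac)
    also have "\<dots> \<le> 2 * C * C * (S ^ n / (2 * C))"
      using geometric_convolution_bound[OF C(1,2), of n] C unfolding S_def by (intro mult_left_mono) auto
    also have "C * q ^ n + \<dots> \<le> C * S ^ n + C * S ^ n"
      using C S by (intro add_mono mult_left_mono power_mono) auto
    finally show ?case by simp
  qed
  \<comment> \<open>The quotients, collected by residue class: division step n = e i + k m used the
    divisor \<open>b i\<close> times X^(k m).\<close>
  define u where "u = (\<lambda>i. Abs_fps (\<lambda>k. if has i then a (e i + k * m) else 0))"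
  have u: "fps_conv_radius (u i) > 0" for i
  proof (rule fps_conv_radius_pos_of_bound)
    have "S ^ (e i + k * m) = S ^ e i * (S ^ m) ^ k" for k
      by (simp add: power_add mult.commute[of k] flip: power_mult)
    then show "norm (fps_nth (u i) k) \<le> (2 * C * S ^ e i) * (S ^ m) ^ k" for k
      using aS[of "e i + k * m"] C(1) S(1) by (simp add: u_def mult.assoc)
  qed (use S in simp)
  have "f = (\<Sum>i<m. b i * (u i oo fps_X ^ m))"
  proof (rule fps_ext)
    fix N
    have part: "fps_nth (b i * (u i oo fps_X ^ m)) N = (\<Sum>n\<in>{n. n \<le> N \<and> n mod m = i}. a n * fps_nth (E n) N)"
      if i: "i < m" for i
    proof (cases "has i")
      case False
      then show ?thesis by (auto simp: b_def E_nth good_def intro!: sum.neutral)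
    next
      case True
      then have ei: "e i mod m = i" "\<And>k. k < e i \<Longrightarrow> fps_nth (b i) k = 0"
        using e b unfolding L_def by blast+
      have "fps_nth ((u i oo fps_X ^ m) * b i) N = (\<Sum>l=0..N. fps_nth (u i oo fps_X ^ m) l * fps_nth (b i) (N - l))"
        by (rule fps_mult_nth)
      also have "\<dots> = (\<Sum>l\<in>{l. l \<le> N \<and> m dvd l}. a (e i + l) * fps_nth (b i) (N - l))"
        using m True by (intro sum.mono_neutral_cong_right) (auto simp: fps_nth_compose_X_power u_def)
      also have "\<dots> = (\<Sum>n\<in>(\<lambda>l. e i + l) ` {l. l \<le> N \<and> m dvd l}. a n * fps_nth (b i) (N + e i - n))"
        by (subst sum.reindex) (auto simp: inj_on_def)
      also have "\<dots> = (\<Sum>n\<in>{n. n \<le> N \<and> n mod m = i}. a n * fps_nth (E n) N)"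
      \<comment> \<open>The two index sets differ in terms that vanish: for n > N the coefficient of
        \<open>b i\<close> lies below its order \<open>e i\<close>, and for n < e i the index is not
        good, so \<open>E n\<close> is 0.\<close>
      proof (rule sum.mono_neutral_cong)
        fix n assume "n \<in> (\<lambda>l. e i + l) ` {l. l \<le> N \<and> m dvd l} - {n. n \<le> N \<and> n mod m = i}"
        then obtain l where l: "n = e i + l" "l \<le> N" "m dvd l" "\<not> (n \<le> N \<and> n mod m = i)" by blast
        then have "n mod m = i" using ei(1) by (metis add.right_neutral mod_add_right_eq dvd_imp_mod_0)
        then have "N < n" using l by simp
        then show "a n * fps_nth (b i) (N + e i - n) = 0" using l ei(2)[of "N + e i - n"] by simp
      next
        fix n assume n: "n \<in> {n. n \<le> N \<and> n mod m = i} - (\<lambda>l. e i + l) ` {l. l \<le> N \<and> m dvd l}"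
        have "\<not> good n"
        proof
          assume g: "good n"
          then have "m dvd n - e i" "e i \<le> n" using dvd[of n] n by (auto simp: good_def)
          then have "n \<in> (\<lambda>l. e i + l) ` {l. l \<le> N \<and> m dvd l}"
            using n by (intro image_eqI[of _ _ "n - e i"]) auto
          then show False using n by blast
        qed
        then show "a n * fps_nth (E n) N = 0" by (simp add: E_def)
      next
        fix n assume n: "n \<in> (\<lambda>l. e i + l) ` {l. l \<le> N \<and> m dvd l} \<inter> {n. n \<le> N \<and> n mod m = i}"
        then have "good n" using True by (auto simp: good_def)
        then show "a n * fps_nth (b i) (N + e i - n) = a n * fps_nth (E n) N"
          using n by (auto simp: E_nth)
      qed auto
      finally show ?thesis by (simp add: mult.commute)
    qed
    have "fps_nth (\<Sum>i<m. b i * (u i oo fps_X ^ m)) N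
        = (\<Sum>i<m. \<Sum>n\<in>{n. n \<le> N \<and> n mod m = i}. a n * fps_nth (E n) N)"
      by (simp add: fps_sum_nth part)
    also have "\<dots> = (\<Sum>i<m. \<Sum>n\<in>{n \<in> {..N}. n mod m = i}. a n * fps_nth (E n) N)"
      by (simp add: atMost_def Collect_conj_eq)
    also have "\<dots> = (\<Sum>n\<le>N. a n * fps_nth (E n) N)"
      by (rule sum.group) (use m in auto)
    finally show "fps_nth f N = fps_nth (\<Sum>i<m. b i * (u i oo fps_X ^ m)) N"
      by (simp add: f_nth)
  qed
  with bA u show ?thesis
    by (intro exI[of _ b] exI[of _ u]) simp
qed

section \<open>Recovering holomorphic functions from their real parts, and the normal form of a
  zero\<close>

lemma fps_nth_zero_of_vanishes:
  fixes D :: "complex \<Rightarrow> complex"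
  assumes "D has_fps_expansion K" "vanishes N D" "n < N"
  shows "fps_nth K n = 0"
proof -
  have "vanishes N (\<lambda>t. D t - (D t - (\<Sum>i<N. fps_nth K i * t ^ i)))"
    by (intro vanishes_diff assms(2) has_fps_expansion_vanishes assms(1))
  then have "vanishes N (\<lambda>t. \<Sum>i<N. fps_nth K i * t ^ i)" by simp
  then have "fps_nth K n * 1 ^ n = 0"
    using assms(3)
    by (intro homogeneous_sum_vanishes[where f = "\<lambda>i t. fps_nth K i * t ^ i" and m = N])
      (auto simp: scaleR_conv_of_real power_mult_distrib)
  then show ?thesis by simp
qed

text \<open>Homogeneity separates the degrees, and a t with t^k = cnj (a k) turns the real part into
  the squared modulus of \<open>a k\<close>. In degree 0 only the real part would be determined,
  hence 0 < k.\<close>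

lemma Re_power_sum_vanishes:
  assumes "vanishes N (\<lambda>t. Re (\<Sum>k<N. a k * t ^ k))" "0 < k" "k < N"
  shows "a k = 0"
proof -
  have "vanishes N (\<lambda>t. \<Sum>k<N. Re (a k * t ^ k))" using assms(1) by (simp only: Re_sum)
  then have 0: "Re (a k * t ^ k) = 0" for t
    using assms(3)
    by (intro homogeneous_sum_vanishes[where f = "\<lambda>i t. Re (a i * t ^ i)" and m = N])
      (auto simp: scaleR_conv_of_real power_mult_distrib algebra_simps simp flip: of_real_power)
  obtain t where "t ^ k = cnj (a k)"
    using assms(2) by (metis exists_complex_root less_irrefl)
  then have "Re (a k * cnj (a k)) = 0" using 0[of t] by simp
  then show ?thesis
    by (simp flip: complex_norm_square)
qed

text \<open>The value at 0 settles the constant term, which the real part leaves open up to an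
  imaginary number.\<close>

lemma vanishes_of_Re_vanishes:
  assumes A: "A analytic_on {0}" "A 0 = 0" and "vanishes N (\<lambda>t. Re (A t))"
  shows "vanishes N A"
proof -
  define a where "a = fps_nth (fps_expansion A 0)"
  have 1: "vanishes N (\<lambda>t. A t - (\<Sum>i<N. a i * t ^ i))"
    unfolding a_def by (rule analytic_vanishes[OF A(1)])
  have "vanishes N (\<lambda>t. Re (A t) - Re (A t - (\<Sum>i<N. a i * t ^ i)))"
    by (intro vanishes_diff assms(3) vanishes_linear[OF 1 bounded_linear_Re])
  then have "vanishes N (\<lambda>t. Re (\<Sum>i<N. a i * t ^ i))" by (simp del: Re_sum)
  then have "a i = 0" if "i < N" for i
    using Re_power_sum_vanishes[of N a i] that A(2)
    by (cases "i = 0") (auto simp: a_def fps_expansion_nth_01)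
  then show ?thesis using 1 by simp
qed

lemma analytic_vanishes_all:
  assumes "A analytic_on {0}" "\<And>N. vanishes N A"
  shows "\<forall>\<^sub>F t in nhds 0. A t = 0"
proof -
  have F: "A has_fps_expansion fps_expansion A 0"
    using assms(1) by (rule analytic_at_imp_has_fps_expansion_0)
  have "fps_expansion A 0 = 0"
    using fps_nth_zero_of_vanishes[OF F assms(2)] by (intro fps_ext) (metis fps_zero_nth lessI)
  then show ?thesis using F by (simp add: has_fps_expansion_0_iff)
qed

text \<open>A zero of order m has the form (t g(t))^m with g nonzero near 0, and \<sigma> is the
  local inverse of t g(t).\<close>

lemma reparametrize_to_power:
  assumes "q analytic_on {0}" "q 0 = 0" "\<not> (\<forall>\<^sub>F t in nhds 0. q t = (0::complex))"
  obtains m \<sigma> where "m > 0" "\<sigma> analytic_on {0}" "\<sigma> 0 = 0" "\<forall>\<^sub>F t in nhds 0. q (\<sigma> t) = t ^ m"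
proof -
  obtain \<epsilon> where \<epsilon>: "\<epsilon> > 0" "q holomorphic_on ball 0 \<epsilon>"
    using assms(1) by (auto simp: analytic_on_def)
  have "\<exists>n. (deriv ^^ n) q 0 \<noteq> 0"
  proof (rule ccontr)
    assume "\<not> ?thesis"
    then have "q t = 0" if "t \<in> ball 0 \<epsilon>" for t
      using holomorphic_fun_eq_0_on_ball[OF \<epsilon>(2) that] by blast
    then have "\<forall>\<^sub>F t in nhds 0. q t = 0"
      using eventually_nhds_in_open[of "ball 0 \<epsilon>" 0] \<epsilon>(1) by (auto elim: eventually_mono)
    then show False using assms(3) by blast
  qed
  define m where "m = (LEAST n. (deriv ^^ n) q 0 \<noteq> 0)"
  have m: "(deriv ^^ m) q 0 \<noteq> 0" "\<And>i. i < m \<Longrightarrow> (deriv ^^ i) q 0 = 0"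
    unfolding m_def using LeastI_ex[OF \<open>\<exists>n. (deriv ^^ n) q 0 \<noteq> 0\<close>]
      not_less_Least[of _ "\<lambda>n. (deriv ^^ n) q 0 \<noteq> 0"] by auto
  have "m > 0" using m(1) assms(2) by (cases m) auto
  obtain g r where g: "0 < r" "g holomorphic_on ball 0 r"
      "\<And>w. w \<in> ball 0 r \<Longrightarrow> q w - q 0 = ((w - 0) * g w) ^ m" "\<And>w. w \<in> ball 0 r \<Longrightarrow> g w \<noteq> 0"
    by (rule holomorphic_factor_order_of_zero_strong[OF \<epsilon>(2) open_ball _ \<open>m > 0\<close> m(1)])
      (use m(2) \<epsilon>(1) in auto)
  define \<psi> where "\<psi> = (\<lambda>w. w * g w)"
  have hol\<psi>: "\<psi> holomorphic_on ball 0 r"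
    unfolding \<psi>_def using g(2) by (intro holomorphic_intros)
  have "(g has_field_derivative deriv g 0) (at 0)"
    using g(1,2) by (intro holomorphic_derivI[of _ "ball 0 r"]) auto
  then have "(\<psi> has_field_derivative g 0) (at 0)"
    unfolding \<psi>_def by (auto intro!: derivative_eq_intros)
  then have d\<psi>: "deriv \<psi> 0 \<noteq> 0" using g(1,4) by (simp add: DERIV_imp_deriv)
  have r0: "0 \<in> ball (0::complex) r" using g(1) by simp
  obtain s where s: "s > 0" "ball (0::complex) s \<subseteq> ball 0 r" "open (\<psi> ` ball 0 s)" "inj_on \<psi> (ball 0 s)"
    by (rule has_complex_derivative_locally_invertible[OF hol\<psi> r0 open_ball d\<psi>])
  obtain \<sigma> where \<sigma>: "\<sigma> holomorphic_on \<psi> ` ball 0 s" "\<And>z. z \<in> ball 0 s \<Longrightarrow> \<sigma> (\<psi> z) = z"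
    using holomorphic_has_inverse[OF holomorphic_on_subset[OF hol\<psi> s(2)] open_ball s(4)] by metis
  have 0: "0 \<in> \<psi> ` ball 0 s" using s(1) by (intro image_eqI[of _ _ 0]) (auto simp: \<psi>_def)
  show thesis
  proof (rule that[OF \<open>m > 0\<close>, of \<sigma>])
    show "\<sigma> analytic_on {0}"
      using \<sigma>(1) s(3) 0 by (auto simp: analytic_at)
    show "\<sigma> 0 = 0" using \<sigma>(2)[of 0] s(1) by (simp add: \<psi>_def)
    show "\<forall>\<^sub>F t in nhds 0. q (\<sigma> t) = t ^ m"
      using eventually_nhds_in_open[OF s(3) 0]
    proof eventually_elim
      case (elim t)
      then obtain z where z: "z \<in> ball 0 s" "t = \<psi> z" by blast
      then show ?case
        using g(3)[of z] s(2) assms(2) \<sigma>(2)[of z] by (auto simp: \<psi>_def)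
    qed
  qed
qed

definition cdiff :: "(complex^'n::finite \<Rightarrow> complex) \<Rightarrow> complex^'n \<Rightarrow> bool" where
  "cdiff g x \<longleftrightarrow> (\<exists>L. (g has_derivative L) (at x) \<and> (\<forall>c v. L (c *s v) = c * L v))"

lemma cdiff_const: "cdiff (\<lambda>_. a) x"
  unfolding cdiff_def by (intro exI[of _ "\<lambda>_. 0"]) auto

lemma cdiff_nth: "cdiff (\<lambda>z. z $ j) x"
  unfolding cdiff_def
  by (intro exI[of _ "\<lambda>z. z $ j"] conjI bounded_linear_imp_has_derivative bounded_linear_vec_nth) auto

lemma cdiff_add: "cdiff f x \<Longrightarrow> cdiff g x \<Longrightarrow> cdiff (\<lambda>z. f z + g z) x"
proof -
  assume "cdiff f x" "cdiff g x"
  then obtain L L' where "(f has_derivative L) (at x)" "\<forall>c v. L (c *s v) = c * L v"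
      "(g has_derivative L') (at x)" "\<forall>c v. L' (c *s v) = c * L' v"
    unfolding cdiff_def by blast
  then show ?thesis
    unfolding cdiff_def by (intro exI[of _ "\<lambda>v. L v + L' v"]) (auto intro: has_derivative_add simp: distrib_left)
qed

lemma cdiff_mult: "cdiff f x \<Longrightarrow> cdiff g x \<Longrightarrow> cdiff (\<lambda>z. f z * g z) x"
proof -
  assume "cdiff f x" "cdiff g x"
  then obtain L L' where "(f has_derivative L) (at x)" "\<forall>c v. L (c *s v) = c * L v"
      "(g has_derivative L') (at x)" "\<forall>c v. L' (c *s v) = c * L' v"
    unfolding cdiff_def by blast
  then show ?thesis
    unfolding cdiff_def
    by (intro exI[of _ "\<lambda>v. f x * L' v + L v * g x"]) (auto simp: algebra_simps dest: has_derivative_mult)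
qed

lemma cdiff_sum: "finite I \<Longrightarrow> (\<And>i. i \<in> I \<Longrightarrow> cdiff (f i) x) \<Longrightarrow> cdiff (\<lambda>z. \<Sum>i\<in>I. f i z) x"
  by (induction I rule: finite_induct) (auto intro: cdiff_add cdiff_const)

lemma cdiff_prod: "finite I \<Longrightarrow> (\<And>i. i \<in> I \<Longrightarrow> cdiff (f i) x) \<Longrightarrow> cdiff (\<lambda>z. \<Prod>i\<in>I. f i z) x"
  by (induction I rule: finite_induct) (auto intro: cdiff_mult cdiff_const)

lemma cdiff_power: "cdiff f x \<Longrightarrow> cdiff (\<lambda>z. f z ^ k) x"
  using cdiff_prod[of "{..<k}" "\<lambda>_. f" x] by simp

lemma cdiff_compose:
  assumes "cdiff f x" "(h has_field_derivative d) (at (f x))"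
  shows "cdiff (\<lambda>z. h (f z)) x"
proof -
  obtain L where L: "(f has_derivative L) (at x)" "\<forall>c v. L (c *s v) = c * L v"
    using assms(1) unfolding cdiff_def by blast
  have "((\<lambda>z. h (f z)) has_derivative (\<lambda>v. d * L v)) (at x)"
    using has_derivative_compose[OF L(1)] assms(2) unfolding has_field_derivative_def by blast
  then show ?thesis
    unfolding cdiff_def using L(2) by (intro exI[of _ "\<lambda>v. d * L v"]) auto
qed

lemma cdiff_hol_poly: "hol_poly d Q \<Longrightarrow> cdiff Q x"
  unfolding hol_poly_def zmono_def
  by (auto intro!: cdiff_sum cdiff_mult cdiff_const cdiff_prod cdiff_power cdiff_nth)

text \<open>Along \<gamma> the function h is only approximated by polynomials. Division expresses it
  through finitely many of them, with coefficients that are convergent series in t^m; as z_j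
  restricts to t^m, these coefficients extend to holomorphic functions of z_j, which gives
  g.\<close>

lemma convergent_solution:
  fixes \<gamma> :: "complex \<Rightarrow> complex^'n::finite"
  assumes \<gamma>: "hol_germ \<gamma>" and m: "m > 0" and pow: "\<forall>\<^sub>F t in nhds 0. \<gamma> t $ j = t ^ m"
    and h: "h analytic_on {0}"
    and approx: "\<And>N. \<exists>Q. hol_poly 2 Q \<and> vanishes N (\<lambda>t. Q (\<gamma> t) - h t)"
  obtains V g where "open V" "0 \<in> V" "smooth_on V g" "\<And>x. x \<in> V \<Longrightarrow> cdiff g x" "vanishes 2 g"
    "\<forall>\<^sub>F t in nhds 0. g (\<gamma> t) = h t"
proof -
  define A where "A = {G. \<exists>P. hol_poly 2 P \<and> (\<lambda>t. P (\<gamma> t)) has_fps_expansion G}"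
  define f where "f = fps_expansion h 0"
  have hf: "h has_fps_expansion f"
    unfolding f_def using h by (rule analytic_at_imp_has_fps_expansion_0)
  have "\<exists>b u. (\<forall>i<m. b i \<in> A \<and> fps_conv_radius (u i) > 0) \<and> f = (\<Sum>i<m. b i * (u i oo fps_X ^ m))"
  proof (rule fps_module_division[OF m])
    show "0 \<in> A"
      unfolding A_def using hol_poly_zero has_fps_expansion_0 by blast
    show "G + H \<in> A" if GH: "G \<in> A" "H \<in> A" for G H
    proof -
      obtain P Q where "hol_poly 2 P" "(\<lambda>t. P (\<gamma> t)) has_fps_expansion G"
        "hol_poly 2 Q" "(\<lambda>t. Q (\<gamma> t)) has_fps_expansion H"
        using GH unfolding A_def by blast
      then show ?thesis
        unfolding A_def using hol_poly_add[of 2 P Q] has_fps_expansion_add[of "\<lambda>t. P (\<gamma> t)" G "\<lambda>t. Q (\<gamma> t)" H]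
        by (intro CollectI exI[of _ "\<lambda>z. P z + Q z"]) simp
    qed
    show "fps_const c * G \<in> A" if G: "G \<in> A" for c G
    proof -
      obtain P where "hol_poly 2 P" "(\<lambda>t. P (\<gamma> t)) has_fps_expansion G"
        using G unfolding A_def by blast
      then show ?thesis
        unfolding A_def using hol_poly_cmult[of 2 P c] has_fps_expansion_cmult_left[of "\<lambda>t. P (\<gamma> t)" G c]
        by (intro CollectI exI[of _ "\<lambda>z. c * P z"]) simp
    qed
    \<comment> \<open>The shift is realized by multiplying the polynomial with
      \<open>z $ j ^ k\<close>, which is t^(m k) along \<gamma>.\<close>
    show "fps_X ^ (m * k) * G \<in> A" if G: "G \<in> A" for k G
    proof -
      obtain P where P: "hol_poly 2 P" "(\<lambda>t. P (\<gamma> t)) has_fps_expansion G"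
        using G unfolding A_def by blast
      have "(\<lambda>t. t ^ (m * k) * P (\<gamma> t)) has_fps_expansion fps_X ^ (m * k) * G"
        by (intro has_fps_expansion_mult has_fps_expansion_fps_X_power P(2))
      moreover have "\<forall>\<^sub>F t in nhds 0. t ^ (m * k) * P (\<gamma> t) = \<gamma> t $ j ^ k * P (\<gamma> t)"
        using pow by eventually_elim (simp add: power_mult)
      ultimately have "(\<lambda>t. \<gamma> t $ j ^ k * P (\<gamma> t)) has_fps_expansion fps_X ^ (m * k) * G"
        using has_fps_expansion_cong by fast
      then show ?thesis
        unfolding A_def using hol_poly_var_power[OF P(1), of j k]
        by (intro CollectI exI[of _ "\<lambda>z. z $ j ^ k * P z"]) simp
    qed
    show "fps_conv_radius G > 0" if G: "G \<in> A" for G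
      using G by (auto simp: A_def has_fps_expansion_def)
    show "fps_conv_radius f > 0" using hf by (simp add: has_fps_expansion_def)
    show "\<exists>G\<in>A. \<forall>n<N. fps_nth G n = fps_nth f n" for N
    proof -
      obtain Q where Q: "hol_poly 2 Q" "vanishes N (\<lambda>t. Q (\<gamma> t) - h t)" using approx by blast
      define G where "G = fps_expansion (\<lambda>t. Q (\<gamma> t)) 0"
      have G: "(\<lambda>t. Q (\<gamma> t)) has_fps_expansion G"
        unfolding G_def
        by (intro analytic_at_imp_has_fps_expansion_0 hol_poly_curve_analytic[OF Q(1)] \<gamma>)
      have "fps_nth (G - f) n = 0" if "n < N" for n
        by (rule fps_nth_zero_of_vanishes[OF has_fps_expansion_diff[OF G hf] Q(2) that])
      then show ?thesis using G Q(1) by (intro bexI[of _ G]) (auto simp: A_def)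
    qed
  qed
  then obtain b u where bu: "\<And>i. i < m \<Longrightarrow> b i \<in> A" "\<And>i. i < m \<Longrightarrow> fps_conv_radius (u i) > 0"
    "f = (\<Sum>i<m. b i * (u i oo fps_X ^ m))" by blast
  from bu(1) obtain P where P: "\<And>i. i < m \<Longrightarrow> hol_poly 2 (P i)"
    "\<And>i. i < m \<Longrightarrow> (\<lambda>t. P i (\<gamma> t)) has_fps_expansion b i"
    unfolding A_def by (simp add: Ball_def) metis
  define D where "D = (\<Inter>i\<in>{..<m}. eball (0::complex) (fps_conv_radius (u i)))"
  have D: "open D" "0 \<in> D"
    unfolding D_def using bu(2) by (auto intro!: open_INT simp: zero_ereal_def)
  define V where "V = (\<lambda>z :: complex^'n. z $ j) -` D"
  have V: "open V" "0 \<in> V"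
    unfolding V_def using D by (auto intro!: open_vimage continuous_intros)
  define g where "g = (\<lambda>z. \<Sum>i<m. P i z * eval_fps (u i) (z $ j))"
  have hol: "eval_fps (u i) holomorphic_on D" if "i < m" for i
    using that by (intro holomorphic_on_eval_fps) (auto simp: D_def)
  have sm_nth: "smooth_on V (\<lambda>z. z $ j)"
    by (intro smooth_on_bounded_linear V bounded_linear_vec_nth)
  have sm_P: "smooth_on V (P i)" if "i < m" for i
    using smooth_on_subset[OF hol_poly_smooth[OF P(1)[OF that]] V(1)] by simp
  have sm_u: "smooth_on V (\<lambda>z. eval_fps (u i) (z $ j))" if "i < m" for i
    by (rule smooth_on_compose[OF sm_nth smooth_on_holomorphic[OF hol[OF that] D(1)]]) (auto simp: V_def)
  show thesis
  proof (rule that[of V g])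
    show "smooth_on V g"
      unfolding g_def by (intro smooth_on_sum smooth_on_mult sm_P sm_u V) auto
    show "cdiff g x" if "x \<in> V" for x
      unfolding g_def
    proof (intro cdiff_sum cdiff_mult)
      fix i assume i: "i \<in> {..<m}"
      then show "cdiff (P i) x" using cdiff_hol_poly[OF P(1)] by simp
      have "(eval_fps (u i) has_field_derivative deriv (eval_fps (u i)) (x $ j)) (at (x $ j))"
        using i that D(1) hol by (intro holomorphic_derivI[of _ D]) (auto simp: V_def)
      then show "cdiff (\<lambda>z. eval_fps (u i) (z $ j)) x"
        by (rule cdiff_compose[OF cdiff_nth])
    qed simp
    have "vanishes (2 + 0) (\<lambda>z. P i z * eval_fps (u i) (z $ j))" if "i < m" for i
      using smooth_vanishes_0[OF sm_u[OF that] V(2)] hol_poly_vanishes[OF P(1)[OF that]]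
      by (intro vanishes_mult)
    then show "vanishes 2 g"
      unfolding g_def by (intro vanishes_sum) auto
    have "(\<lambda>t. \<Sum>i<m. P i (\<gamma> t) * (eval_fps (u i) \<circ> (\<lambda>t. t ^ m)) t) has_fps_expansion f"
      unfolding bu(3) using P(2) bu(2) m
      by (intro has_fps_expansion_sum has_fps_expansion_mult has_fps_expansion_compose
          eval_fps_has_fps_expansion has_fps_expansion_fps_X_power) auto
    then have "\<forall>\<^sub>F t in nhds 0. eval_fps f t = (\<Sum>i<m. P i (\<gamma> t) * eval_fps (u i) (t ^ m))"
      by (simp add: has_fps_expansion_def)
    moreover have "\<forall>\<^sub>F t in nhds 0. eval_fps f t = h t"
      using hf by (simp add: has_fps_expansion_def)
    ultimately show "\<forall>\<^sub>F t in nhds 0. g (\<gamma> t) = h t"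
      using pow by eventually_elim (simp add: g_def)
  qed (fact V)+
qed

section \<open>Holomorphic maps and changes of good coordinate\<close>

lemma holo_map_on_cong:
  assumes "holo_map_on U f" "\<And>x. x \<in> U \<Longrightarrow> f x = g x"
  shows "holo_map_on U g"
  unfolding holo_map_on_def
proof (intro conjI ballI)
  fix x assume x: "x \<in> U"
  then obtain L where L: "(f has_derivative L) (at x)" "\<forall>c v. L (c *s v) = c *s L v"
    using assms(1) unfolding holo_map_on_def by auto
  then have "(g has_derivative L) (at x)"
    using has_derivative_transform_within_open[OF L(1) holo_map_on_open[OF assms(1)] x] assms(2) by blast
  then show "\<exists>L. (g has_derivative L) (at x) \<and> (\<forall>c v. L (c *s v) = c *s L v)"
    using L(2) by auto
qed (use assms holo_map_on_open in blast)

lemma holo_map_on_compose: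
  assumes f: "holo_map_on U f" and g: "holo_map_on W g" and "f ` U \<subseteq> W"
  shows "holo_map_on U (\<lambda>x. g (f x))"
  unfolding holo_map_on_def
proof (intro conjI ballI)
  fix x assume x: "x \<in> U"
  then have fx: "f x \<in> W" using assms(3) by blast
  from has_derivative_compose[OF holo_map_on_frechet(1)[OF f x] holo_map_on_frechet(1)[OF g fx]]
  show "\<exists>L. ((\<lambda>x. g (f x)) has_derivative L) (at x) \<and> (\<forall>c v. L (c *s v) = c *s L v)"
    using holo_map_on_frechet(2)[OF f x] holo_map_on_frechet(2)[OF g fx]
    by (intro exI[of _ "\<lambda>v. frechet_derivative g (at (f x)) (frechet_derivative f (at x) v)"]) simp
qed (use f holo_map_on_open in blast)

lemma holo_map_on_subset: "holo_map_on U f \<Longrightarrow> open V \<Longrightarrow> V \<subseteq> U \<Longrightarrow> holo_map_on V f"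
  unfolding holo_map_on_def by auto

definition shear :: "(complex^'n::finite \<Rightarrow> complex) \<Rightarrow> complex^('n option) \<Rightarrow> complex^('n option)" where
  "shear g y = y + axis None (g (zpart y))"

lemma zpart_shear [simp]: "zpart (shear g y) = zpart y"
  by (simp add: shear_def zpart_def axis_def)

lemma wpart_shear: "wpart (shear g y) = wpart y + g (zpart y)"
  by (simp add: shear_def wpart_def axis_def)

lemma shear_shear: "shear (\<lambda>z. - g z) (shear g y) = y" "shear g (shear (\<lambda>z. - g z) y) = y"
proof -
  have "axis None a + axis None (- a) = (0 :: complex^('a option))"
    "axis None (- a) + axis None a = (0 :: complex^('a option))" for a
    by (simp_all add: axis_def vec_eq_iff)
  then show "shear (\<lambda>z. - g z) (shear g y) = y" "shear g (shear (\<lambda>z. - g z) y) = y"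
    by (simp_all add: shear_def[of _ "shear _ _"]) (simp_all add: shear_def add.assoc)
qed

lemma open_zpart_vimage: "open V \<Longrightarrow> open (zpart -` V)"
  by (intro open_vimage linear_continuous_on zpart_bounded_linear)

lemma shear_holo_map_on:
  assumes "open V" "\<And>x. x \<in> V \<Longrightarrow> cdiff g x"
  shows "holo_map_on (zpart -` V) (shear g)"
  unfolding holo_map_on_def
proof (intro conjI ballI open_zpart_vimage assms(1))
  fix y assume "y \<in> zpart -` V"
  then obtain L where L: "(g has_derivative L) (at (zpart y))" "\<forall>c v. L (c *s v) = c * L v"
    using assms(2) unfolding cdiff_def by blast
  have "((\<lambda>y. g (zpart y)) has_derivative (\<lambda>v. L (zpart v))) (at y)"
    by (rule has_derivative_compose[OF bounded_linear_imp_has_derivative[OF zpart_bounded_linear] L(1)])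
  then have "(shear g has_derivative (\<lambda>v. v + axis None (L (zpart v)))) (at y)"
    unfolding shear_def[abs_def]
    by (intro has_derivative_add has_derivative_ident bounded_linear.has_derivative[OF bounded_linear_axis])
  moreover have zs: "zpart (c *s v) = c *s zpart v" for c v
    by (simp add: zpart_def vec_eq_iff)
  have "c *s v + axis None (L (zpart (c *s v))) = c *s (v + axis None (L (zpart v)))" for c v
    unfolding zs using L(2) by (simp add: vec_eq_iff axis_def distrib_left)
  ultimately show "\<exists>L. (shear g has_derivative L) (at y) \<and> (\<forall>c v. L (c *s v) = c *s L v)"
    by blast
qed

text \<open>This is the coordinate change \<open>w' = w + g(z)\<close>.\<close>

lemma good_coord_shear:
  assumes gc: "good_coord M p U \<Phi> W F" and V: "open V" "0 \<in> V" "V \<subseteq> W"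
    and g: "smooth_on V g" "\<And>x. x \<in> V \<Longrightarrow> cdiff g x" "vanishes 2 g" and F2: "vanishes 2 F"
  shows "\<exists>U' \<Phi>'. good_coord M p U' \<Phi>' V (\<lambda>z. F z - 2 * Re (g z))"
proof -
  note G = good_coordD[OF gc] and I = good_coord_inverse[OF gc]
  let ?g' = "\<lambda>z. - g z" and ?F' = "\<lambda>z. F z - 2 * Re (g z)"
  define U' where "U' = U \<inter> \<Phi> -` (zpart -` V)"
  define \<Phi>' where "\<Phi>' = (\<lambda>x. shear g (\<Phi> x))"
  have inj: "inj_on \<Phi> U" using gc unfolding good_coord_def by blast
  have U': "open U'" "U' \<subseteq> U"
    unfolding U'_def using continuous_open_preimage[OF holo_map_on_continuous[OF G(3)] G(1)] open_zpart_vimage[OF V(1)]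
    by auto
  have cd': "cdiff ?g' x" if "x \<in> V" for x
    using cdiff_mult[OF cdiff_const[of "-1"] g(2)[OF that]] by simp
  note sg = shear_holo_map_on[OF V(1) g(2)] and sg' = shear_holo_map_on[OF V(1) cd']
  \<comment> \<open>As a preimage under the inverse shear, the image is open by continuity.\<close>
  have img: "\<Phi>' ` U' = (zpart -` V) \<inter> shear ?g' -` (\<Phi> ` U)"
  proof (intro equalityI subsetI)
    fix y assume "y \<in> \<Phi>' ` U'"
    then show "y \<in> (zpart -` V) \<inter> shear ?g' -` (\<Phi> ` U)"
      by (auto simp: \<Phi>'_def U'_def shear_shear)
  next
    fix y assume y: "y \<in> (zpart -` V) \<inter> shear ?g' -` (\<Phi> ` U)"
    then obtain x where x: "x \<in> U" "shear ?g' y = \<Phi> x" by blast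
    then have "\<Phi>' x = y" by (metis \<Phi>'_def shear_shear(2))
    moreover have "zpart (\<Phi> x) = zpart y" using x(2) zpart_shear by metis
    ultimately show "y \<in> \<Phi>' ` U'" using x y by (intro image_eqI[of _ _ x]) (auto simp: U'_def)
  qed
  have img_open: "open (\<Phi>' ` U')"
    unfolding img by (intro continuous_open_preimage holo_map_on_continuous[OF sg'] open_zpart_vimage V I(4))
  have inj': "inj_on \<Phi>' U'"
  proof (rule inj_onI)
    fix x y assume xy: "x \<in> U'" "y \<in> U'" "\<Phi>' x = \<Phi>' y"
    then have "\<Phi> x = \<Phi> y" unfolding \<Phi>'_def by (metis shear_shear(1))
    then show "x = y" using xy U'(2) inj by (meson inj_onD subsetD)
  qed
  have inv: "inv_into U \<Phi> (shear ?g' y) = inv_into U' \<Phi>' y" if y: "y \<in> \<Phi>' ` U'" for y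
  proof -
    obtain x where x: "x \<in> U'" "y = \<Phi>' x" using y by blast
    then have "shear ?g' y = \<Phi> x" by (simp add: \<Phi>'_def shear_shear)
    then show ?thesis using x inj inj' U'(2) by (simp add: inv_into_f_f subsetD)
  qed
  have F': "smooth_on V ?F'"
    using smooth_on_subset[OF G(6) V(1,3)]
    by (intro smooth_on_diff smooth_on_linear_compose[OF g(1), where L = "\<lambda>x. 2 * Re x"]
        bounded_linear_const_mult bounded_linear_Re)
  have F'2: "vanishes (Suc 1) ?F'"
    using vanishes_diff[OF F2 vanishes_linear[OF g(3), of "\<lambda>x. 2 * Re x"]]
    by (simp add: bounded_linear_const_mult bounded_linear_Re numeral_2_eq_2)
  \<comment> \<open>Order two of the new function, passed to its first derivatives, is the gradient
    condition in \<open>good_coord\<close>.\<close>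
  have "frechet_derivative ?F' (at 0) v = 0" for v
  proof -
    have "vanishes (Suc 0) (\<lambda>x. frechet_derivative ?F' (at x) v)"
      using vanishes_derivative[OF F' V(2) F'2] by simp
    then show ?thesis by (rule vanishes_zero_at)
  qed
  then have "frechet_derivative ?F' (at 0) = (\<lambda>v. 0)" by blast
  then have F'd: "(?F' has_derivative (\<lambda>v. 0)) (at 0)"
    using smooth_on_has_derivative[OF F' V(2)] by simp
  have rho: "2 * Re (wpart (\<Phi>' x)) + ?F' (zpart (\<Phi>' x)) = rho F (\<Phi> x)" for x
    by (simp add: \<Phi>'_def wpart_shear rho_def)
  have g0: "g 0 = 0" using vanishes_zero_at[of 1 g] g(3) by (simp add: numeral_2_eq_2)
  have "good_coord M p U' \<Phi>' V ?F'"
    unfolding good_coord_def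
  proof (intro conjI)
    show "holo_map_on U' \<Phi>'"
      unfolding \<Phi>'_def by (intro holo_map_on_compose[OF holo_map_on_subset[OF G(3) U'] sg]) (auto simp: U'_def)
    show "holo_map_on (\<Phi>' ` U') (inv_into U' \<Phi>')"
    proof (rule holo_map_on_cong[OF _ inv])
      show "holo_map_on (\<Phi>' ` U') (\<lambda>y. inv_into U \<Phi> (shear ?g' y))"
        by (rule holo_map_on_compose[OF holo_map_on_subset[OF sg' img_open] I(1)]) (auto simp: img)
    qed
    show "p \<in> U'" using G(2,4) V(2) by (simp add: U'_def)
    show "\<Phi>' p = 0" using g0 by (simp add: \<Phi>'_def G(4)) (simp add: shear_def axis_def vec_eq_iff)
    show "M \<inter> U' = {x \<in> U'. 2 * Re (wpart (\<Phi>' x)) + ?F' (zpart (\<Phi>' x)) = 0}"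
      unfolding rho using G(10) U'(2) by blast
    show "\<forall>x\<in>U'. zpart (\<Phi>' x) \<in> V" by (simp add: U'_def \<Phi>'_def)
    show "?F' 0 = 0" using G(7) g0 by simp
  qed (fact U' inj' img_open V F' F'd)+
  then show ?thesis by blast
qed

subsection \<open>The three conditions\<close>

lemma vanishes_imp_bigo:
  fixes f :: "complex \<Rightarrow> real"
  assumes "vanishes N f" shows "f \<in> O[at 0](\<lambda>t. cmod t ^ N)"
proof -
  obtain C where "\<forall>\<^sub>F z in nhds 0. norm (f z) \<le> C * norm z ^ N"
    using assms unfolding vanishes_def by blast
  then have "\<forall>\<^sub>F z in at 0. norm (f z) \<le> C * norm (cmod z ^ N)"
    unfolding eventually_at_filter by (auto elim: eventually_mono)
  then show ?thesis by (rule bigoI)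
qed

lemma bigo_imp_vanishes:
  fixes f :: "complex \<Rightarrow> real"
  assumes "f 0 = 0" "f \<in> O[at 0](\<lambda>t. cmod t ^ N)"
  shows "vanishes N f"
proof -
  obtain C where C: "C > 0" "\<forall>\<^sub>F z in at 0. norm (f z) \<le> C * norm (cmod z ^ N)"
    using assms(2) by (rule landau_o.bigE)
  have "\<forall>\<^sub>F z in nhds 0. norm (f z) \<le> C * norm z ^ N"
    using C(2) unfolding eventually_at_filter
    by (rule eventually_mono) (use assms(1) C(1) in auto)
  then show ?thesis by (rule vanishesI)
qed

lemma good_coord_vanishes_2:
  assumes "good_coord M p U \<Phi> W F" shows "vanishes 2 F"
proof -
  note g = good_coordD[OF assms]
  show ?thesis
  proof (rule vanishes_of_dderiv_zero[OF g(6,5)])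
    fix vs :: "(complex^'a) list" assume "length vs < 2"
    then have "vs = [] \<or> (\<exists>v. vs = [v])" by (cases vs; cases "tl vs") auto
    then show "dderiv vs F 0 = 0"
      using g(7) frechet_derivative_eqI[OF g(8)] by auto
  qed
qed

lemma good_coord_pure:
  assumes "bg_type_infinite M p" "p \<in> M" and gc: "good_coord M p U \<Phi> W F" and "k \<ge> 2"
  shows "\<exists>Q. hol_poly 2 Q \<and> vanishes k (\<lambda>z. F z - 2 * Re (Q z))"
  using good_coordD[OF gc] good_coord_vanishes_2[OF gc] tangent_discs[OF assms(1) gc assms(2) _ good_coord_vanishes_2[OF gc]]
  by (intro taylor_pure[where W = W] assms(4)) auto

lemma Gamma_hatD:
  assumes "\<gamma> \<in> Gamma_hat"
  shows "hol_germ \<gamma>" "\<gamma> 0 = 0" "\<not> (\<forall>\<^sub>F t in nhds 0. \<gamma> t = 0)"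
  using assms by (auto simp: Gamma_hat_def hol_germ_iff)

text \<open>The curve is holomorphic, so F \<circ> \<gamma> is smooth near 0, and vanishing of
  derivatives and order of vanishing translate into each other in both directions.\<close>

lemma flat_at0_iff:
  assumes F: "smooth_on W F" "0 \<in> W" and \<gamma>: "hol_germ \<gamma>" "\<gamma> 0 = 0"
  shows "flat_at0 (\<lambda>t. F (\<gamma> t)) \<longleftrightarrow> (\<forall>N. vanishes N (\<lambda>t. F (\<gamma> t)))"
proof -
  obtain e where e: "e > 0" "\<gamma> ` ball 0 e \<subseteq> W" "\<And>j. (\<lambda>t. \<gamma> t $ j) holomorphic_on ball 0 e"
    using hol_germ_ball[OF \<gamma>(1) smooth_on_open[OF F(1)]] F(2) \<gamma>(2) by auto
  have s: "smooth_on (ball 0 e) (\<lambda>t. F (\<gamma> t))"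
    by (rule smooth_on_compose[OF smooth_on_vec[OF open_ball smooth_on_holomorphic[OF e(3) open_ball]] F(1) e(2)])
  have 0: "0 \<in> ball (0::complex) e" using e(1) by simp
  show ?thesis
    unfolding flat_at0_def
    using vanishes_of_dderiv_zero[OF s 0] dderiv_zero_of_vanishes[OF s 0] by blast
qed

text \<open>Flatness annihilates every coefficient of S \<circ> \<gamma> beyond the constant one, so
  the series converges because it terminates.\<close>

lemma flat_imp_S_comp_converges:
  assumes bg: "bg_type_infinite M p" "p \<in> M" and gc: "good_coord M p U \<Phi> W F"
    and \<gamma>: "\<gamma> \<in> Gamma_hat" and flat: "flat_at0 (\<lambda>t. F (\<gamma> t))"
  shows "fps_converges_near0 (S_comp F \<gamma>)"
proof -
  note g = good_coordD[OF gc]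
  have zero: "fps_nth (S_comp F \<gamma>) k = 0" if "k > 0" for k
  proof -
    \<comment> \<open>Large enough for the partial sum to include degree k, and at least 2 as
      \<open>good_coord_pure\<close> requires.\<close>
    let ?N = "Suc (Suc k)"
    obtain Q where Q: "hol_poly 2 Q" "vanishes ?N (\<lambda>z. F z - 2 * Re (Q z))"
      using good_coord_pure[OF bg gc, of ?N] by auto
    have "vanishes ?N (\<lambda>t. F (\<gamma> t))"
      using flat flat_at0_iff[OF g(6,5) Gamma_hatD(1,2)[OF \<gamma>]] by blast
    from vanishes_diff[OF this F_curve_expansion[OF g(6,5) Q Gamma_hatD(1,2)[OF \<gamma>]]]
    have "vanishes ?N (\<lambda>t. 2 * Re (\<Sum>k<?N. fps_nth (S_comp F \<gamma>) k * t ^ k))"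
      by (simp only: diff_diff_eq2 add_diff_cancel_left' add_diff_cancel_left)
    from vanishes_linear[OF this, of "\<lambda>x. x / 2"]
    have "vanishes ?N (\<lambda>t. Re (\<Sum>k<?N. fps_nth (S_comp F \<gamma>) k * t ^ k))"
      by (simp add: bounded_linear_divide del: Re_sum sum.lessThan_Suc)
    then show ?thesis
      by (rule Re_power_sum_vanishes) (use that in auto)
  qed
  have "summable (\<lambda>k. fps_nth (S_comp F \<gamma>) k * t ^ k)" for t
    by (rule summable_finite[of "{0}"]) (use zero in auto)
  then show ?thesis
    unfolding fps_converges_near0_def by (intro exI[of _ 1]) auto
qed

definition zw :: "complex^'n::finite \<Rightarrow> complex \<Rightarrow> complex^('n option)" where
  "zw z w = (\<chi> k. case k of None \<Rightarrow> w | Some j \<Rightarrow> z $ j)"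

lemma zw_simps [simp]: "zpart (zw z w) = z" "wpart (zw z w) = w" "zw 0 0 = 0"
  by (simp_all add: zw_def zpart_def wpart_def vec_eq_iff split: option.split)

lemma hol_germ_zw:
  assumes "hol_germ \<gamma>" "h analytic_on {0}" shows "hol_germ (\<lambda>t. zw (\<gamma> t) (h t))"
  unfolding hol_germ_def
proof
  fix k show "(\<lambda>t. zw (\<gamma> t) (h t) $ k) analytic_on {0}"
    using assms by (cases k) (simp_all add: zw_def hol_germ_def)
qed

text \<open>The sum of S \<circ> \<gamma>, up to sign and constant term, serves as w-component of a
  curve on which 2 Re w + F vanishes to every order. The inverse coordinate carries it to p, and
  \<open>defining_function_le_rho\<close> passes the estimate to r.\<close>

lemma S_comp_converges_imp_tangent:
  assumes hyp: "real_hypersurface M" and bg: "bg_type_infinite M p" "p \<in> M"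
    and gc: "good_coord M p U \<Phi> W F"
    and \<gamma>: "\<gamma> \<in> Gamma_hat" and conv: "fps_converges_near0 (S_comp F \<gamma>)"
  shows "\<exists>U r. \<exists>\<gamma>\<in>Gamma p. local_defining_fn M p U r \<and> (\<forall>N::nat. (\<lambda>t. r (\<gamma> t)) \<in> O[at 0](\<lambda>t. cmod t ^ N))"
proof -
  note g = good_coordD[OF gc] and i = good_coord_inverse[OF gc] and \<gamma>D = Gamma_hatD[OF \<gamma>]
  let ?\<Psi> = "inv_into U \<Phi>"
  define S where "S = S_comp F \<gamma>"
  obtain \<epsilon> where \<epsilon>: "\<epsilon> > 0" "\<And>t. cmod t < \<epsilon> \<Longrightarrow> summable (\<lambda>k. fps_nth S k * t ^ k)"
    using conv unfolding fps_converges_near0_def S_def by blast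
  have "conv_radius (fps_nth S) \<ge> norm (complex_of_real (\<epsilon> / 2))"
    using \<epsilon> by (intro conv_radius_geI \<epsilon>(2)) simp
  then have "fps_conv_radius S > 0"
    unfolding fps_conv_radius_def using \<epsilon>(1)
    by (metis ereal_less(2) half_gt_zero less_le_trans norm_of_real zero_less_abs_iff less_irrefl)
  then have Sx: "eval_fps S has_fps_expansion S" by (rule eval_fps_has_fps_expansion)
  have FS: "vanishes N (\<lambda>t. F (\<gamma> t) - 2 * Re (\<Sum>k<N. fps_nth S k * t ^ k))" if "N \<ge> 2" for N
    using good_coord_pure[OF bg gc that] F_curve_expansion[OF g(6,5) _ _ \<gamma>D(1,2)] unfolding S_def by blast
  \<comment> \<open>The constant coefficient is subtracted so that the curve starts at 0. It is
    purely imaginary, as \<open>S0\<close> shows, so Re h is still - Re (S \<circ>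
    \<gamma>).\<close>
  define h where "h = (\<lambda>t. fps_nth S 0 - eval_fps S t)"
  define c where "c = (\<lambda>t. zw (\<gamma> t) (h t))"
  have "h analytic_on {0}"
    unfolding h_def by (intro analytic_on_diff analytic_on_const has_fps_expansion_imp_analytic_0[OF Sx])
  then have c: "hol_germ c"
    unfolding c_def by (intro hol_germ_zw \<gamma>D)
  have c0: "c 0 = 0"
    by (simp add: c_def h_def \<gamma>D(2) eval_fps_at_0)
  have "F (\<gamma> 0) - 2 * Re (\<Sum>k<Suc (Suc 0). fps_nth S k * 0 ^ k) = 0"
    using vanishes_zero_at[OF FS[of "Suc (Suc 0)"]] by simp
  then have S0: "Re (fps_nth S 0) = 0"
    using g(7) \<gamma>D(2) by simp
  have van: "vanishes N (\<lambda>t. rho F (c t))" for N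
  proof -
    have "vanishes (N + 2) (\<lambda>t. 2 * Re (eval_fps S t - (\<Sum>k<N + 2. fps_nth S k * t ^ k)))"
      by (rule vanishes_linear[OF has_fps_expansion_vanishes[OF Sx]])
        (intro bounded_linear_const_mult bounded_linear_Re)
    from vanishes_diff[OF FS[of "N + 2"] this]
    have "vanishes (N + 2) (\<lambda>t. F (\<gamma> t) - 2 * Re (eval_fps S t))"
      by (simp del: Re_sum sum.lessThan_Suc)
    then have "vanishes (N + 2) (\<lambda>t. rho F (c t))"
      using S0 by (simp add: rho_def c_def h_def algebra_simps)
    then show ?thesis by (rule vanishes_mono) simp
  qed
  obtain V r where r: "local_defining_fn M p V r"
    using hyp bg(2) unfolding real_hypersurface_def by blast
  obtain C where C: "\<forall>\<^sub>F y in nhds 0. \<bar>r (?\<Psi> y)\<bar> \<le> C * \<bar>rho F y\<bar>"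
    using defining_function_le_rho[OF gc r] by blast
  have cl: "filterlim c (nhds 0) (nhds 0)"
    using isCont_tendsto_nhds[OF hol_germ_continuous[OF c]] c0 by simp
  define \<delta> where "\<delta> = (\<lambda>t. ?\<Psi> (c t))"
  have \<delta>: "hol_germ \<delta>" "\<delta> 0 = p"
    unfolding \<delta>_def using holo_map_on_hol_germ[OF i(1) c] c0 i(2,3) by simp_all
  have "\<not> (\<forall>\<^sub>F t in nhds 0. \<delta> t = p)"
  proof
    assume "\<forall>\<^sub>F t in nhds 0. \<delta> t = p"
    moreover have "\<forall>\<^sub>F t in nhds 0. c t \<in> \<Phi> ` U"
      by (rule hol_germ_eventually_in[OF c i(4)]) (simp add: c0 i(2))
    ultimately have "\<forall>\<^sub>F t in nhds 0. \<gamma> t = 0"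
    proof eventually_elim
      case (elim t)
      then have "c t = 0" using i(5)[of "c t"] g(4) by (simp add: \<delta>_def)
      then have "zpart (c t) = 0" by simp
      then show ?case by (simp add: c_def)
    qed
    then show False using \<gamma>D(3) by blast
  qed
  then have "\<delta> \<in> Gamma p"
    using \<delta> by (simp add: Gamma_def hol_germ_iff)
  moreover have "(\<lambda>t. r (\<delta> t)) \<in> O[at 0](\<lambda>t. cmod t ^ N)" for N
  proof (intro vanishes_imp_bigo vanishes_dominated[OF _ van])
    show "\<forall>\<^sub>F t in nhds 0. norm (r (\<delta> t)) \<le> C * norm (rho F (c t))"
      using eventually_compose_filterlim[OF C cl] by (simp add: \<delta>_def)
  qed
  ultimately show ?thesis using r by blast
qed

lemma tangent_imp_flat:
  fixes M :: "(complex^('n::finite option)) set"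
  assumes bg: "bg_type_infinite M p" "p \<in> M" and gc: "good_coord M p U \<Phi> W F"
    and r: "local_defining_fn M p V r" and \<delta>: "\<delta> \<in> Gamma p"
    and tang: "\<And>N::nat. (\<lambda>t. r (\<delta> t)) \<in> O[at 0](\<lambda>t. cmod t ^ N)"
  shows "\<exists>U \<Phi> W F. \<exists>\<gamma>\<in>(Gamma_hat :: (complex \<Rightarrow> complex^'n) set).
    good_coord M p U \<Phi> W F \<and> flat_at0 (\<lambda>t. F (\<gamma> t))"
proof -
  note g = good_coordD[OF gc] and i = good_coord_inverse[OF gc]
  have \<delta>D: "hol_germ \<delta>" "\<delta> 0 = p" "\<not> (\<forall>\<^sub>F t in nhds 0. \<delta> t = p)"
    using \<delta> by (auto simp: Gamma_def hol_germ_iff)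
  define c where "c = (\<lambda>t. \<Phi> (\<delta> t))"
  have c: "hol_germ c" "c 0 = 0"
    unfolding c_def using holo_map_on_hol_germ[OF g(3) \<delta>D(1)] \<delta>D(2) g(2,4) by simp_all
  have van: "vanishes N (\<lambda>t. rho F (c t))" for N
  proof -
    obtain C where C: "\<forall>\<^sub>F x in nhds p. \<bar>rho F (\<Phi> x)\<bar> \<le> C * \<bar>r x\<bar>"
      using rho_le_defining_function[OF gc r bg(2)] by blast
    have "filterlim \<delta> (nhds p) (nhds 0)"
      using isCont_tendsto_nhds[OF hol_germ_continuous[OF \<delta>D(1)]] \<delta>D(2) by simp
    from eventually_compose_filterlim[OF C this]
    have 1: "\<forall>\<^sub>F t in nhds 0. norm (rho F (c t)) \<le> C * norm (r (\<delta> t))" by (simp add: c_def)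
    have "r (\<delta> 0) = 0" using r bg(2) \<delta>D(2) unfolding local_defining_fn_def by blast
    then have "vanishes N (\<lambda>t. r (\<delta> t))" using tang by (intro bigo_imp_vanishes)
    then show ?thesis by (rule vanishes_dominated[OF 1])
  qed
  have wan: "(\<lambda>t. wpart (c t)) analytic_on {0}" using c(1) by (simp add: hol_germ_def wpart_def)
  have w0: "wpart (c 0) = 0" by (simp add: c(2) wpart_def)
  have z: "hol_germ (\<lambda>t. zpart (c t))" using c(1) by (simp add: hol_germ_def zpart_def)
  \<comment> \<open>If z stayed at 0, the model function would reduce to 2 Re w. Vanishing to every
    order would force w = 0 near t = 0, and \<delta> would be constant.\<close>
  have "\<not> (\<forall>\<^sub>F t in nhds 0. zpart (c t) = 0)"
  proof
    assume z0: "\<forall>\<^sub>F t in nhds 0. zpart (c t) = 0"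
    have "vanishes N (\<lambda>t. Re (wpart (c t)))" for N
    proof -
      have "\<forall>\<^sub>F t in nhds 0. rho F (c t) = 2 * Re (wpart (c t))"
        using z0 by eventually_elim (simp add: rho_def g(7))
      from vanishes_cong[OF this] have "vanishes N (\<lambda>t. 2 * Re (wpart (c t)))"
        using van by simp
      from vanishes_linear[OF this bounded_linear_divide[of 2]] show ?thesis by simp
    qed
    then have "vanishes N (\<lambda>t. wpart (c t))" for N
      by (intro vanishes_of_Re_vanishes wan w0)
    then have "\<forall>\<^sub>F t in nhds 0. wpart (c t) = 0"
      by (intro analytic_vanishes_all wan)
    moreover have "\<forall>\<^sub>F t in nhds 0. \<delta> t \<in> U"
      by (rule hol_germ_eventually_in[OF \<delta>D(1) g(1)]) (simp add: \<delta>D(2) g(2))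
    ultimately have "\<forall>\<^sub>F t in nhds 0. \<delta> t = p"
      using z0
    proof eventually_elim
      case (elim t)
      have "c t $ k = 0" for k
        using elim by (cases k) (auto simp: zpart_def wpart_def vec_eq_iff)
      then have "\<Phi> (\<delta> t) = 0" by (simp add: c_def vec_eq_iff)
      then show ?case using i(7)[of "\<delta> t"] i(3) elim by simp
    qed
    then show False using \<delta>D(3) by blast
  qed
  then obtain j where j: "\<not> (\<forall>\<^sub>F t in nhds 0. zpart (c t) $ j = 0)"
    using eventually_all_finite[of "\<lambda>t j. zpart (c t) $ j = 0" "nhds 0"] by (auto simp: vec_eq_iff)
  have jan: "(\<lambda>t. zpart (c t) $ j) analytic_on {0}" using z by (simp add: hol_germ_def)
  obtain m \<sigma> where \<sigma>: "m > 0" "\<sigma> analytic_on {0}" "\<sigma> 0 = 0" "\<forall>\<^sub>F t in nhds 0. zpart (c (\<sigma> t)) $ j = t ^ m"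
    by (rule reparametrize_to_power[OF jan _ j]) (simp_all add: c(2))
  define \<gamma> where "\<gamma> = (\<lambda>t. zpart (c (\<sigma> t)))"
  define h where "h = (\<lambda>t. wpart (c (\<sigma> t)))"
  have \<sigma>comp: "(\<lambda>t. f (\<sigma> t)) analytic_on {0}" if "f analytic_on {0}" for f
    using analytic_on_compose[of \<sigma> "{0}" f] \<sigma>(2,3) that by (simp add: o_def)
  have \<gamma>: "hol_germ \<gamma>" "\<gamma> 0 = 0"
    using z \<sigma>comp[of "\<lambda>t. zpart (c t) $ _"] by (auto simp: \<gamma>_def hol_germ_def \<sigma>(3) c(2))
  have han: "h analytic_on {0}" "h 0 = 0"
    unfolding h_def by (rule \<sigma>comp[OF wan]) (simp add: \<sigma>(3) w0)
  have \<sigma>1: "vanishes 1 \<sigma>"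
    using analytic_vanishes[OF \<sigma>(2), of 1] \<sigma>(3) by (simp add: fps_expansion_nth_01)
  have F\<gamma>: "vanishes N (\<lambda>t. 2 * Re (h t) + F (\<gamma> t))" for N
    using vanishes_compose[OF van \<sigma>1, of N] by (simp add: rho_def h_def \<gamma>_def)
  \<comment> \<open>Q matches F to order N + 2, so Re (Q \<circ> \<gamma>) matches - Re h along the
    curve; both functions are holomorphic with value 0 at 0, so the real parts decide. The surplus 2
    meets the bound in \<open>good_coord_pure\<close>.\<close>
  have approx: "\<exists>Q. hol_poly 2 Q \<and> vanishes N (\<lambda>t. Q (\<gamma> t) - (- h t))" for N
  proof -
    obtain Q where Q: "hol_poly 2 Q" "vanishes (N + 2) (\<lambda>z. F z - 2 * Re (Q z))"
      using good_coord_pure[OF bg gc, of "N + 2"] by auto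
    have "vanishes (N + 2) (\<lambda>t. F (\<gamma> t) - 2 * Re (Q (\<gamma> t)))"
      by (rule vanishes_compose[OF Q(2) hol_germ_vanishes_1[OF \<gamma>]])
    from vanishes_diff[OF F\<gamma> this]
    have "vanishes (N + 2) (\<lambda>t. 2 * Re (Q (\<gamma> t) + h t))" by (simp add: algebra_simps)
    from vanishes_linear[OF this bounded_linear_divide[of 2]]
    have "vanishes (N + 2) (\<lambda>t. Re (Q (\<gamma> t) + h t))" by (simp add: add_divide_distrib)
    moreover have "(\<lambda>t. Q (\<gamma> t) + h t) analytic_on {0}"
      by (intro analytic_intros hol_poly_curve_analytic[OF Q(1)] \<gamma> han)
    moreover have "Q (\<gamma> 0) + h 0 = 0"
      using vanishes_zero_at[of 1 Q] hol_poly_vanishes[OF Q(1)] \<gamma>(2) han(2) by (simp add: numeral_2_eq_2)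
    ultimately have "vanishes (N + 2) (\<lambda>t. Q (\<gamma> t) + h t)"
      by (intro vanishes_of_Re_vanishes)
    then have "vanishes N (\<lambda>t. Q (\<gamma> t) + h t)" by (rule vanishes_mono) simp
    then show ?thesis using Q(1) by auto
  qed
  \<comment> \<open>The sign is chosen for the new coordinate w + G(z): its value along the curve is
    h - h = 0, which leaves F - 2 Re G flat there.\<close>
  obtain V0 G where G: "open V0" "0 \<in> V0" "smooth_on V0 G" "\<And>x. x \<in> V0 \<Longrightarrow> cdiff G x" "vanishes 2 G"
    "\<forall>\<^sub>F t in nhds 0. G (\<gamma> t) = - h t"
  proof (rule convergent_solution[OF \<gamma>(1) \<sigma>(1), where h = "\<lambda>t. - h t" and j = j])
    show "\<forall>\<^sub>F t in nhds 0. \<gamma> t $ j = t ^ m" using \<sigma>(4) by (simp add: \<gamma>_def)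
    show "(\<lambda>t. - h t) analytic_on {0}" by (intro analytic_intros han)
  qed (use approx in blast)+
  have W: "open (V0 \<inter> W)" "0 \<in> V0 \<inter> W" "V0 \<inter> W \<subseteq> W"
    using G(1,2) g(5) smooth_on_open[OF g(6)] by auto
  obtain U' \<Phi>' where gc': "good_coord M p U' \<Phi>' (V0 \<inter> W) (\<lambda>z. F z - 2 * Re (G z))"
    using good_coord_shear[OF gc W smooth_on_subset[OF G(3) W(1)] _ G(5) good_coord_vanishes_2[OF gc]] G(4) by auto
  have "\<gamma> \<in> Gamma_hat"
  proof -
    have "\<not> (\<forall>\<^sub>F t in nhds 0. \<gamma> t = 0)"
    proof
      assume "\<forall>\<^sub>F t in nhds 0. \<gamma> t = 0"
      with \<sigma>(4) have "\<forall>\<^sub>F t in nhds 0. t ^ m = (0::complex)"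
        by eventually_elim (simp add: \<gamma>_def)
      then have "(\<lambda>t::complex. t ^ m) has_fps_expansion 0" by (simp add: has_fps_expansion_0_iff)
      from fps_nth_fps_expansion[OF this, of m] fps_nth_fps_expansion[OF has_fps_expansion_fps_X_power[of m], of m]
      show False by simp
    qed
    then show ?thesis using \<gamma> by (simp add: Gamma_hat_def hol_germ_iff)
  qed
  moreover have "vanishes N (\<lambda>t. F (\<gamma> t) - 2 * Re (G (\<gamma> t)))" for N
  proof -
    have "\<forall>\<^sub>F t in nhds 0. 2 * Re (h t) + F (\<gamma> t) = F (\<gamma> t) - 2 * Re (G (\<gamma> t))"
      using G(6) by eventually_elim simp
    from vanishes_cong[OF this] show ?thesis using F\<gamma> by simp
  qed
  then have "flat_at0 (\<lambda>t. F (\<gamma> t) - 2 * Re (G (\<gamma> t)))"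
    using flat_at0_iff[OF good_coordD(6)[OF gc'] W(2) \<gamma>] by simp
  ultimately show ?thesis using gc' by blast
qed

theorem theorem6p3:
  fixes M :: "(complex^('n::finite option)) set" and p :: "complex^('n option)"
  assumes "real_hypersurface M" and "p \<in> M"
    and "\<exists>U \<Phi> W F. good_coord M p U \<Phi> W F"
    and "bg_type_infinite M p"
  shows "((\<exists>U r. \<exists>\<gamma>\<in>Gamma p. local_defining_fn M p U r \<and>
              (\<forall>N::nat. (\<lambda>t. r (\<gamma> t)) \<in> O[at 0](\<lambda>t. cmod t ^ N)))
          \<longleftrightarrow> (\<exists>U \<Phi> W F. \<exists>\<gamma>\<in>(Gamma_hat :: (complex \<Rightarrow> complex^'n) set).
                  good_coord M p U \<Phi> W F \<and> flat_at0 (\<lambda>t. F (\<gamma> t))))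
       \<and> ((\<exists>U \<Phi> W F. \<exists>\<gamma>\<in>(Gamma_hat :: (complex \<Rightarrow> complex^'n) set).
                  good_coord M p U \<Phi> W F \<and> flat_at0 (\<lambda>t. F (\<gamma> t)))
          \<longleftrightarrow> (\<exists>U \<Phi> W F. \<exists>\<gamma>\<in>(Gamma_hat :: (complex \<Rightarrow> complex^'n) set).
                  good_coord M p U \<Phi> W F \<and> fps_converges_near0 (S_comp F \<gamma>)))"
proof -
  note bg = assms(4,2)
  obtain U \<Phi> W F where gc: "good_coord M p U \<Phi> W F" using assms(3) by blast
  let ?tangent = "\<exists>U r. \<exists>\<gamma>\<in>Gamma p. local_defining_fn M p U r \<and>
    (\<forall>N::nat. (\<lambda>t. r (\<gamma> t)) \<in> O[at 0](\<lambda>t. cmod t ^ N))"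
  let ?flat = "\<exists>U \<Phi> W F. \<exists>\<gamma>\<in>(Gamma_hat :: (complex \<Rightarrow> complex^'n) set).
    good_coord M p U \<Phi> W F \<and> flat_at0 (\<lambda>t. F (\<gamma> t))"
  let ?conv = "\<exists>U \<Phi> W F. \<exists>\<gamma>\<in>(Gamma_hat :: (complex \<Rightarrow> complex^'n) set).
    good_coord M p U \<Phi> W F \<and> fps_converges_near0 (S_comp F \<gamma>)"
  \<comment> \<open>The implications close a cycle. Only this one changes the coordinate; the other
    two keep both the coordinate and the curve in z-space.\<close>
  have "?tangent \<Longrightarrow> ?flat" using tangent_imp_flat[OF bg gc] by blast
  moreover have "?flat \<Longrightarrow> ?conv" using flat_imp_S_comp_converges[OF bg] by blast
  moreover have "?conv \<Longrightarrow> ?tangent" using S_comp_converges_imp_tangent[OF assms(1) bg] by blast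
  ultimately show ?thesis by blast
qed

end
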